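(* There exist a simply connected open subset $U$ of $\mathbb{C}$ containing the origin and a holomorphic map $f:U\to\mathbb{C}$ with $f(0)=0$ such that $f$ has at $0$ a Siegel disk $\Delta$ that is compactly contained in $U$ (i.e. the closure of $\Delta$ in $\mathbb{C}$ is compact and contained in $U$) and whose boundary $\partial\Delta$ is a pseudo circle.
   Context: Siegel disk: the Siegel disk of $f$ at the fixed point $0$ is the maximal domain $\Delta$ containing $0$ on which $f$ is conjugate to an irrational rotation, i.e. the maximal domain $\Delta\ni 0$ contained in the domain of $f$ for which there is a conformal bijection $\phi$ from $\Delta$ to a disk centered at $0$ or to $\mathbb{C}$, with $\phi(0)=0$ and $\phi(f(z))=e^{2\pi i\theta}\phi(z)$ for all $z\in\Delta$, for some irrational real number $\theta$ (where $f'(0)=e^{2\pi i\theta}$). Pseudo circle: a continuum is a nonempty compact connected metrizable space. A continuum is indecomposable if it is not the union of two proper subcontinua, and hereditarily indecomposable if each of its subcontinua is indecomposable. A circular chain in a topological space is a finite family $(e_i)_{i\in\mathbb{Z}/m\mathbb{Z}}$ of open subsets (called links), with $m\ge 4$, such that $e_i\cap e_j\ne\emptyset$ if and only if $i,j$ are adjacent or equal in $\mathbb{Z}/m\mathbb{Z}$. A continuum is circularly chainable if for every $\varepsilon>0$ it is covered by a circular chain all of whose links have diameter less than $\varepsilon$. A pseudo circle is a circularly chainable and hereditarily indecomposable planar continuum that separates the plane into two components; it is unique up to homeomorphism. *)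

theory Defs
  imports "HOL-Complex_Analysis.Complex_Analysis"
begin

text \<open>A continuum is realised as a subset of a metric space, so metrizability is automatic.\<close>

definition continuum :: "'a::metric_space set \<Rightarrow> bool" where
  "continuum X \<longleftrightarrow> X \<noteq> {} \<and> compact X \<and> connected X"

definition indecomposable_continuum :: "'a::metric_space set \<Rightarrow> bool" where
  "indecomposable_continuum X \<longleftrightarrow>
     continuum X \<and>
     \<not> (\<exists>A B. continuum A \<and> continuum B \<and> A \<subset> X \<and> B \<subset> X \<and> X = A \<union> B)"

definition hereditarily_indecomposable :: "'a::metric_space set \<Rightarrow> bool" where
  "hereditarily_indecomposable X \<longleftrightarrow>
     (\<forall>K. K \<subseteq> X \<and> continuum K \<longrightarrow> indecomposable_continuum K)"

text \<open>The indices in \<open>\<int>/m\<int>\<close> are represented by the residues \<open>0, \<dots>, m - 1\<close>.\<close>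

definition circular_chain :: "'a topology \<Rightarrow> nat \<Rightarrow> (nat \<Rightarrow> 'a set) \<Rightarrow> bool" where
  "circular_chain T m e \<longleftrightarrow>
     4 \<le> m \<and>
     (\<forall>i<m. openin T (e i)) \<and>
     (\<forall>i<m. \<forall>j<m. e i \<inter> e j \<noteq> {} \<longleftrightarrow>
        i = j \<or> j = (i + 1) mod m \<or> i = (j + 1) mod m)"

text \<open>The links of the chain are open in the space \<open>X\<close> itself. As subsets of a compact set
  they are bounded, so \<^const>\<open>diameter\<close> has its usual meaning for them.\<close>

definition circularly_chainable :: "'a::metric_space set \<Rightarrow> bool" where
  "circularly_chainable X \<longleftrightarrow>
     continuum X \<and>
     (\<forall>\<epsilon>>0. \<exists>m e. circular_chain (top_of_set X) m e \<and>
        X \<subseteq> (\<Union>i<m. e i) \<and> (\<forall>i<m. diameter (e i) < \<epsilon>))"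

definition pseudo_circle :: "complex set \<Rightarrow> bool" where
  "pseudo_circle X \<longleftrightarrow>
     continuum X \<and> circularly_chainable X \<and> hereditarily_indecomposable X \<and>
     card (components (- X)) = 2"

definition conformal_bijection :: "(complex \<Rightarrow> complex) \<Rightarrow> complex set \<Rightarrow> complex set \<Rightarrow> bool" where
  "conformal_bijection \<phi> D V \<longleftrightarrow> \<phi> holomorphic_on D \<and> bij_betw \<phi> D V"

text \<open>The functions \<open>f\<close> and \<open>\<phi>\<close> are total in HOL, and only their values on \<open>U\<close> and \<open>D\<close>
  are meaningful. The invariance \<open>f z \<in> D\<close>, implicit in writing \<open>\<phi> (f z)\<close> for a map
  \<open>\<phi>\<close> defined on \<open>D\<close>, is therefore stated explicitly.\<close>

definition rotation_domain :: "(complex \<Rightarrow> complex) \<Rightarrow> complex set \<Rightarrow> complex set \<Rightarrow> bool" where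
  "rotation_domain f U D \<longleftrightarrow>
     open D \<and> connected D \<and> 0 \<in> D \<and> D \<subseteq> U \<and>
     (\<exists>\<theta>::real. \<theta> \<notin> \<rat> \<and> deriv f 0 = cis (2 * pi * \<theta>) \<and>
        (\<exists>\<phi> V. (V = UNIV \<or> (\<exists>r>0. V = ball 0 r)) \<and>
           conformal_bijection \<phi> D V \<and> \<phi> 0 = 0 \<and>
           (\<forall>z\<in>D. f z \<in> D \<and> \<phi> (f z) = cis (2 * pi * \<theta>) * \<phi> z)))"

definition siegel_disk :: "(complex \<Rightarrow> complex) \<Rightarrow> complex set \<Rightarrow> complex set \<Rightarrow> bool" where
  "siegel_disk f U \<Delta> \<longleftrightarrow>
     rotation_domain f U \<Delta> \<and> (\<forall>D. rotation_domain f U D \<longrightarrow> D \<subseteq> \<Delta>)"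

end

(* The map is a limit of maps F n with G n (F n z) = exp(2 pi i theta n) G n z, where theta n is
   rational with denominator q and G n is an entire immersion vanishing only at 0, so that rotations
   lift through G n locally. One replaces G n by k o G n, where the entire immersion k commutes with
   the rotation by 1/q. Then F n also lifts the rotation by theta n through k o G n, and rotations by
   nearby angles lift to maps close to F n on a fixed disc. The immersion k is chosen close to the
   Riemann map of a domain whose boundary collar runs back and forth along the circle in a crooked
   way; this shrinks the linearization disc, whose boundary falls into a thin crooked annulus. The
   nested annuli intersect in a pseudo circle bounding an invariant domain of the limit map, on which
   that map is a rotation by the Schwarz lemma. A larger rotation domain would put an analytic Jordan
   curve inside the pseudo circle, contradicting hereditary indecomposability. *)

theory Submission
  imports Defs "HOL-Analysis.Kronecker_Approximation_Theorem"
begin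

section \<open>Crooked maps of the line\<close>

text \<open>Two demands conflict: the linearization discs must shrink onto a domain with a wild
  boundary, yet all \<open>F n\<close> must live on one fixed disc. This is why \<open>G n\<close>
  is entire with nowhere vanishing derivative instead of a Riemann map of the n-th disc: a lift
  through such a map continues beyond the linearization disc and survives small changes of the
  angle. Rational angles are forced by the rigidity of irrational ones: an entire map commuting with
  an irrational rotation is linear and changes no shape, whereas commuting with a rotation of finite
  order q leaves all q-fold symmetric domains available. Hence the crooked pattern has to commute
  with translation by 1/q. Polynomial approximation of the Riemann map itself would not do, since a
  polynomial without critical points is affine. What is approximated is the logarithm of
  \<open>z k' / k\<close>; whatever the approximant, its exponential has no zeros, and integrating
  back yields a map without critical points.\<close>

definition doubles_back :: "(real \<Rightarrow> real) \<Rightarrow> real \<Rightarrow> real \<Rightarrow> bool" where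
  "doubles_back p s t \<longleftrightarrow>
     (\<exists>c d. s \<le> c \<and> c \<le> d \<and> d \<le> t \<and> \<bar>p c - p t\<bar> \<le> 1 \<and> \<bar>p d - p s\<bar> \<le> 1)"

lemma doubles_back_subinterval:
  assumes "doubles_back p s' t'" "s \<le> s'" "t' \<le> t" "p s' = p s" "p t' = p t"
  shows "doubles_back p s t"
  using assms unfolding doubles_back_def by (smt (verit))

lemma doubles_back_cong:
  assumes "doubles_back p s t" "s \<le> t" "\<And>x. x \<in> {s..t} \<Longrightarrow> q x = p x"
  shows "doubles_back q s t"
proof -
  obtain c d where "s \<le> c" "c \<le> d" "d \<le> t" "\<bar>p c - p t\<bar> \<le> 1" "\<bar>p d - p s\<bar> \<le> 1"
    using assms(1) unfolding doubles_back_def by blast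
  then show ?thesis
    unfolding doubles_back_def using assms(2,3) by (intro exI[of _ c] exI[of _ d]) auto
qed

lemma doubles_back_shift:
  assumes "doubles_back p (s - b) (t - b)"
  shows "doubles_back (\<lambda>x. c + p (x - b)) s t"
proof -
  obtain u v where "s - b \<le> u" "u \<le> v" "v \<le> t - b" "\<bar>p u - p (t - b)\<bar> \<le> 1" "\<bar>p v - p (s - b)\<bar> \<le> 1"
    using assms unfolding doubles_back_def by blast
  then show ?thesis
    unfolding doubles_back_def by (intro exI[of _ "u + b"] exI[of _ "v + b"]) auto
qed

lemma doubles_back_reflect:
  assumes "doubles_back p (b - t) (b - s)"
  shows "doubles_back (\<lambda>x. c + p (b - x)) s t"
proof -
  obtain u v where "b - t \<le> u" "u \<le> v" "v \<le> b - s" "\<bar>p u - p (b - s)\<bar> \<le> 1" "\<bar>p v - p (b - t)\<bar> \<le> 1"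
    using assms unfolding doubles_back_def by blast
  then show ?thesis
    unfolding doubles_back_def by (intro exI[of _ "b - v"] exI[of _ "b - u"]) auto
qed

lemma doubles_back_scale:
  assumes "doubles_back p (k * s) (k * t)" "k > 0"
  shows "doubles_back (\<lambda>x. p (k * x)) s t"
proof -
  obtain u v where "k * s \<le> u" "u \<le> v" "v \<le> k * t" "\<bar>p u - p (k * t)\<bar> \<le> 1" "\<bar>p v - p (k * s)\<bar> \<le> 1"
    using assms(1) unfolding doubles_back_def by blast
  then show ?thesis
    unfolding doubles_back_def using assms(2)
    by (intro exI[of _ "u / k"] exI[of _ "v / k"]) (auto simp: field_simps)
qed

lemma IVT_between:
  fixes p :: "real \<Rightarrow> real"
  assumes "continuous_on {a..b} p" "a \<le> b" "min (p a) (p b) \<le> y" "y \<le> max (p a) (p b)"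
  obtains x where "a \<le> x" "x \<le> b" "p x = y"
  using assms IVT'[of p a y b] IVT2'[of p b y a] by (smt (verit))

text \<open>The intermediate value theorem slides \<open>s\<close> and \<open>t\<close> to points of
  one piece with the same heights, where the assumption on that piece applies: a descent is found on
  the middle piece, an ascent on the first or the third. Only for \<open>p s < 1\<close> and
  \<open>p t > n\<close> can this fail. Then the turning points \<open>b\<close> and
  \<open>c\<close> are the witnesses, their heights \<open>n\<close> and 1 being within 1 of the
  extreme ones.\<close>

lemma doubles_back_concat:
  fixes p :: "real \<Rightarrow> real"
  assumes cont: "continuous_on {a..d} p" and ord: "a \<le> b" "b \<le> c" "c \<le> d"
    and db1: "\<And>s t. \<lbrakk>a \<le> s; s \<le> t; t \<le> b\<rbrakk> \<Longrightarrow> doubles_back p s t"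
    and db2: "\<And>s t. \<lbrakk>b \<le> s; s \<le> t; t \<le> c\<rbrakk> \<Longrightarrow> doubles_back p s t"
    and db3: "\<And>s t. \<lbrakk>c \<le> s; s \<le> t; t \<le> d\<rbrakk> \<Longrightarrow> doubles_back p s t"
    and r1: "\<And>x. \<lbrakk>a \<le> x; x \<le> b\<rbrakk> \<Longrightarrow> 0 \<le> p x \<and> p x \<le> n"
    and r2: "\<And>x. \<lbrakk>b \<le> x; x \<le> c\<rbrakk> \<Longrightarrow> 1 \<le> p x \<and> p x \<le> n"
    and r3: "\<And>x. \<lbrakk>c \<le> x; x \<le> d\<rbrakk> \<Longrightarrow> 1 \<le> p x \<and> p x \<le> n + 1"
    and pb: "p b = n" and pc: "p c = 1"
    and st: "a \<le> s" "s \<le> t" "t \<le> d"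
  shows "doubles_back p s t"
proof -
  have c: "continuous_on {x..y} p" if "a \<le> x" "y \<le> d" for x y
    using cont by (rule continuous_on_subset) (use that in auto)
  consider "t \<le> b" | "b \<le> s" "t \<le> c" | "c \<le> s" | "s \<le> b" "b \<le> t" "t \<le> c" 
    | "b \<le> s" "s \<le> c" "c \<le> t" | "s \<le> b" "c \<le> t" by linarith
  then show ?thesis
  proof cases
    case 1 then show ?thesis using db1 st by auto
  next
    case 2 then show ?thesis using db2 st by auto
  next
    case 3 then show ?thesis using db3 st by auto
  next
    case 4
    show ?thesis
    proof (cases "p s \<le> p t")
      case True
      then obtain t' where "s \<le> t'" "t' \<le> b" "p t' = p t"
        using IVT_between[OF c, of s b "p t"] 4 pb r2[of t] st ord by auto
      then show ?thesis using db1[of s t'] st 4 doubles_back_subinterval[of p s t' s t] by auto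
    next
      case False
      then obtain s' where "b \<le> s'" "s' \<le> t" "p s' = p s"
        using IVT_between[OF c, of b t "p s"] 4 pb r1[of s] st ord by auto
      then show ?thesis using db2[of s' t] st 4 doubles_back_subinterval[of p s' t s t] by auto
    qed
  next
    case 5
    show ?thesis
    proof (cases "p t \<le> p s")
      case True
      then obtain t' where "s \<le> t'" "t' \<le> c" "p t' = p t"
        using IVT_between[OF c, of s c "p t"] 5 pc r3[of t] st ord by auto
      then show ?thesis using db2[of s t'] st 5 doubles_back_subinterval[of p s t' s t] by auto
    next
      case False
      then obtain s' where "c \<le> s'" "s' \<le> t" "p s' = p s"
        using IVT_between[OF c, of c t "p s"] 5 pc r2[of s] st ord by auto
      then show ?thesis using db3[of s' t] st 5 doubles_back_subinterval[of p s' t s t] by auto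
    qed
  next
    case 6
    consider "p t \<le> p s" | "p s \<le> p t" "p t \<le> n" | "p s \<le> p t" "1 \<le> p s" | "n < p t" "p s < 1" by linarith
    then show ?thesis
    proof cases
      case 1
      obtain s' where s': "b \<le> s'" "s' \<le> c" "p s' = p s"
        using IVT_between[OF c, of b c "p s"] 6 pc pb r1[of s] r3[of t] st ord 1 by auto
      then obtain t' where "s' \<le> t'" "t' \<le> c" "p t' = p t"
        using IVT_between[OF c, of s' c "p t"] 6 pc pb r1[of s] r3[of t] st ord 1 by auto
      then show ?thesis using db2[of s' t'] s' st 6 doubles_back_subinterval[of p s' t' s t] by auto
    next
      case 2
      obtain t' where "s \<le> t'" "t' \<le> b" "p t' = p t"
        using IVT_between[OF c, of s b "p t"] 6 2 pb r3[of t] st ord by auto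
      then show ?thesis using db1[of s t'] st 6 ord doubles_back_subinterval[of p s t' s t] by auto
    next
      case 3
      obtain s' where "c \<le> s'" "s' \<le> t" "p s' = p s"
        using IVT_between[OF c, of c t "p s"] 6 3 pc r1[of s] st ord by auto
      then show ?thesis using db3[of s' t] st 6 ord doubles_back_subinterval[of p s' t s t] by auto
    next
      case 4
      have "\<bar>p b - p t\<bar> \<le> 1" "\<bar>p c - p s\<bar> \<le> 1" using 4 6 pb pc r1[of s] r3[of t] st ord by auto
      then show ?thesis unfolding doubles_back_def using 6 ord st by (intro exI[of _ b] exI[of _ c]) auto
    qed
  qed
qed

text \<open>The tolerance is fixed at 1 and the height varies; dividing by the height gives the
  increasingly fine crooked patterns known from the pseudo-arc.\<close>

definition crooked_path :: "(real \<Rightarrow> real) \<Rightarrow> real \<Rightarrow> bool" where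
  "crooked_path p n \<longleftrightarrow> continuous_on {0..1} p \<and> p 0 = 0 \<and> p 1 = n \<and>
     (\<forall>x\<in>{0..1}. 0 \<le> p x \<and> p x \<le> n) \<and>
     (\<forall>s t. 0 \<le> s \<and> s \<le> t \<and> t \<le> 1 \<longrightarrow> doubles_back p s t)"

text \<open>The new path is one of height \<open>n + 1\<close>, a reversed one of height \<open>n\<close> raised by \<open>1\<close>,
  and one of height \<open>n + 1\<close> raised by \<open>1\<close>.\<close>

lemma crooked_path_step:
  assumes p: "crooked_path p (n + 1)" and q: "crooked_path q n" and n: "n \<ge> 0"
  shows "\<exists>r. crooked_path r (n + 2)"
proof -
  define f where "f x = (if x \<le> 1 then p x else if x \<le> 2 then 1 + q (2 - x) else 1 + p (x - 2))" for x
  have pc: "continuous_on {0..1} p" "p 0 = 0" "p 1 = n + 1"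
    and pr: "\<And>x. 0 \<le> x \<Longrightarrow> x \<le> 1 \<Longrightarrow> 0 \<le> p x \<and> p x \<le> n + 1"
    and pd: "\<And>s t. 0 \<le> s \<Longrightarrow> s \<le> t \<Longrightarrow> t \<le> 1 \<Longrightarrow> doubles_back p s t"
    using p unfolding crooked_path_def by auto
  have qc: "continuous_on {0..1} q" "q 0 = 0" "q 1 = n"
    and qr: "\<And>x. 0 \<le> x \<Longrightarrow> x \<le> 1 \<Longrightarrow> 0 \<le> q x \<and> q x \<le> n"
    and qd: "\<And>s t. 0 \<le> s \<Longrightarrow> s \<le> t \<Longrightarrow> t \<le> 1 \<Longrightarrow> doubles_back q s t"
    using q unfolding crooked_path_def by auto
  have f1: "f x = p x" if "x \<le> 1" for x using that by (simp add: f_def)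
  have f2: "f x = 1 + q (2 - x)" if "1 \<le> x" "x \<le> 2" for x
    using that pc qc by (cases "x = 1") (auto simp: f_def)
  have f3: "f x = 1 + p (x - 2)" if "2 \<le> x" for x
    using that pc qc by (cases "x = 2") (auto simp: f_def)
  have "continuous_on {0..1} f" by (rule continuous_on_eq[OF pc(1)]) (simp add: f1)
  moreover have "continuous_on {1..2} f"
  proof -
    have "continuous_on {1..2} (\<lambda>x. 1 + q (2 - x))"
      by (intro continuous_intros continuous_on_compose2[OF qc(1)]) auto
    then show ?thesis by (rule continuous_on_eq) (simp add: f2)
  qed
  moreover have "continuous_on {2..3} f"
  proof -
    have "continuous_on {2..3} (\<lambda>x. 1 + p (x - 2))"
      by (intro continuous_intros continuous_on_compose2[OF pc(1)]) auto
    then show ?thesis by (rule continuous_on_eq) (simp add: f3)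
  qed
  ultimately have "continuous_on ({0..1} \<union> {1..2} \<union> {2..3}) f"
    by (intro continuous_on_closed_Un) auto
  moreover have "{0..1} \<union> {1..2} \<union> {2..3} = {0..3::real}" by auto
  ultimately have fc: "continuous_on {0..3} f" by simp
  have fd: "doubles_back f s t" if "0 \<le> s" "s \<le> t" "t \<le> 3" for s t
  proof (rule doubles_back_concat[OF fc, of 1 2 "n + 1"])
    show "doubles_back f s t" if "0 \<le> s" "s \<le> t" "t \<le> 1" for s t
      by (rule doubles_back_cong[OF pd[OF that]]) (use that f1 in auto)
    show "doubles_back f s t" if "1 \<le> s" "s \<le> t" "t \<le> 2" for s t
      by (rule doubles_back_cong[OF doubles_back_reflect[OF qd, where b = 2 and c = 1]])
        (use that f2 in auto)
    show "doubles_back f s t" if "2 \<le> s" "s \<le> t" "t \<le> 3" for s t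
      by (rule doubles_back_cong[OF doubles_back_shift[OF pd, where b = 2 and c = 1]])
        (use that f3 in auto)
    show "0 \<le> f x \<and> f x \<le> n + 1" if "0 \<le> x" "x \<le> 1" for x using f1 pr that by simp
    show "1 \<le> f x \<and> f x \<le> n + 1" if "1 \<le> x" "x \<le> 2" for x using f2 qr[of "2 - x"] that by auto
    show "1 \<le> f x \<and> f x \<le> n + 1 + 1" if "2 \<le> x" "x \<le> 3" for x using f3 pr[of "x - 2"] that by auto
  qed (use that f1[of 1] f2[of 2] pc qc in auto)
  have fr: "0 \<le> f x \<and> f x \<le> n + 2" if "0 \<le> x" "x \<le> 3" for x
    using that f1[of x] f2[of x] f3[of x] pr[of x] qr[of "2 - x"] pr[of "x - 2"] by (smt (verit))
  have "crooked_path (\<lambda>x. f (3 * x)) (n + 2)"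
    unfolding crooked_path_def
  proof (intro conjI allI impI ballI)
    show "continuous_on {0..1} (\<lambda>x. f (3 * x))"
      by (intro continuous_on_compose2[OF fc] continuous_intros) auto
    show "doubles_back (\<lambda>x. f (3 * x)) s t" if "0 \<le> s \<and> s \<le> t \<and> t \<le> 1" for s t
      by (rule doubles_back_scale[OF fd]) (use that in auto)
  qed (use f1[of 0] f3[of 3] pc fr in auto)
  then show ?thesis by blast
qed

text \<open>The recursion reaches back two heights, so two consecutive heights are carried through
  the induction.\<close>

lemma crooked_path_exists: "\<exists>p. crooked_path p (real n)"
proof -
  have "(\<exists>p. crooked_path p (real n)) \<and> (\<exists>p. crooked_path p (real (Suc n)))"
  proof (induction n)
    case 0
    have "crooked_path (\<lambda>x. 0) 0" "crooked_path (\<lambda>x. x) 1"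
      unfolding crooked_path_def doubles_back_def by (auto, smt (verit))
    then show ?case by auto
  next
    case (Suc n)
    then obtain p q where "crooked_path p (real n + 1)" "crooked_path q (real n)" 
      by (auto simp: add.commute)
    then have "\<exists>r. crooked_path r (real n + 2)" by (intro crooked_path_step) auto
    with Suc show ?case by (auto simp: add.commute)
  qed
  then show ?thesis by blast
qed

text \<open>On \<open>[k, k + 1]\<close> the graph climbs from \<open>k\<close> to
  \<open>k + N + 1\<close> along \<open>p\<close> and then descends to \<open>k + 1\<close> along
  the reverse of \<open>r\<close>. Unless both points already lie on one piece, heights at most
  \<open>N\<close> apart are both attained on a single suitable piece: a rising one if
  \<open>g s \<le> g t\<close>, a falling one otherwise. The intermediate value theorem moves
  \<open>s\<close> and \<open>t\<close> there inward.\<close>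

lemma crooked_periodic_extension:
  fixes N :: nat
  assumes p: "crooked_path p (real N + 1)" and r: "crooked_path r (real N)"
  obtains g :: "real \<Rightarrow> real" where "continuous_on UNIV g" "\<And>x. g (x + 1) = g x + 1"
    "\<And>s t. \<lbrakk>s \<le> t; \<bar>g s - g t\<bar> \<le> real N\<rbrakk> \<Longrightarrow> doubles_back g s t"
proof -
  have pc: "continuous_on {0..1} p" "p 0 = 0" "p 1 = real N + 1"
    and pr: "\<And>x. 0 \<le> x \<Longrightarrow> x \<le> 1 \<Longrightarrow> 0 \<le> p x \<and> p x \<le> real N + 1"
    and pd: "\<And>s t. 0 \<le> s \<Longrightarrow> s \<le> t \<Longrightarrow> t \<le> 1 \<Longrightarrow> doubles_back p s t"
    using p unfolding crooked_path_def by auto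
  have rc: "continuous_on {0..1} r" "r 0 = 0" "r 1 = real N"
    and rr: "\<And>x. 0 \<le> x \<Longrightarrow> x \<le> 1 \<Longrightarrow> 0 \<le> r x \<and> r x \<le> real N"
    and rd: "\<And>s t. 0 \<le> s \<Longrightarrow> s \<le> t \<Longrightarrow> t \<le> 1 \<Longrightarrow> doubles_back r s t"
    using r unfolding crooked_path_def by auto
  define g where "g x = (if frac x \<le> 1/2 then of_int \<lfloor>x\<rfloor> + p (2 * x - 2 * of_int \<lfloor>x\<rfloor>)
      else of_int \<lfloor>x\<rfloor> + 1 + r (2 * of_int \<lfloor>x\<rfloor> + 2 - 2 * x))" for x :: real
  have up: "g x = of_int k + p (2 * x - 2 * of_int k)" if "of_int k \<le> x" "x \<le> of_int k + 1/2" for x k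
  proof -
    have "\<lfloor>x\<rfloor> = k" using that by linarith
    then show ?thesis using that by (simp add: g_def frac_def)
  qed
  have down: "g x = of_int k + 1 + r (2 * of_int k + 2 - 2 * x)" 
    if "of_int k + 1/2 \<le> x" "x \<le> of_int k + 1" for x k
  proof (cases "x = of_int k + 1/2 \<or> x = of_int k + 1")
    case True
    then show ?thesis using up[of k x] up[of "k+1" x] pc rc by auto
  next
    case False
    then have "\<lfloor>x\<rfloor> = k" using that by linarith
    then show ?thesis using that False by (auto simp add: g_def frac_def)
  qed
  have cu: "continuous_on {of_int k..of_int k + 1/2} g" for k
  proof -
    have "continuous_on {of_int k..of_int k + 1/2} (\<lambda>x. of_int k + p (2 * x - 2 * of_int k))"
      by (intro continuous_intros continuous_on_compose2[OF pc(1)]) auto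
    then show ?thesis by (rule continuous_on_eq) (use up in auto)
  qed
  have cd: "continuous_on {of_int k + 1/2..of_int k + 1} g" for k
  proof -
    have "continuous_on {of_int k + 1/2..of_int k + 1} (\<lambda>x. of_int k + 1 + r (2 * of_int k + 2 - 2 * x))"
      by (intro continuous_intros continuous_on_compose2[OF rc(1)]) auto
    then show ?thesis by (rule continuous_on_eq) (use down in auto)
  qed
  have ck: "continuous_on {of_int k - 1/2..of_int k + 1} g" for k
  proof -
    have "continuous_on ({of_int (k-1) + 1/2..of_int (k-1) + 1} \<union> {of_int k..of_int k + 1/2} \<union> {of_int k + 1/2..of_int k + 1}) g"
      by (intro continuous_on_closed_Un cu cd) auto
    moreover have "{of_int (k-1) + 1/2..of_int (k-1) + 1} \<union> {of_int k..of_int k + 1/2} \<union> {of_int k + 1/2..of_int k + 1}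
      = {of_int k - 1/2..of_int k + 1::real}" by auto
    ultimately show ?thesis by simp
  qed
  have "isCont g x" for x
  proof (rule continuous_on_interior[OF ck[of "\<lfloor>x\<rfloor>"]])
    show "x \<in> interior {real_of_int \<lfloor>x\<rfloor> - 1/2..of_int \<lfloor>x\<rfloor> + 1}"
      unfolding interior_atLeastAtMost_real greaterThanLessThan_iff by linarith
  qed
  then have gc: "continuous_on UNIV g" by (simp add: continuous_at_imp_continuous_on)
  have gs: "g (x + 1) = g x + 1" for x
    unfolding g_def frac_def by (auto simp: algebra_simps)
  have c: "continuous_on S g" for S using gc continuous_on_subset by blast
  have gu: "of_int k \<le> g x \<and> g x \<le> of_int k + (real N + 1)" if "of_int k \<le> x" "x \<le> of_int k + 1/2" for x k
    using up[OF that] pr[of "2 * x - 2 * of_int k"] that by auto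
  have gd: "of_int k + 1 \<le> g x \<and> g x \<le> of_int k + (real N + 1)" if "of_int k + 1/2 \<le> x" "x \<le> of_int k + 1" for x k
    using down[OF that] rr[of "2 * of_int k + 2 - 2 * x"] that by auto
  have gk: "g (of_int k) = of_int k" for k using up[of k "of_int k"] pc by auto
  have gm: "g (of_int k + 1/2) = of_int k + (real N + 1)" for k using up[of k "of_int k + 1/2"] pc by auto
  have du: "doubles_back g s t" if "of_int k \<le> s" "s \<le> t" "t \<le> of_int k + 1/2" for s t k
    by (rule doubles_back_cong[OF doubles_back_scale[OF doubles_back_shift[OF pd, where b = "2 * of_int k" and c = "of_int k"], where k = 2]])
      (use that up in auto)
  have dd: "doubles_back g s t" if "of_int k + 1/2 \<le> s" "s \<le> t" "t \<le> of_int k + 1" for s t k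
    by (rule doubles_back_cong[OF doubles_back_scale[OF doubles_back_reflect[OF rd, where b = "2 * of_int k + 2" and c = "of_int k + 1"], where k = 2]])
      (use that down in auto)
  have du': "doubles_back g s t" if "s \<le> s'" "s' \<le> t'" "t' \<le> t" "g s' = g s" "g t' = g t" 
      "of_int k \<le> s'" "t' \<le> of_int k + 1/2" for s t s' t' k
    using doubles_back_subinterval[OF du[of k s' t']] that by auto
  have dd': "doubles_back g s t" if "s \<le> s'" "s' \<le> t'" "t' \<le> t" "g s' = g s" "g t' = g t" 
      "of_int k + 1/2 \<le> s'" "t' \<le> of_int k + 1" for s t s' t' k
    using doubles_back_subinterval[OF dd[of k s' t']] that by auto
  have gge: "real_of_int k \<le> g x" if "of_int k \<le> x" for k x
  proof -
    have "of_int \<lfloor>x\<rfloor> \<le> g x" using gu[of "\<lfloor>x\<rfloor>" x] gd[of "\<lfloor>x\<rfloor>" x] by linarith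
    moreover have "k \<le> \<lfloor>x\<rfloor>" using that by linarith
    ultimately show ?thesis by linarith
  qed
  have gle: "g x \<le> real_of_int k + real N" if "x < of_int k" for k x
  proof -
    have "g x \<le> of_int \<lfloor>x\<rfloor> + (real N + 1)" using gu[of "\<lfloor>x\<rfloor>" x] gd[of "\<lfloor>x\<rfloor>" x] by linarith
    moreover have "\<lfloor>x\<rfloor> \<le> k - 1" using that by linarith
    ultimately show ?thesis by linarith
  qed
  have "doubles_back g s t" if st: "s \<le> t" and dist: "\<bar>g s - g t\<bar> \<le> real N" for s t
  proof -
    define k where "k = \<lfloor>s\<rfloor>"
    have k: "of_int k \<le> s" "s < of_int k + 1" unfolding k_def by linarith+
    show ?thesis
    proof (cases "g s \<le> g t")
      case True
      show ?thesis
      proof (cases "s \<le> of_int k + 1/2 \<and> g t \<le> of_int k + (real N + 1)")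
        case c1: True
        show ?thesis
        proof (cases "t \<le> of_int k + 1/2")
          case False
          obtain t' where "s \<le> t'" "t' \<le> of_int k + 1/2" "g t' = g t"
            using IVT_between[OF c, of s "of_int k + 1/2" "g t"] c1 gm[of k] True by auto
          then show ?thesis using False k by (intro du'[of s s t' t k]) auto
        qed (use du st k in auto)
      next
        case c2: False
        \<comment> \<open>\<open>l\<close> is the start of a later rising piece whose range contains
          both heights. In the exceptional case \<open>t < l\<close> both points lie on the falling
          half of period \<open>k\<close>.\<close>
        have "\<exists>l. l > k \<and> g t \<le> of_int l + (real N + 1) \<and> (t < of_int l \<longrightarrow> l = k + 1 \<and> s > of_int k + 1/2) \<and> of_int l \<le> g s"
        proof (cases "g t \<le> of_int k + 1 + (real N + 1)")
          case True
          have "of_int k + 1 \<le> g s" using c2 gd[of k s] k dist True \<open>g s \<le> g t\<close> by linarith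
          moreover have "s > of_int k + 1/2" if "t < of_int k + 1"
            using c2 gle[of t "k+1"] that by auto
          ultimately show ?thesis using True by (intro exI[of _ "k + 1"]) auto
        next
          case False
          \<comment> \<open>The least integer whose rising piece reaches up to \<open>g t\<close>.
            The bound \<open>N\<close> on the height difference puts it below \<open>g s\<close>,
            and \<open>t\<close> cannot precede it, since heights before \<open>l\<close> do not
            exceed \<open>l + N\<close>.\<close>
          define l where "l = \<lceil>g t - (real N + 1)\<rceil>"
          have l: "g t \<le> of_int l + (real N + 1)" "g t > of_int l + real N" unfolding l_def by linarith+
          then show ?thesis using False dist gle[of t l] by (intro exI[of _ l]) auto
        qed
        then obtain l where l: "l > k" "g t \<le> of_int l + (real N + 1)" "t < of_int l \<longrightarrow> l = k + 1 \<and> s > of_int k + 1/2" 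
          "of_int l \<le> g s" by blast
        show ?thesis
        proof (cases "t < of_int l")
          case True
          then show ?thesis using l dd[of k s t] st by auto
        next
          case tl: False
          have sl: "s \<le> of_int l" using l(1) k by linarith
          show ?thesis
          proof (cases "t \<le> of_int l + 1/2")
            case tl2: True
            obtain s' where "of_int l \<le> s'" "s' \<le> t" "g s' = g s"
              using IVT_between[OF c, of "of_int l" t "g s"] l gk[of l] True tl by auto
            then show ?thesis using sl tl2 by (intro du'[of s s' t t l]) auto
          next
            case False
            obtain s' where s': "of_int l \<le> s'" "s' \<le> of_int l + 1/2" "g s' = g s"
              using IVT_between[OF c, of "of_int l" "of_int l + 1/2" "g s"] l gk[of l] gm[of l] True by auto
            then obtain t' where "s' \<le> t'" "t' \<le> of_int l + 1/2" "g t' = g t"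
              using IVT_between[OF c, of s' "of_int l + 1/2" "g t"] l gm[of l] True by auto
            then show ?thesis using sl s' False by (intro du'[of s s' t' t l]) auto
          qed
        qed
      qed
    next
      case False
      have gsk: "g s \<le> of_int k + (real N + 1)" using gu[of k s] gd[of k s] k by linarith
      show ?thesis
      proof (cases "of_int k + 1 \<le> g t")
        case True
        show ?thesis
        proof (cases "s \<le> of_int k + 1/2")
          case s1: True
          consider "t \<le> of_int k + 1/2" | "of_int k + 1/2 \<le> t" "t \<le> of_int k + 1" | "of_int k + 1 \<le> t" by linarith
          then show ?thesis
          proof cases
            case 1 then show ?thesis using du k st by auto
          next
            case 2
            obtain s' where "of_int k + 1/2 \<le> s'" "s' \<le> t" "g s' = g s"
              using IVT_between[OF c, of "of_int k + 1/2" t "g s"] 2 gm[of k] False gsk by auto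
            then show ?thesis using 2 s1 by (intro dd'[of s s' t t k]) auto
          next
            case 3
            obtain s' where s': "of_int k + 1/2 \<le> s'" "s' \<le> of_int k + 1" "g s' = g s"
              using IVT_between[OF c, of "of_int k + 1/2" "of_int k + 1" "g s"] gk[of "k+1"] gm[of k] False gsk True by auto
            then obtain t' where "s' \<le> t'" "t' \<le> of_int k + 1" "g t' = g t"
              using IVT_between[OF c, of s' "of_int k + 1" "g t"] gk[of "k+1"] False True by auto
            then show ?thesis using s' 3 s1 by (intro dd'[of s s' t' t k]) auto
          qed
        next
          case s2: False
          show ?thesis
          proof (cases "t \<le> of_int k + 1")
            case True then show ?thesis using dd[of k s t] s2 st by auto
          next
            case t3: False
            obtain t' where "s \<le> t'" "t' \<le> of_int k + 1" "g t' = g t"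
              using IVT_between[OF c, of s "of_int k + 1" "g t"] gk[of "k+1"] False True k by auto
            then show ?thesis using s2 t3 by (intro dd'[of s s t' t k]) auto
          qed
        qed
      next
        case gt: False
        have "t < of_int k + 1" using gge[of "k+1" t] gt by fastforce
        moreover have "t \<le> of_int k + 1/2" using gd[of k t] gt calculation by linarith
        ultimately show ?thesis using du k st by auto
      qed
    qed
  qed
  with gc gs show thesis using that by blast
qed

text \<open>A pattern with unit tolerance is shrunk by \<open>Q = q * m\<close>: the factor
  \<open>m\<close> brings the tolerance \<open>1 / Q\<close> below \<open>\<eta>\<close>, and
  \<open>m\<close> unit translations become the translation by \<open>1 / q\<close>. The bound 2
  comes from the application, where the angles of two intersecting continua, after applying
  \<open>g\<close>, each stay within one turn of the angle of a common point.\<close>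

lemma crooked_lift_exists:
  assumes q: "q > 0" and \<eta>: "\<eta> > 0"
  obtains g :: "real \<Rightarrow> real" where "continuous_on UNIV g" "\<And>x. g (x + 1 / real q) = g x + 1 / real q"
    "\<And>s t. \<lbrakk>s \<le> t; \<bar>g s - g t\<bar> \<le> 2\<rbrakk> \<Longrightarrow>
       \<exists>c d. s \<le> c \<and> c \<le> d \<and> d \<le> t \<and> \<bar>g c - g t\<bar> \<le> \<eta> \<and> \<bar>g d - g s\<bar> \<le> \<eta>"
proof -
  obtain m :: nat where m: "m > 0" "1 / real m < \<eta>"
    using \<eta> reals_Archimedean[of \<eta>] by (metis inverse_eq_divide zero_less_Suc)
  define Q where "Q = q * m"
  have Q: "Q > 0" "real Q \<ge> real m" using q m by (auto simp: Q_def)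
  then have Q\<eta>: "1 / real Q \<le> \<eta>" using m frac_le[of 1 1 "real m" "real Q"] by simp
  obtain p r where pr: "crooked_path p (real (Suc (2 * Q)))" "crooked_path r (real (2 * Q))"
    using crooked_path_exists by blast
  have "crooked_path p (real (2 * Q) + 1)" using pr(1) by (simp add: add.commute)
  from crooked_periodic_extension[OF this pr(2)]
  obtain f :: "real \<Rightarrow> real" where f: "continuous_on UNIV f" "\<And>x. f (x + 1) = f x + 1"
    and db: "\<And>s t. \<lbrakk>s \<le> t; \<bar>f s - f t\<bar> \<le> real (2 * Q)\<rbrakk> \<Longrightarrow> doubles_back f s t" by metis
  have fn: "f (x + real n) = f x + real n" for x n
  proof (induction n)
    case (Suc n)
    then show ?case using f(2)[of "x + real n"] by (simp add: add_ac)
  qed auto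
  define g where "g x = f (real Q * x) / real Q" for x
  show thesis
  proof
    show "continuous_on UNIV g" unfolding g_def
      by (intro continuous_intros continuous_on_compose2[OF f(1)]) (use Q in auto)
    show "g (x + 1 / real q) = g x + 1 / real q" for x
    proof -
      have "real Q * (x + 1 / real q) = real Q * x + real m" using q by (simp add: Q_def field_simps)
      then have "g (x + 1 / real q) = (f (real Q * x) + real m) / real Q"
        unfolding g_def by (simp only: fn)
      also have "\<dots> = g x + 1 / real q"
        unfolding g_def using q m by (simp add: Q_def add_divide_distrib)
      finally show ?thesis .
    qed
    fix s t assume st: "s \<le> t" "\<bar>g s - g t\<bar> \<le> 2"
    have gd: "\<bar>g a - g b\<bar> = \<bar>f (real Q * a) - f (real Q * b)\<bar> / real Q" for a b
      unfolding g_def diff_divide_distrib[symmetric] by simp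
    have "\<bar>f (real Q * s) - f (real Q * t)\<bar> \<le> real (2 * Q)"
      using st(2) Q unfolding gd by (simp add: field_simps)
    then obtain c d where cd: "real Q * s \<le> c" "c \<le> d" "d \<le> real Q * t" "\<bar>f c - f (real Q * t)\<bar> \<le> 1" "\<bar>f d - f (real Q * s)\<bar> \<le> 1"
      using db[of "real Q * s" "real Q * t"] st Q unfolding doubles_back_def by auto
    have "1 / real Q * \<bar>f c - f (real Q * t)\<bar> \<le> 1 / real Q * 1" "1 / real Q * \<bar>f d - f (real Q * s)\<bar> \<le> 1 / real Q * 1"
      using cd Q by (intro mult_left_mono; simp)+
    then show "\<exists>c d. s \<le> c \<and> c \<le> d \<and> d \<le> t \<and> \<bar>g c - g t\<bar> \<le> \<eta> \<and> \<bar>g d - g s\<bar> \<le> \<eta>"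
      using Q Q\<eta> cd
      by (intro exI[of _ "c / real Q"] exI[of _ "d / real Q"]) (auto simp: gd field_simps)
  qed
qed

section \<open>Twisted domains\<close>

lemma periodic_real_int:
  fixes p :: "real \<Rightarrow> 'a"
  assumes "\<And>x. p (x + 1) = p x"
  shows "p (x + of_int k) = p x"
proof -
  have nat: "p (x + real n) = p x" for x n
  proof (induction n)
    case (Suc n)
    then show ?case using assms[of "x + real n"] by (simp add: add_ac)
  qed auto
  show ?thesis
  proof (cases "k \<ge> 0")
    case True
    then show ?thesis using nat[of x "nat k"] by simp
  next
    case False
    then show ?thesis using nat[of "x + of_int k" "nat (- k)"] by simp
  qed
qed

lemma cis_2pi_eq_iff: "cis (2 * pi * x) = cis (2 * pi * y) \<longleftrightarrow> (\<exists>k::int. x = y + of_int k)"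
proof -
  have "cis (2 * pi * x) = cis (2 * pi * y) \<longleftrightarrow> (\<exists>k::int. 2 * pi * x = 2 * pi * y + 2 * of_int k * pi)"
    unfolding cis_conv_exp exp_eq by (auto simp: complex_eq_iff algebra_simps)
  also have "\<dots> \<longleftrightarrow> (\<exists>k::int. x = y + of_int k)"
  proof -
    have "2 * pi * x = 2 * pi * y + 2 * of_int k * pi \<longleftrightarrow> x = y + of_int k" for k :: int
    proof -
      have "2 * pi * x = 2 * pi * y + 2 * of_int k * pi \<longleftrightarrow> 2 * pi * x = 2 * pi * (y + of_int k)"
        by (simp add: algebra_simps)
      then show ?thesis by simp
    qed
    then show ?thesis by simp
  qed
  finally show ?thesis .
qed

lemma polar_2pi:
  obtains x where "w = of_real (norm w) * cis (2 * pi * x)" "0 < x" "x \<le> 1"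
proof -
  define y where "y = Arg w / (2 * pi)"
  have y: "w = of_real (norm w) * cis (2 * pi * y)"
    using rcis_cmod_Arg[of w] by (simp add: y_def rcis_def)
  have b: "- (1/2) < y" "y \<le> 1/2" using Arg_bounded[of w] by (auto simp: y_def field_simps)
  show thesis
  proof (cases "y > 0")
    case True
    then show ?thesis using that[of y] y b by auto
  next
    case False
    have "cis (2 * pi * (y + 1)) = cis (2 * pi * y)" 
      unfolding cis_2pi_eq_iff by (intro exI[of _ 1]) auto
    then show ?thesis using that[of "y + 1"] y b False by auto
  qed
qed

text \<open>\<open>P\<close> is read off from \<open>Arg\<close>. Across the negative axis, where
  \<open>Arg\<close> jumps, periodicity permits the argument of \<open>- w\<close> shifted by half a
  turn.\<close>

lemma periodic_on_punctured_plane: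
  fixes p :: "real \<Rightarrow> real"
  assumes p: "continuous_on UNIV p" "\<And>x. p (x + 1) = p x"
  obtains P :: "complex \<Rightarrow> real" where "continuous_on (- {0}) P"
    "\<And>r x. r > 0 \<Longrightarrow> P (of_real r * cis (2 * pi * x)) = p x"
proof -
  define P where "P w = p (Arg w / (2 * pi))" for w
  have Pp: "P (of_real r * cis (2 * pi * x)) = p x" if "r > 0" for r x
  proof -
    let ?w = "of_real r * cis (2 * pi * x)"
    have w0: "?w \<noteq> 0" using that by auto
    have "cis (2 * pi * (Arg ?w / (2 * pi))) = cis (2 * pi * x)"
      using cis_Arg[OF w0] that by (simp add: sgn_mult sgn_of_real)
    then obtain k :: int where "Arg ?w / (2 * pi) = x + of_int k"
      unfolding cis_2pi_eq_iff by blast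
    then show ?thesis unfolding P_def using periodic_real_int[of p, OF p(2)] by simp
  qed
  have pc: "isCont p x" for x using p(1) by (simp add: continuous_on_eq_continuous_at)
  have "isCont P w" if "w \<noteq> 0" for w
  proof (cases "w \<in> \<real>\<^sub>\<le>\<^sub>0")
    case False
    show ?thesis unfolding P_def
      by (intro continuous_intros isCont_o2[OF _ pc] continuous_at_Arg False) auto
  next
    case True
    then have mw: "- w \<notin> \<real>\<^sub>\<le>\<^sub>0" using that by (auto simp: complex_nonpos_Reals_iff complex_eq_iff)
    have c: "isCont (\<lambda>w. p (Arg (- w) / (2 * pi) + 1/2)) w"
      by (intro continuous_intros isCont_o2[OF _ pc] isCont_o2[of w uminus Arg] continuous_at_Arg mw) auto
    have eq: "P v = p (Arg (- v) / (2 * pi) + 1/2)" if "v \<noteq> 0" for v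
    proof -
      have "v = - (of_real (norm v) * cis (Arg (- v)))"
        using rcis_cmod_Arg[of "-v"] by (simp add: rcis_def)
      also have "\<dots> = of_real (norm v) * cis (2 * pi * (Arg (- v) / (2 * pi) + 1/2))"
        by (simp add: distrib_left cis_mult[symmetric])
      finally show ?thesis using Pp[of "norm v" "Arg (- v) / (2 * pi) + 1/2"] that by simp
    qed
    have "\<forall>\<^sub>F v in nhds w. P v = p (Arg (- v) / (2 * pi) + 1/2)"
      by (rule eventually_mono[OF eventually_nhds_in_open[of "- {0}" w]]) (use that eq in auto)
    then show ?thesis using c isCont_cong by force
  qed
  then have "continuous_on (- {0}) P" by (simp add: continuous_at_imp_continuous_on)
  with Pp show thesis using that by blast
qed

text \<open>A star-shaped domain with radial function \<open>y + a p\<close>, where \<open>p x = g x - x\<close>, is twisted by the angle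
  \<open>(|w| - y) / a\<close>. Its boundary point at angle \<open>x\<close> is thus turned by \<open>p x\<close> and ends up at angle \<open>g x\<close>.\<close>

lemma twisted_domain_exists:
  assumes q: "q > 0" and \<rho>: "0 < \<rho>" "\<rho> < 1" and \<tau>: "\<tau> > 0"
  obtains D K and \<xi> :: "complex \<Rightarrow> complex" and g :: "real \<Rightarrow> real"
  where "open D" "simply_connected D" "compact K" "cball 0 \<rho> \<subseteq> K" "K \<subseteq> D" "D \<subseteq> ball 0 1"
    "\<And>w. w \<in> D \<Longrightarrow> cis (2 * pi / real q) * w \<in> D"
    "continuous_on (- {0}) \<xi>" "\<And>w. w \<noteq> 0 \<Longrightarrow> norm (\<xi> w) = 1"
    "continuous_on UNIV g"
    "\<And>s t. \<lbrakk>s \<le> t; \<bar>g s - g t\<bar> \<le> 2\<rbrakk> \<Longrightarrow>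
       \<exists>c d. s \<le> c \<and> c \<le> d \<and> d \<le> t \<and> \<bar>g c - g t\<bar> \<le> \<tau> \<and> \<bar>g d - g s\<bar> \<le> \<tau>"
    "\<And>w x. \<lbrakk>w \<in> D - K; \<xi> w = cis (2 * pi * x)\<rbrakk> \<Longrightarrow>
       \<exists>X. w = of_real (norm w) * cis (2 * pi * X) \<and> \<bar>X - g x\<bar> \<le> \<tau>"
proof -
  obtain g :: "real \<Rightarrow> real" where g: "continuous_on UNIV g" "\<And>x. g (x + 1 / real q) = g x + 1 / real q"
    and crooked: "\<And>s t. \<lbrakk>s \<le> t; \<bar>g s - g t\<bar> \<le> 2\<rbrakk> \<Longrightarrow>
       \<exists>c d. s \<le> c \<and> c \<le> d \<and> d \<le> t \<and> \<bar>g c - g t\<bar> \<le> \<tau> \<and> \<bar>g d - g s\<bar> \<le> \<tau>"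
    using crooked_lift_exists[OF q \<tau>] by metis
  define p where "p x = g x - x" for x
  have pc: "continuous_on UNIV p" unfolding p_def by (intro continuous_intros g)
  have pq: "p (x + 1 / real q) = p x" for x by (simp add: p_def g)
  have pqn: "p (x + real n * (1 / real q)) = p x" for x n
  proof (induction n)
    case (Suc n)
    then show ?case using pq[of "x + real n * (1 / real q)"] by (simp add: algebra_simps add_divide_distrib)
  qed auto
  have p1: "p (x + 1) = p x" for x using pqn[of x q] q by simp
  obtain P where Pc: "continuous_on (- {0}) P" 
    and P: "\<And>r x. r > 0 \<Longrightarrow> P (of_real r * cis (2 * pi * x)) = p x"
    using periodic_on_punctured_plane[OF pc p1] by metis
  have "compact (p ` {0..1})"
    by (intro compact_continuous_image continuous_on_subset[OF pc]) auto
  then obtain B where B: "B > 0" "\<And>x. x \<in> {0..1} \<Longrightarrow> \<bar>p x\<bar> \<le> B"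
    using compact_imp_bounded bounded_pos by (metis imageI real_norm_def)
  have PB: "\<bar>P w\<bar> \<le> B" if "w \<noteq> 0" for w
  proof -
    obtain x where x: "w = of_real (norm w) * cis (2 * pi * x)" "0 < x" "x \<le> 1" using polar_2pi .
    then have "P w = p x" using P[of "norm w" x] that by simp
    then show ?thesis using B(2)[of x] x by simp
  qed
  \<comment> \<open>The radial function \<open>y + a * p\<close> must stay strictly between
    \<open>\<rho>\<close> and 1 with a margin of \<open>a * \<tau>\<close>. So \<open>y\<close> is
    the midpoint of these radii, and \<open>a * (B + \<tau>)\<close> is a quarter of the gap, where
    half of it is available.\<close>
  define y where "y = (1 + \<rho>) / 2"
  define a where "a = (1 - \<rho>) / (4 * (B + \<tau>))"
  have a: "a > 0" using \<rho> B \<tau> by (simp add: a_def)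
  have "(1 - \<rho>) / (4 * s) * s = (1 - \<rho>) / 4" if "s \<noteq> 0" for s using that by simp
  from this[of "B + \<tau>"] have "a * (B + \<tau>) = (1 - \<rho>) / 4" using B \<tau> by (simp add: a_def)
  then have ab: "\<rho> < y - a * (B + \<tau>)" "y + a * (B + \<tau>) < 1" using \<rho> by (auto simp: y_def field_simps)
  have aP: "\<bar>a * P w\<bar> \<le> a * B" if "w \<noteq> 0" for w
    using PB[OF that] a by (simp add: abs_mult)
  have at: "a * \<tau> > 0" using a \<tau> by simp
  \<comment> \<open>The twist preserves the modulus, so its inverse merely reverses the
    angle.\<close>
  define T where "T w = w * cis (2 * pi * ((norm w - y) / a))" for w :: complex
  define T' where "T' w = w * cis (- (2 * pi * ((norm w - y) / a)))" for w :: complex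
  have nT: "norm (T w) = norm w" "norm (T' w) = norm w" for w by (auto simp: T_def T'_def norm_mult)
  have T'T: "T' (T w) = w" and TT': "T (T' w) = w" for w
    unfolding T'_def[of "T w"] T_def[of "T' w"] nT by (simp_all add: T_def T'_def mult.assoc cis_mult)
  have cT: "continuous_on UNIV T" "continuous_on UNIV T'"
    unfolding T_def T'_def using a by (intro continuous_intros; simp)+
  \<comment> \<open>\<open>P\<close> carries no information at 0, which is therefore added by hand.
    \<open>C\<close> is \<open>S\<close> with the radial function lowered by
    \<open>a * \<tau>\<close>; after division by \<open>a\<close>, points between the two are
    twisted by an angle within \<open>\<tau>\<close> of \<open>p\<close>.\<close>
  define S where "S = {w. w = 0 \<or> norm w < y + a * P w}"
  define C where "C = {w. w = 0 \<or> norm w \<le> y - a * \<tau> + a * P w}"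
  have low: "cball 0 \<rho> \<subseteq> C"
  proof
    fix w :: complex assume "w \<in> cball 0 \<rho>"
    then show "w \<in> C" using aP[of w] ab(1) by (cases "w = 0") (auto simp: C_def algebra_simps)
  qed
  have CS: "C \<subseteq> S" using at by (auto simp: C_def S_def)
  have lowS: "ball 0 \<rho> \<subseteq> S" using low CS ball_subset_cball by blast
  have S1: "S \<subseteq> ball 0 1"
  proof
    fix w assume "w \<in> S"
    then show "w \<in> ball 0 1" using aP[of w] ab(2) at by (cases "w = 0") (auto simp: S_def algebra_simps)
  qed
  have "open S"
  proof -
    have "open ((- {0}) \<inter> (\<lambda>w. norm w - a * P w) -` {..<y})"
      by (intro continuous_open_preimage continuous_intros Pc)
    moreover have "S = ball 0 \<rho> \<union> ((- {0}) \<inter> (\<lambda>w. norm w - a * P w) -` {..<y})"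
      using lowS \<rho> unfolding S_def by auto
    ultimately show ?thesis by auto
  qed
  have "compact C"
  proof -
    have "closed ({w. \<rho> \<le> norm w} \<inter> (\<lambda>w. norm w - a * P w) -` {..y - a * \<tau>})"
      using \<rho> by (intro continuous_closed_preimage continuous_intros continuous_on_subset[OF Pc] closed_Collect_le) auto
    moreover have "C = cball 0 \<rho> \<union> ({w. \<rho> \<le> norm w} \<inter> (\<lambda>w. norm w - a * P w) -` {..y - a * \<tau>})"
      using low \<rho> unfolding C_def by auto
    ultimately have "closed C" by auto
    moreover have "bounded C" using CS S1 bounded_ball bounded_subset by blast
    ultimately show ?thesis by (simp add: compact_eq_bounded_closed)
  qed
  have "starlike S"
    unfolding starlike_def
  proof (intro bexI[of _ 0] ballI)
    show "0 \<in> S" by (simp add: S_def)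
    fix w assume w: "w \<in> S"
    show "closed_segment 0 w \<subseteq> S"
    proof
      fix v assume "v \<in> closed_segment 0 w"
      then obtain u where u: "0 \<le> u" "u \<le> 1" "v = u *\<^sub>R w" by (auto simp: closed_segment_def)
      show "v \<in> S"
      proof (cases "v = 0")
        case False
        then have u0: "u > 0" "w \<noteq> 0" using u by auto
        obtain x where x: "w = of_real (norm w) * cis (2 * pi * x)" using polar_2pi by metis
        have "P w = p x" using P[of "norm w" x] u0 x by simp
        moreover have "v = of_real (u * norm w) * cis (2 * pi * x)"
          using u(3) x by (simp add: scaleR_conv_of_real)
        then have "P v = p x" using P[of "u * norm w" x] u0 by simp
        moreover have "norm v \<le> norm w" using u by (simp add: mult_left_le_one_le)
        ultimately show ?thesis using w u0 by (simp add: S_def)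
      qed (simp add: S_def)
    qed
  qed
  then have "simply_connected S" by (rule starlike_imp_simply_connected)
  moreover have hom: "homeomorphism S (T ` S) T T'"
    by (rule homeomorphismI) (auto simp: T'T intro: continuous_on_subset[OF cT(1)] continuous_on_subset[OF cT(2)])
  ultimately have f1: "simply_connected (T ` S)"
    using homeomorphic_simply_connected homeomorphic_def by blast
  have f2: "open (T ` S)"
  proof -
    have "T ` S = T' -` S"
    proof
      show "T' -` S \<subseteq> T ` S" using TT' by (metis image_eqI subsetI vimageE)
    qed (auto simp: T'T)
    then show ?thesis using \<open>open S\<close> cT(2) by (simp add: open_vimage)
  qed
  have f3: "compact (T ` C)" 
    using \<open>compact C\<close> by (intro compact_continuous_image continuous_on_subset[OF cT(1)]) auto
  have f4: "cball 0 \<rho> \<subseteq> T ` C"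
  proof
    fix w :: complex assume "w \<in> cball 0 \<rho>"
    then have "T' w \<in> C" using low nT by auto
    then show "w \<in> T ` C" using TT' by (metis image_eqI)
  qed
  have f5: "T ` S \<subseteq> ball 0 1" using S1 nT by (auto simp: subset_iff)
  have f6: "cis (2 * pi / real q) * w \<in> T ` S" if "w \<in> T ` S" for w
  proof -
    obtain v where v: "v \<in> S" "w = T v" using \<open>w \<in> T ` S\<close> by blast
    have "cis (2 * pi / real q) * v \<in> S"
    proof (cases "v = 0")
      case False
      obtain x where x: "v = of_real (norm v) * cis (2 * pi * x)" using polar_2pi by metis
      have "P v = p x" using P[of "norm v" x] False x by simp
      moreover have "cis (2 * pi / real q) * v = of_real (norm v) * cis (2 * pi * (x + 1 / real q))"
        using x by (simp add: distrib_left cis_mult[symmetric])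
      then have "P (cis (2 * pi / real q) * v) = p x"
        using P[of "norm v" "x + 1 / real q"] pq[of x] False by simp
      ultimately show ?thesis using v False by (simp add: S_def norm_mult)
    qed (simp add: S_def)
    moreover have "cis (2 * pi / real q) * w = T (cis (2 * pi / real q) * v)"
      by (simp add: v T_def norm_mult)
    ultimately show ?thesis by blast
  qed
  \<comment> \<open>The direction before the twist, that is, the parameter at which \<open>g\<close>
    is evaluated.\<close>
  define \<xi> where "\<xi> w = sgn (T' w)" for w
  have f7: "continuous_on (- {0}) \<xi>"
  proof -
    have "T' w \<noteq> 0" if "w \<noteq> 0" for w using nT(2)[of w] that by force
    then show ?thesis unfolding \<xi>_def sgn_div_norm
      by (intro continuous_intros continuous_on_subset[OF cT(2)]) auto
  qed
  have f8: "norm (\<xi> w) = 1" if "w \<noteq> 0" for w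
    using nT(2)[of w] that by (force simp: \<xi>_def norm_sgn)
  have f9: "\<exists>X. w = of_real (norm w) * cis (2 * pi * X) \<and> \<bar>X - g x\<bar> \<le> \<tau>"
    if w: "w \<in> T ` S - T ` C" and x: "\<xi> w = cis (2 * pi * x)" for w x
  proof -
    define v where "v = T' w"
    have Tv: "w = T v" by (simp add: v_def TT')
    then have v: "v \<in> S" "v \<notin> C" using w T'T by (auto simp: image_iff) metis
    then have v0: "v \<noteq> 0" by (auto simp: C_def)
    have nv: "norm v = norm w" by (simp add: v_def nT)
    have vx: "v = of_real (norm v) * cis (2 * pi * x)"
      using x v0 by (simp add: \<xi>_def v_def[symmetric] sgn_div_norm scaleR_conv_of_real field_simps)
    then have "P v = p x" using P[of "norm v" x] v0 by simp
    then have n: "norm w < y + a * p x" "y - a * \<tau> + a * p x < norm w"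
      using v v0 nv by (auto simp: S_def C_def)
    have "w = v * cis (2 * pi * ((norm v - y) / a))" unfolding Tv T_def ..
    also have "\<dots> = of_real (norm w) * cis (2 * pi * (x + (norm w - y) / a))"
      by (subst vx) (simp add: nv mult.assoc cis_mult distrib_left)
    finally have "w = of_real (norm w) * cis (2 * pi * (x + (norm w - y) / a))" .
    moreover have "\<bar>x + (norm w - y) / a - g x\<bar> \<le> \<tau>"
    proof -
      have "(norm w - y) / a < p x" "(norm w - y) / a > p x - \<tau>" using n a by (auto simp: field_simps)
      then show ?thesis by (simp add: p_def)
    qed
    ultimately show ?thesis by blast
  qed
  show thesis
    by (rule that[of "T ` S" "T ` C" \<xi> g]) (fact f1 f2 f3 f4 f5 f6 f7 f8 f9 g(1) crooked image_mono[OF CS])+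
qed

section \<open>Polynomial approximation\<close>

definition poly_approximable :: "complex set \<Rightarrow> (complex \<Rightarrow> complex) \<Rightarrow> bool" where
  "poly_approximable K f \<longleftrightarrow> (\<forall>e>0. \<exists>P. \<forall>z\<in>K. norm (poly P z - f z) < e)"

lemma poly_approximable_const: "poly_approximable K (\<lambda>z. c)"
  unfolding poly_approximable_def by (intro allI impI exI[of _ "[:c:]"]) simp

lemma poly_approximable_id: "poly_approximable K (\<lambda>z. z)"
  unfolding poly_approximable_def by (intro allI impI exI[of _ "[:0, 1:]"]) simp

lemma poly_approximable_cong:
  "\<lbrakk>poly_approximable K f; \<And>z. z \<in> K \<Longrightarrow> f z = g z\<rbrakk> \<Longrightarrow> poly_approximable K g"
  unfolding poly_approximable_def by metis

lemma poly_approximable_add: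
  assumes "poly_approximable K f" "poly_approximable K g"
  shows "poly_approximable K (\<lambda>z. f z + g z)"
  unfolding poly_approximable_def
proof (intro allI impI)
  fix e :: real assume "e > 0"
  then obtain P Q where PQ: "\<forall>z\<in>K. norm (poly P z - f z) < e/2" "\<forall>z\<in>K. norm (poly Q z - g z) < e/2"
    using assms unfolding poly_approximable_def by (meson half_gt_zero)
  have "norm (poly (P + Q) z - (f z + g z)) < e" if "z \<in> K" for z
    using norm_triangle_ineq[of "poly P z - f z" "poly Q z - g z"] PQ that
    by (smt (verit) add_diff_add field_sum_of_halves poly_add)
  then show "\<exists>P. \<forall>z\<in>K. norm (poly P z - (f z + g z)) < e" by blast
qed

lemma poly_approximable_mult:
  assumes f: "poly_approximable K f" and g: "poly_approximable K g" and b: "bounded (f ` K)" "bounded (g ` K)"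
  shows "poly_approximable K (\<lambda>z. f z * g z)"
  unfolding poly_approximable_def
proof (intro allI impI)
  fix e :: real assume e: "e > 0"
  obtain A where A: "A > 0" "\<And>z. z \<in> K \<Longrightarrow> norm (f z) \<le> A" using b(1) by (auto simp: bounded_pos)
  obtain B where B: "B > 0" "\<And>z. z \<in> K \<Longrightarrow> norm (g z) \<le> B" using b(2) by (auto simp: bounded_pos)
  define d where "d = min 1 (e / (A + B + 2))"
  have "e / (A + B + 2) * (A + B + 2) = e" using A B by simp
  moreover have "d * (A + B + 2) \<le> e / (A + B + 2) * (A + B + 2)"
    using A B by (intro mult_right_mono) (auto simp: d_def)
  ultimately have d: "d > 0" "d \<le> 1" "d * (A + B + 2) \<le> e" using e A B by (auto simp: d_def)
  obtain P Q where PQ: "\<forall>z\<in>K. norm (poly P z - f z) < d" "\<forall>z\<in>K. norm (poly Q z - g z) < d"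
    using f g d(1) unfolding poly_approximable_def by meson
  have "norm (poly (P * Q) z - f z * g z) < e" if z: "z \<in> K" for z
  proof -
    have "norm (poly Q z) \<le> B + 1"
      using norm_triangle_ineq2[of "poly Q z" "g z"] PQ(2) B(2)[OF z] d z by force
    have "poly (P * Q) z - f z * g z = (poly P z - f z) * poly Q z + f z * (poly Q z - g z)"
      by (simp add: algebra_simps)
    also have "norm \<dots> \<le> norm (poly P z - f z) * norm (poly Q z) + norm (f z) * norm (poly Q z - g z)"
      by (metis norm_mult norm_triangle_ineq)
    also have "\<dots> \<le> d * (B + 1) + A * d"
      using PQ z d A(2)[OF z] A(1) \<open>norm (poly Q z) \<le> B + 1\<close> by (intro add_mono mult_mono) (auto intro: less_imp_le)
    also have "\<dots> < d * (A + B + 2)" using d by (simp add: algebra_simps)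
    finally show ?thesis using d by simp
  qed
  then show "\<exists>P. \<forall>z\<in>K. norm (poly P z - f z * g z) < e" by blast
qed

lemma poly_approximable_sum:
  "(\<And>i. i \<in> I \<Longrightarrow> poly_approximable K (f i)) \<Longrightarrow> poly_approximable K (\<lambda>z. \<Sum>i\<in>I. f i z)"
  by (induction I rule: infinite_finite_induct)
    (auto intro: poly_approximable_add poly_approximable_const)

lemma poly_approximable_limit:
  assumes "\<And>e. e > 0 \<Longrightarrow> \<exists>g. poly_approximable K g \<and> (\<forall>z\<in>K. norm (g z - f z) < e)"
  shows "poly_approximable K f"
  unfolding poly_approximable_def
proof (intro allI impI)
  fix e :: real assume "e > 0"
  then obtain g where g: "poly_approximable K g" "\<forall>z\<in>K. norm (g z - f z) < e/2"
    using assms[of "e/2"] by auto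
  then obtain P where P: "\<forall>z\<in>K. norm (poly P z - g z) < e/2"
    using \<open>e > 0\<close> unfolding poly_approximable_def by (meson half_gt_zero)
  have "norm (poly P z - f z) < e" if "z \<in> K" for z
    using norm_triangle_ineq[of "poly P z - g z" "g z - f z"] P g(2) that by fastforce
  then show "\<exists>P. \<forall>z\<in>K. norm (poly P z - f z) < e" by blast
qed

lemma poly_approximable_power:
  assumes "poly_approximable K u" "\<And>z. z \<in> K \<Longrightarrow> norm (u z) \<le> 1/2"
  shows "poly_approximable K (\<lambda>z. u z ^ n)"
proof (induction n)
  case 0 then show ?case by (simp add: poly_approximable_const)
next
  case (Suc n)
  have "bounded (u ` K)" using assms(2) unfolding bounded_iff by blast
  moreover have "bounded ((\<lambda>z. u z ^ n) ` K)"
    unfolding bounded_iff by (rule exI[of _ 1]) (auto simp: norm_power intro!: power_le_one order_trans[OF assms(2)])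
  ultimately show ?case using poly_approximable_mult[OF assms(1) Suc] by simp
qed

lemma poly_approximable_geometric:
  assumes u: "poly_approximable K u" "\<And>z. z \<in> K \<Longrightarrow> norm (u z) \<le> 1/2"
  shows "poly_approximable K (\<lambda>z. 1 / (1 - u z))"
proof (rule poly_approximable_limit)
  fix e :: real assume "e > 0"
  then obtain n where n: "(1/2::real) ^ n < e / 2" using real_arch_pow_inv[of "e/2" "1/2"] by auto
  have "norm ((\<Sum>i<n. u z ^ i) - 1 / (1 - u z)) < e" if z: "z \<in> K" for z
  proof -
    have "norm (1 - u z) \<ge> 1/2" using norm_triangle_ineq2[of 1 "u z"] u(2)[OF z] by simp
    then have nz: "1 - u z \<noteq> 0" by auto
    have "(\<Sum>i<n. u z ^ i) - 1 / (1 - u z) = - (u z ^ n) / (1 - u z)"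
      using nz sum_gp_strict[of "u z" n] by (simp add: divide_simps) 
    also have "norm \<dots> = norm (u z) ^ n / norm (1 - u z)" by (simp add: norm_divide norm_power)
    also have "\<dots> \<le> (1/2) ^ n / (1/2)"
      using u(2)[OF z] \<open>norm (1 - u z) \<ge> 1/2\<close> by (intro frac_le power_mono) auto
    also have "\<dots> < e" using n by simp
    finally show ?thesis .
  qed
  moreover have "poly_approximable K (\<lambda>z. \<Sum>i<n. u z ^ i)"
    by (intro poly_approximable_sum poly_approximable_power u)
  ultimately show "\<exists>g. poly_approximable K g \<and> (\<forall>z\<in>K. norm (g z - 1 / (1 - u z)) < e)" by blast
qed

text \<open>The admissible poles form a nonempty, relatively open and closed subset of the connected
  set \<open>- K\<close>. Moving a pole by at most half its distance from \<open>K\<close>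
  multiplies the fraction by a geometric series of ratio at most 1/2; for a pole far away such a
  series in \<open>z / a\<close> is available directly.\<close>

lemma pole_pushing:
  assumes K: "compact K" "connected (- K)" and a: "a \<notin> K"
  shows "poly_approximable K (\<lambda>z. 1 / (z - a))"
proof (cases "K = {}")
  case True then show ?thesis by (simp add: poly_approximable_def)
next
  case False
  define A where "A = {a. a \<notin> K \<and> poly_approximable K (\<lambda>z. 1 / (z - a))}"
  have bnd: "bounded ((\<lambda>z. 1 / (z - a)) ` K)" if "a \<notin> K" for a
    using that K(1) by (intro compact_imp_bounded compact_continuous_image continuous_intros) auto
  have inf: "infdist a K \<le> norm (z - a)" if "z \<in> K" for a z
    using infdist_le[OF that, of a] by (simp add: dist_norm norm_minus_commute)
  have inf0: "infdist a K > 0" if "a \<notin> K" for a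
    using that K(1) False by (simp add: compact_imp_closed infdist_pos_not_in_closed)
  have push: "b \<in> A" if "a \<in> A" "norm (b - a) \<le> infdist a K / 2" for a b
  proof -
    have aK: "a \<notin> K" "poly_approximable K (\<lambda>z. 1 / (z - a))" using that(1) by (auto simp: A_def)
    have bK: "b \<notin> K" using inf[of b a] inf0[OF aK(1)] that(2) by auto
    have small: "norm ((b - a) * (1 / (z - a))) \<le> 1/2" if "z \<in> K" for z
      using inf[OF that, of a] inf0[OF aK(1)] \<open>norm (b - a) \<le> infdist a K / 2\<close>
      by (simp add: norm_mult norm_divide divide_simps)
    have p1: "poly_approximable K (\<lambda>z. (b - a) * (1 / (z - a)))"
      by (intro poly_approximable_mult poly_approximable_const aK bnd) (auto simp: image_constant_conv)
    have p2: "poly_approximable K (\<lambda>z. 1 / (1 - (b - a) * (1 / (z - a))))"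
      by (rule poly_approximable_geometric[OF p1 small])
    have eq: "1 / (z - a) * (1 / (1 - (b - a) * (1 / (z - a)))) = 1 / (z - b)" if "z \<in> K" for z
    proof -
      have "z \<noteq> a" "z \<noteq> b" using that aK bK by auto
      then show ?thesis by (simp add: field_simps)
    qed
    have "bounded ((\<lambda>z. 1 / (1 - (b - a) * (1 / (z - a)))) ` K)"
      unfolding bounded_iff
    proof (intro exI[of _ 2] ballI)
      fix x assume "x \<in> (\<lambda>z. 1 / (1 - (b - a) * (1 / (z - a)))) ` K"
      then obtain z where z: "z \<in> K" "x = 1 / (1 - (b - a) * (1 / (z - a)))" by blast
      have "norm (1 - (b - a) * (1 / (z - a))) \<ge> 1/2"
        using norm_triangle_ineq2[of 1 "(b - a) * (1 / (z - a))"] small[OF z(1)] by simp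
      then have "1 / norm (1 - (b - a) * (1 / (z - a))) \<le> 1 / (1/2)" by (intro divide_left_mono) auto
      then show "norm x \<le> 2" unfolding z(2) norm_divide by simp
    qed
    then have "poly_approximable K (\<lambda>z. 1 / (z - a) * (1 / (1 - (b - a) * (1 / (z - a)))))"
      by (intro poly_approximable_mult aK p2 bnd)
    then have "poly_approximable K (\<lambda>z. 1 / (z - b))" by (rule poly_approximable_cong) (fact eq)
    then show ?thesis using bK by (simp add: A_def)
  qed
  have "open A"
    unfolding open_contains_ball
  proof
    fix a assume a: "a \<in> A"
    then have "infdist a K / 2 > 0" using inf0 by (simp add: A_def)
    moreover have "ball a (infdist a K / 2) \<subseteq> A"
      using push[OF a] by (auto simp: dist_norm norm_minus_commute)
    ultimately show "\<exists>e>0. ball a e \<subseteq> A" by blast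
  qed
  moreover have "open (- K - A)"
    unfolding open_contains_ball
  proof
    fix b assume b: "b \<in> - K - A"
    define d where "d = infdist b K"
    have d: "d > 0" using inf0 b by (simp add: d_def)
    \<comment> \<open>If \<open>a\<close> is within \<open>d / 3\<close> of \<open>b\<close>, its
      distance from \<open>K\<close> exceeds \<open>2 * d / 3\<close>, so a push from
      \<open>a\<close> would reach \<open>b\<close>.\<close>
    have "ball b (d / 3) \<subseteq> - K - A"
    proof
      fix a assume "a \<in> ball b (d / 3)"
      then have ab: "norm (b - a) < d / 3" by (simp add: dist_norm)
      have "d \<le> infdist a K + dist b a" unfolding d_def by (rule infdist_triangle)
      then have "d * (2/3) < infdist a K" using ab by (simp add: dist_norm)
      then have "norm (b - a) \<le> infdist a K / 2" "infdist a K > 0" using ab d by auto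
      then show "a \<in> - K - A" using push[of a b] b by auto
    qed
    then show "\<exists>e>0. ball b e \<subseteq> - K - A" using d by (intro exI[of _ "d/3"]) auto
  qed
  moreover have "A \<noteq> {}"
  proof -
    obtain B where B: "B > 0" "\<And>z. z \<in> K \<Longrightarrow> norm z \<le> B"
      using compact_imp_bounded[OF K(1)] by (auto simp: bounded_pos)
    define a where "a = complex_of_real (2 * B)"
    have a: "a \<noteq> 0" "norm a = 2 * B" using B by (auto simp: a_def)
    have aK: "a \<notin> K" using B(2)[of a] a B(1) by auto
    have "poly_approximable K (\<lambda>z. (1 / a) * z)"
      by (intro poly_approximable_mult poly_approximable_const poly_approximable_id)
        (use compact_imp_bounded[OF K(1)] in \<open>auto simp: image_constant_conv\<close>)
    then have "poly_approximable K (\<lambda>z. 1 / (1 - (1 / a) * z))"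
      by (rule poly_approximable_geometric) (use B a in \<open>auto simp: norm_divide norm_mult divide_simps\<close>)
    moreover have b: "bounded ((\<lambda>z. 1 / (1 - (1 / a) * z)) ` K)"
      using K(1) a aK by (intro compact_imp_bounded compact_continuous_image continuous_intros) (auto simp: divide_simps)
    ultimately have "poly_approximable K (\<lambda>z. (- 1 / a) * (1 / (1 - (1 / a) * z)))"
      by (intro poly_approximable_mult poly_approximable_const) (auto simp: image_constant_conv)
    then have "poly_approximable K (\<lambda>z. 1 / (z - a))"
      by (rule poly_approximable_cong) (use a aK in \<open>auto simp: divide_simps\<close>)
    then show ?thesis using aK by (auto simp: A_def)
  qed
  moreover have "A \<subseteq> - K" by (auto simp: A_def)
  ultimately have "A = - K"
    using connectedD[OF K(2), of A "- K - A"] by auto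
  then show ?thesis using a by (auto simp: A_def)
qed

section \<open>Cauchy integrals, Riemann sums and Runge's theorem for images of closed discs\<close>

lemma Riemann_sum_error:
  fixes \<Phi> :: "real \<Rightarrow> 'a::banach"
  assumes c: "continuous_on {0..1} \<Phi>" and N: "N > 0"
    and osc: "\<And>t t'. \<lbrakk>t \<in> {0..1}; t' \<in> {0..1}; \<bar>t - t'\<bar> \<le> 1 / real N\<rbrakk> \<Longrightarrow> norm (\<Phi> t - \<Phi> t') \<le> e"
  shows "norm (integral {0..1} \<Phi> - (\<Sum>i<N. (1 / real N) *\<^sub>R \<Phi> (real i / real N))) \<le> e"
proof -
  have "norm (integral {0..real k / real N} \<Phi> - (\<Sum>i<k. (1 / real N) *\<^sub>R \<Phi> (real i / real N))) \<le> e * (real k / real N)"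
    if "k \<le> N" for k
    using that
  proof (induction k)
    case (Suc k)
    define a b where "a = real k / real N" and "b = real (Suc k) / real N"
    have ab: "0 \<le> a" "a \<le> b" "b \<le> 1" "b - a = 1 / real N"
      using Suc.prems N by (auto simp: a_def b_def field_simps)
    have cab: "continuous_on {x..y} \<Phi>" if "0 \<le> x" "y \<le> 1" for x y
      using c by (rule continuous_on_subset) (use that in auto)
    have comb: "integral {0..b} \<Phi> = integral {0..a} \<Phi> + integral {a..b} \<Phi>"
      using ab by (intro Henstock_Kurzweil_Integration.integral_combine[symmetric] integrable_continuous_interval cab) auto
    have "integral {a..b} (\<lambda>t. \<Phi> t - \<Phi> a) = integral {a..b} \<Phi> - (b - a) *\<^sub>R \<Phi> a"
      using ab by (subst integral_diff) (auto intro!: integrable_continuous_interval cab)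
    moreover have "norm (integral {a..b} (\<lambda>t. \<Phi> t - \<Phi> a)) \<le> e * (b - a)"
      using ab by (intro integral_bound continuous_intros cab osc) auto
    ultimately have *: "norm (integral {a..b} \<Phi> - (1 / real N) *\<^sub>R \<Phi> a) \<le> e * (1 / real N)" using ab by simp
    have "norm (integral {0..b} \<Phi> - (\<Sum>i<Suc k. (1 / real N) *\<^sub>R \<Phi> (real i / real N)))
      \<le> norm (integral {0..a} \<Phi> - (\<Sum>i<k. (1 / real N) *\<^sub>R \<Phi> (real i / real N)))
        + norm (integral {a..b} \<Phi> - (1 / real N) *\<^sub>R \<Phi> a)"
      unfolding comb by (rule order_trans[OF eq_refl norm_triangle_ineq]) (simp add: a_def algebra_simps)
    also have "\<dots> \<le> e * a + e * (1 / real N)"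
      using Suc * by (intro add_mono) (auto simp: a_def)
    also have "\<dots> = e * b" by (simp add: ab(4)[symmetric] algebra_simps)
    finally show ?case by (simp add: b_def)
  qed auto
  from this[of N] N show ?thesis by simp
qed

text \<open>Pulling the integral back to the disc avoids winding numbers of the image curve.\<close>

lemma Cauchy_formula_injective_image:
  assumes h: "h holomorphic_on ball 0 1" "inj_on h (ball 0 1)" and f: "f holomorphic_on h ` ball 0 1"
    and r: "r < 1" "norm u0 < r"
  shows "((\<lambda>u. f (h u) * deriv h u / (h u - h u0)) has_contour_integral 2 * of_real pi * \<i> * f (h u0)) (circlepath 0 r)"
proof -
  have r0: "r > 0" using r(2) norm_ge_zero[of u0] by linarith
  have u0: "u0 \<in> ball 0 1" using r by auto
  \<comment> \<open>The divided difference of \<open>h\<close> has no zeros because \<open>h\<close>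
    is injective; \<open>h u - h u0 = (u - u0) * D u\<close> reduces everything to the ordinary
    Cauchy kernel.\<close>
  define D where "D u = (if u = u0 then deriv h u0 else (h u - h u0) / (u - u0))" for u
  have D: "D holomorphic_on ball 0 1" unfolding D_def by (rule pole_lemma_open[OF h(1)]) auto
  have D0: "D u \<noteq> 0" if "u \<in> ball 0 1" for u
    using holomorphic_injective_imp_regular[OF h(1) _ h(2), of u0] inj_onD[OF h(2), of u u0] that u0
    by (auto simp: D_def)
  have fh: "(\<lambda>u. f (h u)) holomorphic_on ball 0 1"
    using holomorphic_on_compose[OF h(1) f] by (simp add: o_def)
  have "(\<lambda>u. f (h u) * deriv h u / D u) holomorphic_on ball 0 1"
    using D0 by (intro holomorphic_intros fh D holomorphic_deriv h) auto
  then have "(\<lambda>u. f (h u) * deriv h u / D u) holomorphic_on cball 0 r"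
    by (rule holomorphic_on_subset) (use r in auto)
  from Cauchy_integral_circlepath_simple[OF this, of u0]
  have "((\<lambda>u. f (h u) * deriv h u / D u / (u - u0)) has_contour_integral 2 * of_real pi * \<i> * (f (h u0) * deriv h u0 / D u0)) (circlepath 0 r)"
    using r by simp
  moreover have "f (h u0) * deriv h u0 / D u0 = f (h u0)" using D0[OF u0] by (simp add: D_def)
  moreover have "f (h u) * deriv h u / D u / (u - u0) = f (h u) * deriv h u / (h u - h u0)"
    if "u \<in> path_image (circlepath 0 r)" for u
  proof -
    have "norm u = r" using that r0 by (simp add: path_image_circlepath)
    then have "u \<noteq> u0" using r by auto
    then show ?thesis by (simp add: D_def)
  qed
  ultimately show ?thesis by (metis (no_types, lifting) has_contour_integral_eq)
qed

text \<open>The Cauchy formula writes \<open>f\<close> on the compact set as an average of functions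
  \<open>V t / (A t - z)\<close> with poles off that set. Riemann sums approximate it uniformly in
  \<open>z\<close>, and their poles can be pushed away because a homeomorphic copy of a closed disc
  has connected complement.\<close>

theorem Runge_injective_image:
  assumes h: "h holomorphic_on ball 0 1" "inj_on h (ball 0 1)" and f: "f holomorphic_on h ` ball 0 1"
    and s: "0 < s" "s < 1"
  shows "poly_approximable (h ` cball 0 s) f"
proof -
  define K where "K = h ` cball 0 s"
  have sub: "cball 0 s \<subseteq> ball (0::complex) 1" using s by auto
  have hc: "continuous_on (ball 0 1) h" using h(1) holomorphic_on_imp_continuous_on by blast
  have K: "compact K" unfolding K_def
    by (intro compact_continuous_image continuous_on_subset[OF hc sub]) auto
  have "cball (0::complex) s homeomorphic K"
    using homeomorphism_compact[of "cball 0 s" h K] continuous_on_subset[OF hc sub] inj_on_subset[OF h(2) sub]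
    unfolding K_def homeomorphic_def by (metis compact_cball)
  then have conn: "connected (- K)"
    using connected_complement_homeomorphic_convex_compact[of K "cball (0::complex) s"] homeomorphic_sym by auto
  define r where "r = (s + 1) / 2"
  have r: "s < r" "r < 1" "0 < r" using s by (auto simp: r_def)
  \<comment> \<open>The last factor is the velocity of the circle without
    \<open>2 * pi * \<i>\<close>, which cancels against the same constant in the Cauchy
    formula.\<close>
  define V where "V t = f (h (circlepath 0 r t)) * deriv h (circlepath 0 r t) * (of_real r * exp (2 * of_real pi * \<i> * of_real t))" for t
  define A where "A t = h (circlepath 0 r t)" for t
  have cr: "norm (circlepath 0 r t) = r" for t
    using r by (simp add: circlepath norm_mult mult.assoc)
  have cc: "continuous_on {0..1} (circlepath 0 r)"
    using path_circlepath unfolding path_def by blast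
  have fh: "(\<lambda>u. f (h u)) holomorphic_on ball 0 1"
    using holomorphic_on_compose[OF h(1) f] by (simp add: o_def)
  have "continuous_on (ball 0 1) (\<lambda>u. f (h u) * deriv h u)"
    by (intro holomorphic_on_imp_continuous_on holomorphic_intros fh holomorphic_deriv h) auto
  then have "continuous_on {0..1} (\<lambda>t. f (h (circlepath 0 r t)) * deriv h (circlepath 0 r t))"
    by (rule continuous_on_compose2[OF _ cc]) (use cr r in auto)
  then have Vc: "continuous_on {0..1} V" unfolding V_def by (rule continuous_on_mult) (intro continuous_intros)
  have Ac: "continuous_on {0..1} A" unfolding A_def
    by (rule continuous_on_compose2[OF hc cc]) (use cr r in auto)
  have AK: "A t \<notin> K" for t
  proof
    assume "A t \<in> K"
    then obtain u where "norm u \<le> s" "h (circlepath 0 r t) = h u" by (auto simp: A_def K_def)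
    then have "circlepath 0 r t = u" using inj_onD[OF h(2)] cr[of t] r by auto
    then show False using cr[of t] \<open>norm u \<le> s\<close> r by auto
  qed
  have int: "((\<lambda>t. V t / (A t - z)) has_integral f z) {0..1}" if z: "z \<in> K" for z
  proof -
    obtain u0 where u0: "norm u0 \<le> s" "z = h u0" using z by (auto simp: K_def)
    have "((\<lambda>u. f (h u) * deriv h u / (h u - h u0)) has_contour_integral 2 * of_real pi * \<i> * f (h u0)) (circlepath 0 r)"
      using u0 r by (intro Cauchy_formula_injective_image h f) auto
    then have "((\<lambda>t. f (A t) * deriv h (circlepath 0 r t) / (A t - z) * vector_derivative (circlepath 0 r) (at t within {0..1}))
       has_integral 2 * of_real pi * \<i> * f z) {0..1}"
      unfolding has_contour_integral_def u0(2) A_def .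
    then have "((\<lambda>t. 2 * of_real pi * \<i> * (V t / (A t - z))) has_integral 2 * of_real pi * \<i> * f z) {0..1}"
      by (rule has_integral_eq[rotated]) (auto simp: vector_derivative_circlepath01 V_def A_def)
    moreover have "(F has_integral I) S" if "((\<lambda>t. c * F t) has_integral c * I) S" "c \<noteq> 0"
      for c I :: complex and F :: "real \<Rightarrow> complex" and S
      using has_integral_mult_right[OF that(1), of "inverse c"] that(2) by (simp add: mult.assoc[symmetric])
    ultimately show ?thesis by force
  qed
  have unif: "uniformly_continuous_on ({0..1} \<times> K) (\<lambda>(t, z). V t / (A t - z))"
  proof (intro compact_uniformly_continuous compact_Times K)
    have "continuous_on ({0..1} \<times> K) (\<lambda>x. V (fst x) / (A (fst x) - snd x))"
      by (intro continuous_intros continuous_on_compose2[OF Vc] continuous_on_compose2[OF Ac])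
        (use AK in auto)
    then show "continuous_on ({0..1} \<times> K) (\<lambda>(t, z). V t / (A t - z))" by (simp add: case_prod_unfold)
  qed auto
  show ?thesis
    unfolding K_def[symmetric]
  proof (rule poly_approximable_limit)
    fix e :: real assume e: "e > 0"
    obtain d where d: "d > 0" "\<And>t z t' z'. \<lbrakk>t \<in> {0..1}; z \<in> K; t' \<in> {0..1}; z' \<in> K; dist (t', z') (t, z) < d\<rbrakk>
        \<Longrightarrow> dist (V t' / (A t' - z')) (V t / (A t - z)) < e/2"
      using unif[unfolded uniformly_continuous_on_def, rule_format, of "e/2"] e by force
    obtain N :: nat where N: "N > 0" "1 / real N < d"
      using d(1) reals_Archimedean[of d] by (metis inverse_eq_divide zero_less_Suc)
    define G where "G z = (\<Sum>i<N. (1 / real N) *\<^sub>R (V (real i / real N) / (A (real i / real N) - z)))" for z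
    have "norm (G z - f z) < e" if z: "z \<in> K" for z
    proof -
      have "norm (integral {0..1} (\<lambda>t. V t / (A t - z)) - G z) \<le> e/2"
        unfolding G_def
      proof (rule Riemann_sum_error)
        show "continuous_on {0..1} (\<lambda>t. V t / (A t - z))"
          using AK z by (intro continuous_intros Vc Ac) auto
        show "norm (V t / (A t - z) - V t' / (A t' - z)) \<le> e/2" if "t \<in> {0..1}" "t' \<in> {0..1}" "\<bar>t - t'\<bar> \<le> 1 / real N" for t t'
          using d(2)[of t' z t z] that z N by (simp add: dist_norm dist_prod_def)
      qed (use N in auto)
      moreover have "integral {0..1} (\<lambda>t. V t / (A t - z)) = f z" using int[OF z] by (rule integral_unique)
      ultimately show ?thesis using e by (simp add: norm_minus_commute)
    qed
    moreover have "poly_approximable K G"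
      unfolding G_def
    proof (rule poly_approximable_sum)
      fix i assume "i \<in> {..<N}"
      define a where "a = A (real i / real N)"
      have a: "a \<notin> K" using AK by (simp add: a_def)
      have eq: "- V' / of_nat N * (1 / (z - a)) = 1 / of_nat N * (V' / (a - z))" for V' z
        by (metis (no_types, opaque_lifting) minus_diff_eq minus_divide_left
            minus_divide_right mult.commute times_divide_eq_right)
      have "bounded ((\<lambda>z. 1 / (z - a)) ` K)"
        using a K by (intro compact_imp_bounded compact_continuous_image continuous_intros) auto
      then have "poly_approximable K (\<lambda>z. (- V (real i / real N) / of_nat N) * (1 / (z - a)))"
        by (intro poly_approximable_mult poly_approximable_const pole_pushing K conn a) (auto simp: image_constant_conv)
      then show "poly_approximable K (\<lambda>z. (1 / real N) *\<^sub>R (V (real i / real N) / (A (real i / real N) - z)))"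
        by (rule poly_approximable_cong)
          (simp only: a_def[symmetric] scaleR_conv_of_real of_real_divide of_real_1 of_real_of_nat_eq eq)
    qed
    ultimately show "\<exists>g. poly_approximable K g \<and> (\<forall>z\<in>K. norm (g z - f z) < e)" by blast
  qed
qed

section \<open>Entire immersions approximating a Riemann map\<close>

lemma normalized_Riemann_map:
  assumes "open D" "simply_connected D" "0 \<in> D" "D \<noteq> UNIV"
  obtains \<kappa> h where "\<kappa> holomorphic_on D" "h holomorphic_on ball 0 1" "\<kappa> 0 = 0" "h 0 = 0"
    "\<And>z. z \<in> D \<Longrightarrow> \<kappa> z \<in> ball 0 1 \<and> h (\<kappa> z) = z" "\<And>u. u \<in> ball 0 1 \<Longrightarrow> h u \<in> D \<and> \<kappa> (h u) = u"
proof -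
  have "\<exists>f g. f holomorphic_on D \<and> g holomorphic_on ball 0 1 \<and>
           (\<forall>z \<in> D. f z \<in> ball 0 1 \<and> g(f z) = z) \<and>
           (\<forall>z \<in> ball 0 1. g z \<in> D \<and> f(g z) = z)"
    using Riemann_mapping_theorem[of D] assms by blast
  then obtain f g where f: "f holomorphic_on D" "\<And>z. z \<in> D \<Longrightarrow> f z \<in> ball 0 1 \<and> g (f z) = z"
    and g: "g holomorphic_on ball 0 1" "\<And>u. u \<in> ball 0 1 \<Longrightarrow> g u \<in> D \<and> f (g u) = u"
    by blast
  have "f 0 \<in> ball 0 1" using f assms by auto
  then obtain F G where FG: "F (f 0) = 0" "F holomorphic_on ball 0 1" "F ` ball 0 1 \<subseteq> ball 0 1"
     "G holomorphic_on ball 0 1" "G ` ball 0 1 \<subseteq> ball 0 1"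
     "\<And>z. z \<in> ball 0 1 \<Longrightarrow> F (G z) = z" "\<And>z. z \<in> ball 0 1 \<Longrightarrow> G (F z) = z"
    using ball_biholomorphism_exists by blast
  have G0: "G 0 = f 0" using FG(7)[of "f 0"] FG(1) \<open>f 0 \<in> ball 0 1\<close> by simp
  show thesis
  proof (rule that[of "F \<circ> f" "g \<circ> G"])
    show "F \<circ> f holomorphic_on D"
      by (rule holomorphic_on_compose_gen[OF f(1) FG(2)]) (use f in auto)
    show "g \<circ> G holomorphic_on ball 0 1"
      by (rule holomorphic_on_compose_gen[OF FG(4) g(1) FG(5)])
  qed (use f g FG G0 assms in \<open>auto simp: image_subset_iff\<close>)
qed

text \<open>In the coordinate \<open>\<kappa>\<close> the map \<open>F\<close> fixes 0 with a
  derivative of modulus 1, the equality case of the Schwarz lemma. It serves twice: to show that a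
  Riemann map inherits the symmetry of its domain, and to linearize the limit map.\<close>

lemma Schwarz_conjugate_rotation:
  assumes "open D" "0 \<in> D" and \<kappa>: "\<kappa> holomorphic_on D" and h: "h holomorphic_on ball 0 1" "\<kappa> 0 = 0" "h 0 = 0"
    and \<kappa>h: "\<And>z. z \<in> D \<Longrightarrow> \<kappa> z \<in> ball 0 1 \<and> h (\<kappa> z) = z" "\<And>u. u \<in> ball 0 1 \<Longrightarrow> h u \<in> D \<and> \<kappa> (h u) = u"
    and F: "F holomorphic_on D" "\<And>z. z \<in> D \<Longrightarrow> F z \<in> D" "F 0 = 0" "norm (deriv F 0) = 1"
    and z: "z \<in> D"
  shows "\<kappa> (F z) = deriv F 0 * \<kappa> z"
proof -
  define \<phi> where "\<phi> = (\<lambda>u. \<kappa> (F (h u)))"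
  have d\<kappa>: "(\<kappa> has_field_derivative deriv \<kappa> 0) (at 0)" using \<kappa> assms(1,2) by (rule holomorphic_derivI)
  have dh: "(h has_field_derivative deriv h 0) (at 0)" using h by (intro holomorphic_derivI) auto
  have dF: "(F has_field_derivative deriv F 0) (at 0)" using F assms(1,2) by (intro holomorphic_derivI) auto
  have d1: "((\<lambda>u. \<kappa> (h u)) has_field_derivative deriv \<kappa> 0 * deriv h 0) (at 0)"
    using DERIV_chain'[OF dh, of \<kappa> "deriv \<kappa> 0"] d\<kappa> h by (simp add: mult.commute)
  have "((\<lambda>u. u) has_field_derivative deriv \<kappa> 0 * deriv h 0) (at 0)"
    by (rule has_field_derivative_transform_within_open[OF d1, of "ball 0 1"]) (use \<kappa>h in auto)
  then have one: "deriv \<kappa> 0 * deriv h 0 = 1" using DERIV_ident DERIV_unique by blast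
  have d2: "((\<lambda>u. F (h u)) has_field_derivative deriv F 0 * deriv h 0) (at 0)"
    using DERIV_chain'[OF dh, of F "deriv F 0"] dF h by (simp add: mult.commute)
  have "(\<phi> has_field_derivative deriv \<kappa> 0 * (deriv F 0 * deriv h 0)) (at 0)"
    unfolding \<phi>_def using DERIV_chain'[OF d2, of \<kappa> "deriv \<kappa> 0"] d\<kappa> h F by (simp add: mult_ac)
  then have d\<phi>: "(\<phi> has_field_derivative deriv F 0) (at 0)" using one by (simp add: algebra_simps)
  have hol: "\<phi> holomorphic_on ball 0 1"
  proof -
    have "F \<circ> h holomorphic_on ball 0 1"
      by (rule holomorphic_on_compose_gen[OF h(1) F(1)]) (use \<kappa>h in auto)
    then have "\<kappa> \<circ> (F \<circ> h) holomorphic_on ball 0 1"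
      by (rule holomorphic_on_compose_gen[OF _ \<kappa>]) (use \<kappa>h F in auto)
    then show ?thesis by (simp add: \<phi>_def o_def)
  qed
  have "\<exists>\<alpha>. (\<forall>z. norm z < 1 \<longrightarrow> \<phi> z = \<alpha> * z) \<and> norm \<alpha> = 1"
  proof (rule Schwarz_Lemma(3)[OF hol, where \<xi> = 0])
    show "\<phi> 0 = 0" by (simp add: \<phi>_def h F)
    show "norm (\<phi> z) < 1" if "norm z < 1" for z using \<kappa>h F(2) that by (simp add: \<phi>_def)
    show "(\<exists>z. norm z < 1 \<and> z \<noteq> 0 \<and> norm (\<phi> z) = norm z) \<or> norm (deriv \<phi> 0) = 1"
      using DERIV_imp_deriv[OF d\<phi>] F by simp
  qed auto
  then obtain \<alpha> where \<alpha>: "\<And>u. norm u < 1 \<Longrightarrow> \<phi> u = \<alpha> * u" by blast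
  have "((\<lambda>u. \<alpha> * u) has_field_derivative deriv F 0) (at 0)"
    by (rule has_field_derivative_transform_within_open[OF d\<phi>, of "ball 0 1"]) (use \<alpha> in auto)
  moreover have "((\<lambda>u. \<alpha> * u) has_field_derivative \<alpha>) (at 0)" by (auto intro!: derivative_eq_intros)
  ultimately have "\<alpha> = deriv F 0" using DERIV_unique by blast
  then show ?thesis using \<alpha>[of "\<kappa> z"] \<kappa>h(1)[OF z] by (simp add: \<phi>_def)
qed

text \<open>This is an approximate Riemann map seen in the coordinate of the exact one and rescaled.
  For \<open>B = 0\<close> it is the dilation by \<open>1 / t1\<close>, which keeps the disc of
  radius \<open>t0\<close> strictly inside the unit disc and carries that of radius
  \<open>s1\<close> beyond it; small \<open>B\<close> and \<open>B'\<close> preserve this as well as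
  injectivity.\<close>

lemma perturbed_dilation:
  fixes t0 t1 s1 :: real
  assumes t: "0 < t0" "t0 < t1" "t1 < s1"
  shows "\<exists>\<eta>>0. \<forall>B B' :: complex \<Rightarrow> complex. (\<forall>u\<in>cball 0 s1.
        (B has_field_derivative B' u) (at u) \<and> norm (B u) < \<eta> \<and> norm (B' u) < \<eta>) \<longrightarrow>
      inj_on (\<lambda>u. u * exp (B u) / of_real t1) (ball 0 s1) \<and>
      (\<exists>s>1. ball 0 s \<subseteq> (\<lambda>u. u * exp (B u) / of_real t1) ` ball 0 s1) \<and>
      (\<exists>\<rho>>0. \<rho> < 1 \<and> (\<lambda>u. u * exp (B u) / of_real t1) ` cball 0 t0 \<subseteq> ball 0 \<rho>)"
proof -
  have "isCont (\<lambda>p. exp (fst p) * (1 + snd p)) (0::complex, 0::complex)"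
    by (intro continuous_intros)
  then obtain \<delta> where \<delta>: "\<delta> > 0" "\<And>p. dist p (0, 0) < \<delta> \<Longrightarrow> dist (exp (fst p) * (1 + snd p)) (1::complex) < 1/2"
    unfolding continuous_at_eps_delta by (force dest: spec[of _ "1/2"])
  have small: "norm (exp x * (1 + y) - 1) < 1/2" if "norm x < \<delta> / 2" "norm y < \<delta> / 2" for x y :: complex
  proof -
    have "dist (x, y) (0, 0) \<le> norm x + norm y"
      using norm_Pair_le[of x y] by (simp add: dist_norm)
    then show ?thesis using \<delta>(2)[of "(x, y)"] that by (simp add: dist_norm)
  qed
  \<comment> \<open>The first two entries keep \<open>B\<close> and \<open>u * B'\<close> below
    \<open>\<delta> / 2\<close>; the logarithms keep the factor \<open>exp \<eta>\<close> below
    \<open>t1 / t0\<close> and \<open>s1 / t1\<close>, strictly because of the halving.\<close>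
  define \<eta> where "\<eta> = Min {\<delta> / 2, \<delta> / (2 * s1), ln (t1 / t0) / 2, ln (s1 / t1) / 2}"
  have "\<eta> > 0" using \<delta> t by (simp add: \<eta>_def ln_gt_zero_iff)
  have "\<eta> \<le> \<delta> / (2 * s1)" by (simp add: \<eta>_def)
  then have \<eta>2: "s1 * \<eta> \<le> \<delta> / 2" using t by (simp add: field_simps)
  have \<eta>1: "\<eta> \<le> \<delta> / 2" by (simp add: \<eta>_def)
  have "\<eta> < ln (t1 / t0)" "\<eta> < ln (s1 / t1)"
    using t by (auto simp: \<eta>_def min_less_iff_disj ln_gt_zero_iff intro: le_less_trans[OF min.cobounded2])
  then have e: "exp \<eta> < t1 / t0" "exp \<eta> < s1 / t1"
    using t by (metis exp_less_cancel_iff exp_ln divide_pos_pos order_less_trans)+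
  show ?thesis
  proof (rule exI[of _ \<eta>], rule conjI, fact, intro allI impI)
    fix B B' :: "complex \<Rightarrow> complex"
    assume "\<forall>u\<in>cball 0 s1.
        (B has_field_derivative B' u) (at u) \<and> norm (B u) < \<eta> \<and> norm (B' u) < \<eta>"
    note * = this[rule_format]
    define m where "m u = u * exp (B u) / of_real t1" for u
    have ub: "norm (exp (B u)) \<le> exp \<eta>" "exp (- \<eta>) \<le> norm (exp (B u))" if "u \<in> cball 0 s1" for u
      using *[OF that] abs_Re_le_cmod[of "B u"] by auto
    have nm: "norm (m u) = norm u * norm (exp (B u)) / t1" for u
      using t by (simp add: m_def norm_mult norm_divide)
    have md: "(m has_field_derivative exp (B u) * (1 + u * B' u) / of_real t1) (at u)" if "u \<in> cball 0 s1" for u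
      unfolding m_def using *[OF that] t by (auto intro!: derivative_eq_intros simp: algebra_simps add_divide_distrib)
    have mc: "continuous_on (cball 0 s1) m"
      using md by (meson DERIV_isCont continuous_at_imp_continuous_on)
    have mh: "m holomorphic_on ball 0 s1"
      unfolding holomorphic_on_open[OF open_ball] using md ball_subset_cball by blast
    have inj: "inj_on m (cball 0 s1)"
    proof (rule inj_onI)
      fix u v assume uv: "u \<in> cball 0 s1" "v \<in> cball 0 s1" "m u = m v"
      \<comment> \<open>On the convex disc, \<open>t1 * m\<close> differs from the identity by a map
        with Lipschitz constant 1/2, so it cannot identify two points.\<close>
      have "norm ((of_real t1 * m u - u) - (of_real t1 * m v - v)) \<le> 1/2 * norm (u - v)"
      proof (rule field_differentiable_bound[of "cball 0 s1" _ "\<lambda>u. exp (B u) * (1 + u * B' u) - 1"])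
        fix z :: complex assume z: "z \<in> cball 0 s1"
        have "((\<lambda>u. of_real t1 * m u - u) has_field_derivative of_real t1 * (exp (B z) * (1 + z * B' z) / of_real t1) - 1) (at z)"
          by (intro DERIV_diff DERIV_cmult md[OF z] DERIV_ident)
        then show "((\<lambda>u. of_real t1 * m u - u) has_field_derivative exp (B z) * (1 + z * B' z) - 1) (at z within cball 0 s1)"
          using t by (auto intro: has_field_derivative_at_within)
        have "norm (z * B' z) \<le> s1 * norm (B' z)" using z by (auto simp: norm_mult intro: mult_right_mono)
        also have "\<dots> < s1 * \<eta>" using *[OF z] t by simp
        finally have "norm (z * B' z) < \<delta> / 2" using \<eta>2 by simp
        moreover have "norm (B z) < \<delta> / 2" using *[OF z] \<eta>1 by simp
        ultimately show "norm (exp (B z) * (1 + z * B' z) - 1) \<le> 1/2" using small less_imp_le by blast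
      qed (use uv in auto)
      then have "norm (v - u) \<le> 1/2 * norm (u - v)" using uv(3) by simp
      then show "u = v" by (simp add: norm_minus_commute)
    qed
    define s where "s = s1 * exp (- \<eta>) / t1"
    have "t1 * exp \<eta> < s1" using e(2) t by (simp add: field_simps)
    then have s1: "s > 1" using t by (simp add: s_def exp_minus field_simps)
    \<comment> \<open>The boundary circle is sent outside \<open>ball 0 s\<close>. Inside that ball
      the images of the open and of the closed disc thus coincide, and connectedness makes them fill
      it.\<close>
    have onto: "ball 0 s \<subseteq> m ` ball 0 s1"
    proof -
      have sph: "norm (m u) \<ge> s" if "norm u = s1" for u
      proof -
        have "s1 * exp (- \<eta>) \<le> s1 * norm (exp (B u))" using ub(2)[of u] that t by simp
        then show ?thesis unfolding nm that s_def using t by (simp add: divide_right_mono)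
      qed
      have o: "open (m ` ball 0 s1)"
        using open_mapping_thm3[OF mh] inj inj_on_subset[OF inj ball_subset_cball] by simp
      have c: "closed (m ` cball 0 s1)"
        by (intro compact_imp_closed compact_continuous_image mc) auto
      have "ball 0 s \<inter> m ` cball 0 s1 \<subseteq> m ` ball 0 s1"
      proof
        fix w assume "w \<in> ball 0 s \<inter> m ` cball 0 s1"
        then obtain u where u: "w = m u" "norm u \<le> s1" "norm (m u) < s" by auto
        then have "norm u \<noteq> s1" using sph[of u] by linarith
        then show "w \<in> m ` ball 0 s1" using u by auto
      qed
      moreover have "m ` ball 0 s1 \<subseteq> m ` cball 0 s1" by auto
      ultimately have "ball 0 s \<subseteq> m ` ball 0 s1 \<union> - (m ` cball 0 s1)" 
        and "m ` ball 0 s1 \<inter> - (m ` cball 0 s1) \<inter> ball 0 s = {}" by auto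
      then have "m ` ball 0 s1 \<inter> ball 0 s = {} \<or> - (m ` cball 0 s1) \<inter> ball 0 s = {}"
        using connectedD[of "ball 0 s" "m ` ball 0 s1" "- (m ` cball 0 s1)"] o c by (auto simp: open_Compl)
      moreover have "0 \<in> m ` ball 0 s1 \<inter> ball 0 s"
        using s1 t by (auto simp: m_def intro!: image_eqI[of _ _ 0])
      ultimately have "- (m ` cball 0 s1) \<inter> ball 0 s = {}" by blast
      then show ?thesis using \<open>ball 0 s \<inter> m ` cball 0 s1 \<subseteq> m ` ball 0 s1\<close> by blast
    qed
    define \<rho>0 where "\<rho>0 = t0 * exp \<eta> / t1"
    have r0: "0 < \<rho>0" "\<rho>0 < 1" using e(1) t by (auto simp: \<rho>0_def field_simps)
    have "m ` cball 0 t0 \<subseteq> ball 0 ((1 + \<rho>0) / 2)"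
    proof
      fix w assume "w \<in> m ` cball 0 t0"
      then obtain u where u: "w = m u" "norm u \<le> t0" by auto
      then have "norm u * norm (exp (B u)) \<le> t0 * exp \<eta>" using ub(1)[of u] t by (intro mult_mono) auto
      then have "norm w \<le> \<rho>0" unfolding u(1) nm \<rho>0_def using t by (simp add: divide_right_mono)
      then show "w \<in> ball 0 ((1 + \<rho>0) / 2)" using r0 by simp
    qed
    then show "inj_on (\<lambda>u. u * exp (B u) / of_real t1) (ball 0 s1) \<and>
      (\<exists>s>1. ball 0 s \<subseteq> (\<lambda>u. u * exp (B u) / of_real t1) ` ball 0 s1) \<and>
      (\<exists>\<rho>>0. \<rho> < 1 \<and> (\<lambda>u. u * exp (B u) / of_real t1) ` cball 0 t0 \<subseteq> ball 0 \<rho>)"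
      using inj_on_subset[OF inj ball_subset_cball] onto s1 r0 unfolding m_def[abs_def]
      by (intro conjI exI[of _ s] exI[of _ "(1 + \<rho>0) / 2"]) auto
  qed
qed

text \<open>Averaging over the powers of \<open>\<omega>\<close> enforces the symmetry at no cost,
  since \<open>L\<close> already has it; correcting the value at 0 costs a second
  \<open>e / 2\<close>.\<close>

lemma symmetric_entire_approximation:
  assumes L: "poly_approximable K L" and \<omega>: "\<omega> ^ q = 1" and q: "q > 0"
    and K: "\<And>z. z \<in> K \<Longrightarrow> \<omega> * z \<in> K" "0 \<in> K"
    and L\<omega>: "\<And>z. z \<in> K \<Longrightarrow> L (\<omega> * z) = L z" and L0: "L 0 = 0" and e: "e > 0"
  obtains P where "P holomorphic_on UNIV" "P 0 = 0" "\<And>z. P (\<omega> * z) = P z"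
    "\<And>z. z \<in> K \<Longrightarrow> norm (P z - L z) < e"
proof -
  obtain Q where Q: "\<And>z. z \<in> K \<Longrightarrow> norm (poly Q z - L z) < e / 2"
    using L e unfolding poly_approximable_def by (meson half_gt_zero)
  define P where "P z = (\<Sum>j<q. poly Q (\<omega> ^ j * z)) / of_nat q - poly Q 0" for z
  have Kj: "\<omega> ^ j * z \<in> K \<and> L (\<omega> ^ j * z) = L z" if "z \<in> K" for j z
    using that K L\<omega> by (induction j) (auto simp: mult.assoc)
  show thesis
  proof
    show "P holomorphic_on UNIV" unfolding P_def
      using q by (intro holomorphic_intros) auto
    show "P 0 = 0" using q by (simp add: P_def)
    fix z
    have "(\<Sum>j<q. poly Q (\<omega> ^ Suc j * z)) + poly Q z = (\<Sum>j<q. poly Q (\<omega> ^ j * z)) + poly Q (\<omega> ^ q * z)"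
      using sum.lessThan_Suc_shift[of "\<lambda>j. poly Q (\<omega> ^ j * z)" q] by (simp add: add.commute)
    then have "(\<Sum>j<q. poly Q (\<omega> ^ Suc j * z)) = (\<Sum>j<q. poly Q (\<omega> ^ j * z))" by (simp add: \<omega>)
    moreover have "(\<Sum>j<q. poly Q (\<omega> ^ j * (\<omega> * z))) = (\<Sum>j<q. poly Q (\<omega> ^ Suc j * z))"
      by (simp add: mult_ac)
    ultimately show "P (\<omega> * z) = P z" by (simp add: P_def)
    assume z: "z \<in> K"
    have "(\<Sum>j<q. poly Q (\<omega> ^ j * z) - L (\<omega> ^ j * z)) = (\<Sum>j<q. poly Q (\<omega> ^ j * z)) - of_nat q * L z"
      using Kj[OF z] by (simp add: sum_subtractf)
    then have eq: "(\<Sum>j<q. poly Q (\<omega> ^ j * z)) / of_nat q - L z = (\<Sum>j<q. poly Q (\<omega> ^ j * z) - L (\<omega> ^ j * z)) / of_nat q"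
      using q by (simp add: diff_divide_distrib)
    have "norm (\<Sum>j<q. poly Q (\<omega> ^ j * z) - L (\<omega> ^ j * z)) \<le> of_nat (card {..<q}) * (e / 2)"
      by (intro sum_norm_bound less_imp_le Q) (use Kj[OF z] in auto)
    then have "norm ((\<Sum>j<q. poly Q (\<omega> ^ j * z)) / of_nat q - L z) \<le> e / 2"
      unfolding eq using q by (simp add: norm_divide divide_simps mult.commute)
    moreover have "norm (poly Q 0) < e / 2" using Q[OF K(2)] L0 by simp
    moreover have "P z - L z = ((\<Sum>j<q. poly Q (\<omega> ^ j * z)) / of_nat q - L z) - poly Q 0" by (simp add: P_def)
    ultimately show "norm (P z - L z) < e" by (smt (verit) norm_triangle_ineq4 field_sum_of_halves)
  qed
qed

text \<open>\<open>W\<close> is a primitive of \<open>(exp (P z) - 1) / z\<close>, whose singularity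
  is removable because \<open>P 0 = 0\<close>. The equation makes the derivative of
  \<open>z * exp (W z)\<close> equal to \<open>exp (W z) * exp (P z)\<close>, hence free of zeros.
  For the symmetry, the derivative of \<open>W (\<omega> * z) - W z\<close> vanishes off 0, and at 0
  by continuity.\<close>

lemma entire_logarithmic_primitive:
  assumes P: "P holomorphic_on UNIV" "P 0 = 0" "\<And>z. P (\<omega> * z) = P z" and \<omega>: "\<omega> \<noteq> 0"
  obtains W where "W holomorphic_on UNIV" "W 0 = 0" "\<And>z. W (\<omega> * z) = W z"
    "\<And>z. z * deriv W z = exp (P z) - 1"
proof -
  define V where "V z = (if z = 0 then deriv (\<lambda>z. exp (P z)) 0 else (exp (P z) - exp (P 0)) / (z - 0))" for z
  have "V holomorphic_on UNIV" unfolding V_def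
    by (rule pole_lemma_open) (auto intro!: holomorphic_intros P)
  then obtain U where U: "\<And>z. (U has_field_derivative V z) (at z)"
    using holomorphic_convex_primitive'[of UNIV V] by auto
  define W where "W z = U z - U 0" for z
  have W: "(W has_field_derivative V z) (at z)" for z
    unfolding W_def by (auto intro!: derivative_eq_intros U)
  have zV: "z * V z = exp (P z) - 1" for z by (simp add: V_def P)
  show thesis
  proof
    show "W holomorphic_on UNIV" using W by (auto simp: holomorphic_on_open)
    show "W 0 = 0" by (simp add: W_def)
    show "z * deriv W z = exp (P z) - 1" for z using zV DERIV_imp_deriv[OF W] by simp
    have V\<omega>: "\<omega> * V (\<omega> * z) = V z" if "z \<noteq> 0" for z
    proof -
      have "z * (\<omega> * V (\<omega> * z)) = z * V z"
        using zV[of z] zV[of "\<omega> * z"] P(3)[of z] by (simp only: mult_ac)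
      then show ?thesis using that by simp
    qed
    have d: "((\<lambda>z. W (\<omega> * z) - W z) has_field_derivative \<omega> * V (\<omega> * z) - V z) (at z)" for z
      using DERIV_diff[OF DERIV_chain'[OF DERIV_cmult_Id W] W, of \<omega> z] by (simp add: mult.commute)
    have dc: "continuous_on UNIV (\<lambda>z. \<omega> * V (\<omega> * z) - V z)"
    proof -
      have cV: "continuous_on UNIV V" using \<open>V holomorphic_on UNIV\<close> holomorphic_on_imp_continuous_on by blast
      have "continuous_on UNIV (\<lambda>z. V (\<omega> * z))"
        by (rule continuous_on_compose2[OF cV]) (auto intro: continuous_intros)
      then show ?thesis using cV by (intro continuous_on_diff continuous_on_mult_left)
    qed
    have "\<omega> * V (\<omega> * 0) - V 0 = 0"
    proof -
      have "((\<lambda>z. \<omega> * V (\<omega> * z) - V z) \<longlongrightarrow> \<omega> * V (\<omega> * 0) - V 0) (at 0)"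
        using dc unfolding continuous_on_eq_continuous_at[OF open_UNIV] isCont_def by blast
      moreover have "((\<lambda>z. \<omega> * V (\<omega> * z) - V z) \<longlongrightarrow> 0) (at 0)"
        by (rule tendsto_eventually) (use V\<omega> in \<open>auto simp: eventually_at_filter\<close>)
      ultimately show ?thesis using tendsto_unique trivial_limit_at by blast
    qed
    then have "((\<lambda>z. W (\<omega> * z) - W z) has_field_derivative 0) (at z)" for z
      using d[of z] V\<omega>[of z] by (cases "z = 0") auto
    then obtain c where "\<And>z. W (\<omega> * z) - W z = c"
      using has_field_derivative_zero_constant[of UNIV "\<lambda>z. W (\<omega> * z) - W z"] by auto
    from this[of 0] this show "W (\<omega> * z) = W z" for z by (auto simp: \<open>W 0 = 0\<close>)
  qed
qed

lemma compact_in_unit_disc: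
  assumes "compact S" "S \<subseteq> ball (0::'a::real_normed_vector) 1"
  obtains t where "0 < t" "t < 1" "S \<subseteq> cball 0 t"
proof (cases "S = {}")
  case True then show ?thesis using that[of "1/2"] by simp
next
  case False
  then obtain x where x: "x \<in> S" "\<And>y. y \<in> S \<Longrightarrow> norm y \<le> norm x"
    using continuous_attains_sup[OF assms(1), of norm] by (auto intro: continuous_intros)
  have "norm x < 1" using x assms(2) by auto
  then have "(norm x + 1) / 2 < 1" "norm x \<le> (norm x + 1) / 2" by auto
  moreover have "0 < (norm x + 1) / 2" by (simp add: add_nonneg_pos)
  moreover have "S \<subseteq> cball 0 ((norm x + 1) / 2)"
    using x(2) calculation(2) by (meson mem_cball_0 order_trans subsetI)
  ultimately show ?thesis using that by blast
qed

text \<open>The Schwarz lemma with both discs rescaled. It permits division of a small error by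
  \<open>u\<close> near 0.\<close>

lemma Schwarz_scaled_bound:
  assumes E: "E holomorphic_on ball 0 r" "E 0 = 0" and r: "s < r" "0 < s"
    and b: "\<And>u. norm u \<le> s \<Longrightarrow> norm (E u) < e" and u: "norm u \<le> s"
  shows "norm (E u) \<le> e / s * norm u"
proof (cases "norm u = s")
  case True
  then show ?thesis using b[OF u] r by simp
next
  case False
  have e: "e > 0" using b[of 0] r E(2) by simp
  have "norm (E (of_real s * v) / of_real e) \<le> norm v" if "norm v < 1" for v
  proof (rule Schwarz_Lemma(1))
    show "(\<lambda>v. E (of_real s * v) / of_real e) holomorphic_on ball 0 1"
    proof -
      have "norm (of_real s * v) < r" if "norm v < 1" for v :: complex
      proof -
        have "s * norm v \<le> s * 1" using that r by (intro mult_left_mono) auto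
        then have "s * norm v < r" using r by linarith
        then show ?thesis using r by (simp add: norm_mult)
      qed
      then have "E \<circ> (\<lambda>v. of_real s * v) holomorphic_on ball 0 1"
        by (intro holomorphic_on_compose_gen[OF _ E(1)] holomorphic_intros) auto
      then show ?thesis using e by (auto intro!: holomorphic_intros simp: o_def)
    qed
    show "norm (E (of_real s * z) / of_real e) < 1" if "norm z < 1" for z
    proof -
      have "s * norm z \<le> s * 1" using that r by (intro mult_left_mono) auto
      then have "s * norm z \<le> s" by simp
      then have "norm (E (of_real s * z)) < e" using r by (intro b) (simp add: norm_mult)
      then show ?thesis using e by (simp add: norm_divide)
    qed
  qed (use E(2) that in auto)
  from this[of "u / of_real s"] False u r e show ?thesis
    by (simp add: norm_divide divide_simps) (simp add: mult_ac)
qed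

lemma normalized_logarithm:
  assumes "f holomorphic_on ball 0 1" "\<And>u. u \<in> ball 0 1 \<Longrightarrow> f u \<noteq> 0" "f 0 = 1"
  obtains l where "l holomorphic_on ball (0::complex) 1" "l 0 = 0" "\<And>u. u \<in> ball 0 1 \<Longrightarrow> exp (l u) = f u"
proof -
  obtain g where g: "g holomorphic_on ball 0 1" "\<And>u. u \<in> ball 0 1 \<Longrightarrow> exp (g u) = f u"
    using holomorphic_logarithm_exists[of "ball 0 1" f 0] assms by auto
  show thesis
    by (rule that[of "\<lambda>u. g u - g 0"]) (use g assms(3) in \<open>auto intro!: holomorphic_intros simp: exp_diff\<close>)
qed

text \<open>If \<open>k z = \<mu> z exp (W z)\<close> and \<open>1 + z deriv W z = exp P\<close>, then \<open>k\<close> is an immersion whatever the entire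
  function \<open>P\<close> is. For the Riemann map \<open>\<kappa>\<close> in place of \<open>k\<close> one has \<open>exp P = z deriv \<kappa> z / \<kappa> z\<close>, so \<open>P\<close> is taken close
  to a logarithm of this function.\<close>

lemma approximating_immersion:
  assumes D: "open D" "simply_connected D" "0 \<in> D" "D \<noteq> UNIV" and q: "q > 0"
    and sym: "\<And>w. w \<in> D \<Longrightarrow> cis (2 * pi / real q) * w \<in> D" and K: "compact K" "K \<subseteq> D"
  obtains k J s \<rho> where "k holomorphic_on UNIV" "\<And>z. deriv k z \<noteq> 0" "\<And>z. k z = 0 \<longleftrightarrow> z = 0"
    "\<And>z. k (cis (2 * pi / real q) * z) = cis (2 * pi / real q) * k z"
    "s > 1" "J holomorphic_on ball 0 s" "J ` ball 0 s \<subseteq> D" "\<And>w. w \<in> ball 0 s \<Longrightarrow> k (J w) = w" "J 0 = 0"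
    "0 < \<rho>" "\<rho> < 1" "K \<subseteq> J ` ball 0 \<rho>"
proof -
  define \<omega> where "\<omega> = cis (2 * pi / real q)"
  have "\<omega> ^ q = cis (real q * (2 * pi / real q))" unfolding \<omega>_def by (rule Complex.DeMoivre)
  also have "\<dots> = 1" using q by simp
  finally have \<omega>: "\<omega> ^ q = 1" "\<omega> \<noteq> 0" "norm \<omega> = 1" by (auto simp: \<omega>_def)
  obtain \<kappa> h where \<kappa>: "\<kappa> holomorphic_on D" and h: "h holomorphic_on ball 0 1" and zero: "\<kappa> 0 = 0" "h 0 = 0"
    and inv: "\<And>z. z \<in> D \<Longrightarrow> \<kappa> z \<in> ball 0 1 \<and> h (\<kappa> z) = z" "\<And>u. u \<in> ball 0 1 \<Longrightarrow> h u \<in> D \<and> \<kappa> (h u) = u"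
    using normalized_Riemann_map[OF D] by metis
  have d\<omega>: "deriv (\<lambda>z. \<omega> * z) 0 = \<omega>" by (rule DERIV_imp_deriv) (auto intro!: derivative_eq_intros)
  have \<kappa>\<omega>: "\<kappa> (\<omega> * z) = \<omega> * \<kappa> z" if "z \<in> D" for z
    using Schwarz_conjugate_rotation[OF D(1,3) \<kappa> h zero inv, of "\<lambda>z. \<omega> * z"] sym \<omega> that
    by (simp add: d\<omega> holomorphic_intros \<omega>_def[symmetric])
  have h\<omega>: "h (\<omega> * u) = \<omega> * h u" if "u \<in> ball 0 1" for u
    using \<kappa>\<omega>[of "h u"] inv(1)[of "\<omega> * h u"] inv(2)[OF that] sym[of "h u"] by (simp add: \<omega>_def)
  have inj: "inj_on h (ball 0 1)" by (metis inv(2) inj_onI)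
  have hD: "h ` ball 0 1 = D"
  proof
    show "D \<subseteq> h ` ball 0 1" using inv(1) by (metis image_eqI subsetI)
  qed (use inv(2) in blast)
  have h': "deriv h u \<noteq> 0" if "u \<in> ball 0 1" for u
    using holomorphic_injective_imp_regular[OF h _ inj that] by simp
  define N where "N u = (if u = 0 then deriv h 0 else (h u - h 0) / (u - 0))" for u
  have N: "N holomorphic_on ball 0 1" unfolding N_def by (rule pole_lemma_open[OF h]) auto
  have hN: "h u = u * N u" for u by (auto simp: N_def zero)
  have N0: "N u \<noteq> 0" if "u \<in> ball 0 1" for u
    using h'[of 0] inj_onD[OF inj, of u 0] that zero by (auto simp: N_def)
  \<comment> \<open>In the coordinate \<open>z = h u\<close> this is
    \<open>z * deriv \<kappa> z / \<kappa> z\<close>.\<close>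
  define M where "M u = N u / deriv h u" for u
  have M: "M holomorphic_on ball 0 1" unfolding M_def
    using h' by (intro holomorphic_intros N holomorphic_deriv h) auto
  have M0: "M u \<noteq> 0" if "u \<in> ball 0 1" for u using that N0 h' by (simp add: M_def)
  have M1: "M 0 = 1" using h'[of 0] by (simp add: M_def N_def)
  obtain l where l: "l holomorphic_on ball 0 1" "l 0 = 0" "\<And>u. u \<in> ball 0 1 \<Longrightarrow> exp (l u) = M u"
    using normalized_logarithm[OF M M0 M1] by metis
  \<comment> \<open>A logarithm of \<open>h u / (u * deriv h 0)\<close>. If the approximation below
    were exact, \<open>W (h u)\<close> would be \<open>- \<Lambda> u\<close>.\<close>
  obtain \<Lambda> where \<Lambda>: "\<Lambda> holomorphic_on ball 0 1" "\<Lambda> 0 = 0" "\<And>u. u \<in> ball 0 1 \<Longrightarrow> exp (\<Lambda> u) = N u / deriv h 0"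
  proof (rule normalized_logarithm)
    show "(\<lambda>u. N u / deriv h 0) holomorphic_on ball 0 1"
      using h'[of 0] by (intro holomorphic_intros N) auto
    show "N 0 / deriv h 0 = 1" using h'[of 0] by (simp add: N_def)
    show "N u / deriv h 0 \<noteq> 0" if "u \<in> ball 0 1" for u using N0[OF that] h'[of 0] by simp
  qed blast
  have \<omega>b: "\<omega> * u \<in> ball 0 1" if "u \<in> ball 0 1" for u using that \<omega> by (simp add: norm_mult)
  have M\<omega>: "M (\<omega> * u) = M u" if u: "u \<in> ball 0 1" for u
  proof -
    have "((\<lambda>u. h (\<omega> * u)) has_field_derivative deriv h (\<omega> * u) * \<omega>) (at u)"
      by (rule DERIV_chain'[OF DERIV_cmult_Id]) (rule holomorphic_derivI[OF h open_ball \<omega>b[OF u]])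
    moreover have "((\<lambda>u. \<omega> * h u) has_field_derivative \<omega> * deriv h u) (at u)"
      by (intro DERIV_cmult holomorphic_derivI[OF h open_ball u])
    then have "((\<lambda>u. h (\<omega> * u)) has_field_derivative \<omega> * deriv h u) (at u)"
      by (rule has_field_derivative_transform_within_open[OF _ open_ball u]) (simp add: h\<omega>)
    ultimately have "deriv h (\<omega> * u) = deriv h u"
      using DERIV_unique \<omega>(2) by (metis mult.commute mult_cancel_left)
    moreover have "N (\<omega> * u) = N u" using \<omega>(2) h\<omega>[OF u] zero by (simp add: N_def)
    ultimately show ?thesis by (simp add: M_def)
  qed
  have l\<omega>: "l (\<omega> * u) = l u" if u: "u \<in> ball 0 1" for u
  proof -
    define E where "E u = l (\<omega> * u) - l u" for u
    have lo: "(\<lambda>u. l (\<omega> * u)) holomorphic_on ball 0 1"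
      using holomorphic_on_compose_gen[of "\<lambda>u. \<omega> * u" "ball 0 1" l "ball 0 1"] l(1) \<omega>b
      by (auto simp: o_def image_subset_iff intro: holomorphic_intros)
    have E: "E holomorphic_on ball 0 1" unfolding E_def by (intro holomorphic_intros lo l)
    have eE: "exp (E u) = 1" if "u \<in> ball 0 1" for u
      using l(3)[OF that] l(3)[OF \<omega>b[OF that]] M\<omega>[OF that] M0[OF that] by (simp add: E_def exp_diff)
    have "(E has_field_derivative 0) (at u within ball 0 1)" if "u \<in> ball 0 1" for u
    proof -
      have dE: "(E has_field_derivative deriv E u) (at u)" by (rule holomorphic_derivI[OF E open_ball that])
      have "((\<lambda>u. exp (E u)) has_field_derivative exp (E u) * deriv E u) (at u)"
        by (rule DERIV_chain'[OF dE DERIV_exp])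
      then have "((\<lambda>u. 1) has_field_derivative exp (E u) * deriv E u) (at u)"
        by (rule has_field_derivative_transform_within_open[OF _ open_ball that]) (simp add: eE)
      then have "exp (E u) * deriv E u = 0" using DERIV_const DERIV_unique by blast
      then show ?thesis using dE by (auto intro: has_field_derivative_at_within)
    qed
    then obtain c where "\<And>u. u \<in> ball 0 1 \<Longrightarrow> E u = c"
      using has_field_derivative_zero_constant[of "ball 0 1" E] by auto
    from this[of 0] this[OF u] show ?thesis by (simp add: E_def l)
  qed
  have "compact (\<kappa> ` K)"
    by (intro compact_continuous_image K continuous_on_subset[OF holomorphic_on_imp_continuous_on[OF \<kappa>]])
  moreover have "\<kappa> ` K \<subseteq> ball 0 1" using inv K by auto
  ultimately obtain t0 where t0: "0 < t0" "t0 < 1" "\<kappa> ` K \<subseteq> cball 0 t0"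
    using compact_in_unit_disc by metis
  \<comment> \<open>The radii \<open>t0\<close>, \<open>t1\<close>, \<open>s1\<close>, 1 are equally
    spaced. \<open>K\<close> lies over the disc of radius \<open>t0\<close>, the disc of radius
    \<open>t1\<close> becomes the unit disc up to a small error, and the surplus up to
    \<open>s1\<close> lets \<open>J\<close> extend beyond it.\<close>
  define t1 where "t1 = t0 + (1 - t0) / 3"
  define s1 where "s1 = t0 + 2 * (1 - t0) / 3"
  have t: "0 < t0" "t0 < t1" "t1 < s1" "s1 < 1" using t0 by (auto simp: t1_def s1_def field_simps)
  have sub: "cball 0 s1 \<subseteq> ball (0::complex) 1" using t by auto
  obtain \<eta> where \<eta>: "\<eta> > 0" and dil: "\<forall>B B' :: complex \<Rightarrow> complex. (\<forall>u\<in>cball 0 s1.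
        (B has_field_derivative B' u) (at u) \<and> norm (B u) < \<eta> \<and> norm (B' u) < \<eta>) \<longrightarrow>
      inj_on (\<lambda>u. u * exp (B u) / of_real t1) (ball 0 s1) \<and>
      (\<exists>s>1. ball 0 s \<subseteq> (\<lambda>u. u * exp (B u) / of_real t1) ` ball 0 s1) \<and>
      (\<exists>\<rho>>0. \<rho> < 1 \<and> (\<lambda>u. u * exp (B u) / of_real t1) ` cball 0 t0 \<subseteq> ball 0 \<rho>)"
    using perturbed_dilation[OF t(1-3)] by blast
  have Mc: "continuous_on (cball 0 s1) M"
    using M sub holomorphic_on_imp_continuous_on holomorphic_on_subset by blast
  have "compact (M ` cball 0 s1)" by (intro compact_continuous_image Mc) auto
  then obtain C1 where C1: "C1 > 0" "\<And>u. u \<in> cball 0 s1 \<Longrightarrow> norm (M u) \<le> C1"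
    by (auto dest!: compact_imp_bounded simp: bounded_pos)
  have "compact ((\<lambda>u. 1 / M u) ` cball 0 s1)"
    using M0 sub by (intro compact_continuous_image continuous_intros Mc) auto
  then obtain C2 where C2: "C2 > 0" "\<And>u. u \<in> cball 0 s1 \<Longrightarrow> norm (1 / M u) \<le> C2"
    by (auto dest!: compact_imp_bounded simp: bounded_pos)
  \<comment> \<open>\<open>c\<close> will bound \<open>B\<close> and \<open>B'\<close>; it is
    strictly below \<open>\<eta>\<close> since only weak inequalities will be obtained.
    \<open>\<epsilon>\<close> is chosen to make \<open>\<epsilon> / s1 * C2\<close> equal to
    \<open>c\<close>.\<close>
  define c where "c = \<eta> / 2"
  define \<epsilon> where "\<epsilon> = c * s1 / C2"
  have c: "0 < c" "c < \<eta>" using \<eta> by (auto simp: c_def)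
  have \<epsilon>: "\<epsilon> > 0" using c t C2 by (simp add: \<epsilon>_def)
  have "isCont exp (0::complex)" by (intro continuous_intros)
  then obtain \<delta> where \<delta>: "\<delta> > 0" "\<And>x::complex. norm x < \<delta> \<Longrightarrow> norm (exp x - 1) < \<epsilon> / C1"
    using \<epsilon> C1(1) unfolding continuous_at_eps_delta dist_norm by (force dest: spec[of _ "\<epsilon> / C1"])
  define L where "L = (\<lambda>z. l (\<kappa> z))"
  have "L holomorphic_on h ` ball 0 1"
    unfolding hD L_def using holomorphic_on_compose_gen[OF \<kappa> l(1)] inv(1) by (simp add: o_def image_subset_iff)
  then have "poly_approximable (h ` cball 0 s1) L"
    using t by (intro Runge_injective_image h inj) auto
  moreover have "\<omega> * z \<in> h ` cball 0 s1" if "z \<in> h ` cball 0 s1" for z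
  proof -
    obtain u where "z = h u" "u \<in> cball 0 s1" using \<open>z \<in> h ` cball 0 s1\<close> by blast
    then show ?thesis using h\<omega>[of u] sub \<omega> by (intro image_eqI[of _ _ "\<omega> * u"]) (auto simp: norm_mult)
  qed
  moreover have "0 \<in> h ` cball 0 s1" using zero t by (intro image_eqI[of _ _ 0]) auto
  moreover have "L (\<omega> * z) = L z" if "z \<in> h ` cball 0 s1" for z
  proof -
    have "z \<in> D" using that hD sub by blast
    then show ?thesis using l\<omega>[of "\<kappa> z"] \<kappa>\<omega>[of z] inv(1)[of z] by (simp add: L_def)
  qed
  moreover have "L 0 = 0" by (simp add: L_def zero l)
  ultimately obtain P where P: "P holomorphic_on UNIV" "P 0 = 0" "\<And>z. P (\<omega> * z) = P z"
     and PL: "\<And>z. z \<in> h ` cball 0 s1 \<Longrightarrow> norm (P z - L z) < \<delta>"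
    using symmetric_entire_approximation[OF _ \<omega>(1) q _ _ _ _ \<delta>(1), of "h ` cball 0 s1" L] by metis
  obtain W where W: "W holomorphic_on UNIV" "W 0 = 0" "\<And>z. W (\<omega> * z) = W z" "\<And>z. z * deriv W z = exp (P z) - 1"
    using entire_logarithmic_primitive[OF P \<omega>(2)] by metis
  have dW: "(W has_field_derivative deriv W z) (at z)" for z using holomorphic_derivI[OF W(1)] by simp
  \<comment> \<open>This normalization makes \<open>k (h u)\<close> equal to
    \<open>u * exp (B u) / of_real t1\<close>.\<close>
  define \<mu> where "\<mu> = 1 / (of_real t1 * deriv h 0)"
  have \<mu>: "\<mu> \<noteq> 0" using t h'[of 0] by (simp add: \<mu>_def)
  define k where "k z = \<mu> * z * exp (W z)" for z
  have k_hol: "k holomorphic_on UNIV" unfolding k_def by (intro holomorphic_intros W)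
  have k': "deriv k z \<noteq> 0" for z
  proof -
    have "(k has_field_derivative \<mu> * (exp (W z) * (1 + z * deriv W z))) (at z)"
      unfolding k_def using DERIV_mult[OF DERIV_cmult_Id DERIV_chain'[OF dW DERIV_exp], of \<mu> z]
      by (simp add: algebra_simps)
    then have "deriv k z = \<mu> * (exp (W z) * exp (P z))" unfolding W(4) by (simp add: DERIV_imp_deriv)
    then show ?thesis using \<mu> by simp
  qed
  \<comment> \<open>The logarithmic deviation of \<open>k \<circ> h\<close> from the dilation by
    \<open>1 / t1\<close>, together with its derivative.\<close>
  define B where "B u = W (h u) + \<Lambda> u" for u
  define B' where "B' u = deriv W (h u) * deriv h u + deriv \<Lambda> u" for u
  have dh: "(h has_field_derivative deriv h u) (at u)" if "u \<in> ball 0 1" for u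
    by (rule holomorphic_derivI[OF h open_ball that])
  have d\<Lambda>: "(\<Lambda> has_field_derivative deriv \<Lambda> u) (at u)" if "u \<in> ball 0 1" for u
    by (rule holomorphic_derivI[OF \<Lambda>(1) open_ball that])
  have dB: "(B has_field_derivative B' u) (at u)" if "u \<in> ball 0 1" for u
    unfolding B_def B'_def by (intro DERIV_add DERIV_chain'[OF dh[OF that] dW] d\<Lambda>[OF that])
  define E where "E u = exp (P (h u)) - M u" for u
  \<comment> \<open>\<open>u * B' u\<close> is the difference of the logarithmic derivatives of
    \<open>k \<circ> h\<close> and of the identity, multiplied by \<open>u\<close>. The equation for
    \<open>W\<close> expresses it by the approximation error \<open>E\<close>, so only an error of
    values, not of derivatives, has to be controlled.\<close>
  have B'E: "u * M u * B' u = E u" if u: "u \<in> ball 0 1" for u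
  proof -
    have dN: "(N has_field_derivative deriv N u) (at u)" by (rule holomorphic_derivI[OF N open_ball u])
    have "(h has_field_derivative u * deriv N u + 1 * N u) (at u)"
      unfolding hN[abs_def] by (rule DERIV_mult'[OF DERIV_ident dN, simplified mult_1_left[symmetric]])
    then have hN': "deriv h u = u * deriv N u + N u" by (simp add: DERIV_imp_deriv)
    have "((\<lambda>u. exp (\<Lambda> u)) has_field_derivative exp (\<Lambda> u) * deriv \<Lambda> u) (at u)"
      by (rule DERIV_chain'[OF d\<Lambda>[OF u] DERIV_exp])
    then have "((\<lambda>u. N u / deriv h 0) has_field_derivative exp (\<Lambda> u) * deriv \<Lambda> u) (at u)"
      by (rule has_field_derivative_transform_within_open[OF _ open_ball u]) (simp add: \<Lambda>)
    moreover have "((\<lambda>u. N u / deriv h 0) has_field_derivative deriv N u / deriv h 0) (at u)"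
      by (intro DERIV_cdivide dN)
    ultimately have "deriv N u / deriv h 0 = N u / deriv h 0 * deriv \<Lambda> u"
      using DERIV_unique \<Lambda>(3)[OF u] by fastforce
    then have N': "deriv N u = N u * deriv \<Lambda> u" using h'[of 0] by simp
    have "deriv h u * (u * M u * B' u) = N u * u * (deriv W (h u) * deriv h u + deriv \<Lambda> u)"
      using h'[OF u] by (simp add: M_def B'_def)
    also have "\<dots> = (h u * deriv W (h u)) * deriv h u + u * deriv N u"
      unfolding N' by (simp add: hN algebra_simps)
    also have "\<dots> = (exp (P (h u)) - 1) * deriv h u + (deriv h u - N u)" unfolding W(4) hN' by simp
    also have "\<dots> = deriv h u * E u" using h'[OF u] by (simp add: E_def M_def algebra_simps)
    finally show ?thesis using h'[OF u] by simp
  qed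
  have Eb: "norm (E u) < \<epsilon>" if u: "norm u \<le> s1" for u
  proof -
    have u1: "u \<in> ball 0 1" "u \<in> cball 0 s1" using u t by auto
    have "M u = exp (L (h u))" using l(3)[OF u1(1)] inv(2)[OF u1(1)] by (simp add: L_def)
    then have "E u = M u * (exp (P (h u) - L (h u)) - 1)" by (simp add: E_def exp_diff algebra_simps)
    moreover have "norm (exp (P (h u) - L (h u)) - 1) < \<epsilon> / C1" by (intro \<delta>(2) PL imageI u1)
    ultimately have "norm (E u) \<le> C1 * norm (exp (P (h u) - L (h u)) - 1)"
      using C1(2)[OF u1(2)] by (simp add: norm_mult mult_right_mono)
    also have "\<dots> < C1 * (\<epsilon> / C1)" using C1(1) \<open>norm (exp (P (h u) - L (h u)) - 1) < \<epsilon> / C1\<close> by (intro mult_strict_left_mono)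
    finally show ?thesis using C1(1) by simp
  qed
  have E_hol: "E holomorphic_on ball 0 1"
  proof -
    have "P \<circ> h holomorphic_on ball 0 1" by (rule holomorphic_on_compose_gen[OF h P(1)]) auto
    then show ?thesis unfolding E_def by (intro holomorphic_intros M) (simp add: o_def)
  qed
  have B'0: "norm (B' u) \<le> c" if u: "norm u \<le> s1" "u \<noteq> 0" for u
  proof -
    have u1: "u \<in> ball 0 1" "u \<in> cball 0 s1" using u t by auto
    have "norm (E u) \<le> \<epsilon> / s1 * norm u"
      by (rule Schwarz_scaled_bound[OF E_hol _ t(4) _ Eb u(1)]) (use t in \<open>auto simp: E_def P M1 zero\<close>)
    moreover have B'u: "B' u = E u / u * (1 / M u)" using B'E[OF u1(1)] u(2) M0[OF u1(1)] by (simp add: field_simps)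
    ultimately have "norm (B' u) \<le> \<epsilon> / s1 * C2"
      using C2(2)[OF u1(2)] u(2) \<epsilon> t unfolding B'u norm_mult
      by (intro mult_mono) (auto simp: norm_divide divide_simps mult_ac)
    then show ?thesis using C2(1) t by (simp add: \<epsilon>_def)
  qed
  \<comment> \<open>Division by \<open>u\<close> says nothing at 0, where the bound is inherited by
    continuity.\<close>
  have B'c: "norm (B' u) \<le> c" if u: "norm u \<le> s1" for u
  proof (cases "u = 0")
    case True
    have "B' holomorphic_on ball 0 1"
    proof -
      have "deriv W \<circ> h holomorphic_on ball 0 1"
        by (rule holomorphic_on_compose_gen[OF h, of _ UNIV]) (auto intro: holomorphic_deriv W)
      then show ?thesis unfolding B'_def
        by (intro holomorphic_intros holomorphic_deriv h \<Lambda>) (auto simp: o_def)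
    qed
    then have "isCont B' 0" using holomorphic_on_imp_continuous_on[THEN continuous_on_interior] by fastforce
    moreover have "\<forall>\<^sub>F u in at 0. norm (B' u) \<le> c"
      unfolding eventually_at using B'0 t by (intro exI[of _ s1]) auto
    ultimately show ?thesis unfolding True isCont_def by (intro Lim_norm_ubound[of "at 0" B']) auto
  qed (use B'0 u in auto)
  have B_bound: "norm (B u) \<le> c" if u: "norm u \<le> s1" for u
  proof -
    have "norm (B u - B 0) \<le> c * norm (u - 0)"
      by (rule field_differentiable_bound[of "cball 0 s1" B B'])
        (use dB sub B'c u t in \<open>auto intro: has_field_derivative_at_within\<close>)
    moreover have "c * norm u \<le> c * 1" using c u t by (intro mult_left_mono) auto
    ultimately show ?thesis by (simp add: B_def W zero \<Lambda>)
  qed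
  define m where "m u = u * exp (B u) / of_real t1" for u
  have "inj_on m (ball 0 s1) \<and> (\<exists>s>1. ball 0 s \<subseteq> m ` ball 0 s1) \<and> (\<exists>\<rho>>0. \<rho> < 1 \<and> m ` cball 0 t0 \<subseteq> ball 0 \<rho>)"
    unfolding m_def[abs_def]
    by (rule dil[rule_format, of B B']) (use dB le_less_trans[OF B'c c(2)] le_less_trans[OF B_bound c(2)] sub in auto)
  then obtain s \<rho> where minj: "inj_on m (ball 0 s1)" and s: "s > 1" "ball 0 s \<subseteq> m ` ball 0 s1"
    and \<rho>: "0 < \<rho>" "\<rho> < 1" "m ` cball 0 t0 \<subseteq> ball 0 \<rho>" by blast
  have km: "k (h u) = m u" if "u \<in> ball 0 1" for u
  proof -
    have "exp (B u) = exp (W (h u)) * (N u / deriv h 0)" using \<Lambda>(3)[OF that] by (simp add: B_def exp_add)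
    then show ?thesis by (simp add: k_def m_def \<mu>_def hN mult_ac)
  qed
  have sub1: "ball 0 s1 \<subseteq> ball (0::complex) 1" using t by auto
  have "m holomorphic_on ball 0 s1"
  proof -
    have "B holomorphic_on ball 0 s1" unfolding holomorphic_on_open[OF open_ball] using dB sub1 by blast
    then show ?thesis unfolding m_def using t by (intro holomorphic_intros) auto
  qed
  then obtain g where g: "g holomorphic_on m ` ball 0 s1" "\<And>u. u \<in> ball 0 s1 \<Longrightarrow> g (m u) = u"
    using holomorphic_has_inverse[OF _ open_ball minj] by metis
  have g1: "g w \<in> ball 0 s1" "m (g w) = w" if "w \<in> ball 0 s" for w
    using s(2) that g(2) by auto
  have gb: "g w \<in> ball 0 1" if "w \<in> ball 0 s" for w using g1(1)[OF that] sub1 by blast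
  show thesis
  proof (rule that[of k s "h \<circ> g" \<rho>])
    show "k (cis (2 * pi / real q) * z) = cis (2 * pi / real q) * k z" for z
      using W(3)[of z] by (simp add: k_def \<omega>_def mult_ac)
    show "h \<circ> g holomorphic_on ball 0 s"
      using gb by (intro holomorphic_on_compose_gen[OF holomorphic_on_subset[OF g(1) s(2)] h]) blast
    show "(h \<circ> g) ` ball 0 s \<subseteq> D" using gb inv(2) unfolding o_def by blast
    show "k ((h \<circ> g) w) = w" if "w \<in> ball 0 s" for w
      using km[OF gb[OF that]] g1(2)[OF that] by simp
    have "m 0 = 0" by (simp add: m_def)
    then show "(h \<circ> g) 0 = 0" using g(2)[of 0] t zero by simp
    show "K \<subseteq> (h \<circ> g) ` ball 0 \<rho>"
    proof
      fix z assume z: "z \<in> K"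
      then have "\<kappa> z \<in> cball 0 t0" "h (\<kappa> z) = z" using t0 inv K by auto
      moreover have "g (m (\<kappa> z)) = \<kappa> z" using calculation t by (intro g(2)) auto
      moreover have "m (\<kappa> z) \<in> ball 0 \<rho>" using \<rho>(3) calculation(1) by blast
      ultimately show "z \<in> (h \<circ> g) ` ball 0 \<rho>"
        by (intro image_eqI[of _ _ "m (\<kappa> z)"]) auto
    qed
    show "k z = 0 \<longleftrightarrow> z = 0" for z using \<mu> by (simp add: k_def)
  qed (fact k_hol k' s \<rho>)+
qed

section \<open>Lifting rotations\<close>

lemma norm_cis_diff_le: "norm (cis a - cis b) \<le> \<bar>a - b\<bar>"
proof -
  have "cis a - cis b = cis b * (cis (a - b) - 1)" by (simp add: right_diff_distrib cis_mult)
  then have "norm (cis a - cis b) = norm (exp (\<i> * of_real (a - b)) - 1)"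
    by (simp add: norm_mult cis_conv_exp)
  also have "\<dots> = 2 * \<bar>sin ((a - b) / 2)\<bar>" by (rule dist_exp_i_1)
  also have "\<dots> \<le> 2 * \<bar>(a - b) / 2\<bar>" using abs_sin_x_le_abs_x[of "(a - b) / 2"] by linarith
  finally show ?thesis by simp
qed

text \<open>Discs of injectivity about single points cover \<open>C\<close>; a Lebesgue number of
  this cover serves all points at once.\<close>

lemma uniform_injectivity_radius:
  assumes G: "G holomorphic_on UNIV" "\<And>z. deriv G z \<noteq> 0" and C: "compact C"
  obtains \<eta> where "\<eta> > 0" "\<And>v. v \<in> C \<Longrightarrow> inj_on G (ball v \<eta>)"
proof -
  have "\<exists>r>0. inj_on G (ball v r)" for v
    using has_complex_derivative_locally_injective[of G UNIV v] G by auto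
  then obtain r where r: "\<And>v. r v > 0" "\<And>v. inj_on G (ball v (r v))" by metis
  obtain \<eta> where \<eta>: "\<eta> > 0" "\<And>v. v \<in> C \<Longrightarrow> \<exists>B\<in>range (\<lambda>v. ball v (r v)). ball v \<eta> \<subseteq> B"
  proof (rule Heine_Borel_lemma[OF C])
    show "C \<subseteq> \<Union> (range (\<lambda>v. ball v (r v)))" using r(1) by (auto intro: centre_in_ball[THEN iffD2])
  qed auto
  have "inj_on G (ball v \<eta>)" if "v \<in> C" for v
    using \<eta>(2)[OF that] r(2) inj_on_subset by blast
  with \<eta>(1) show thesis using that by blast
qed

text \<open>At each centre half of both radii is held in reserve, so the inclusion persists at
  nearby centres, and finitely many of these suffice.\<close>

lemma uniform_image_ball:
  assumes G: "G holomorphic_on UNIV" "\<And>z. deriv G z \<noteq> 0" and C: "compact C" and \<eta>: "\<eta> > 0"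
  obtains \<mu> where "\<mu> > 0" "\<And>v. v \<in> C \<Longrightarrow> ball (G v) \<mu> \<subseteq> G ` ball v \<eta>"
proof -
  have nc: "\<not> G constant_on UNIV"
  proof
    assume "G constant_on UNIV"
    then obtain c where "G = (\<lambda>_. c)" by (auto simp: constant_on_def)
    then show False using G(2)[of 0] by simp
  qed
  have op: "open (G ` ball v (\<eta> / 2))" for v
    by (rule open_mapping_thm[OF G(1) open_UNIV connected_UNIV open_ball _ nc]) auto
  have "\<exists>m>0. ball (G v) (2 * m) \<subseteq> G ` ball v (\<eta> / 2)" for v
  proof -
    have "G v \<in> G ` ball v (\<eta> / 2)" using \<eta> by auto
    then obtain e where "e > 0" "ball (G v) e \<subseteq> G ` ball v (\<eta> / 2)"
      using op open_contains_ball by meson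
    then show ?thesis by (intro exI[of _ "e / 2"]) auto
  qed
  then obtain m where m: "\<And>v. m v > 0" "\<And>v. ball (G v) (2 * m v) \<subseteq> G ` ball v (\<eta> / 2)" by metis
  define N where "N v = ball v (\<eta> / 2) \<inter> G -` ball (G v) (m v)" for v
  have oN: "open (N v)" for v unfolding N_def
    using continuous_open_preimage[OF continuous_on_subset[OF holomorphic_on_imp_continuous_on[OF G(1)]], of "ball v (\<eta> / 2)" "ball (G v) (m v)"]
    by simp
  have "C \<subseteq> (\<Union>v\<in>C. N v)" using \<eta> m(1) by (auto simp: N_def)
  then obtain C' where C': "C' \<subseteq> C" "finite C'" "C \<subseteq> (\<Union>v\<in>C'. N v)"
    using compactE_image[OF C, of C N] oN by auto
  show thesis
  proof (rule that[of "Min (insert 1 (m ` C'))"])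
    show "Min (insert 1 (m ` C')) > 0" using m(1) C' by auto
    fix v assume "v \<in> C"
    then obtain u where u: "u \<in> C'" "v \<in> N u" using C' by auto
    have "Min (insert 1 (m ` C')) \<le> m u" using u C' by (intro Min_le) auto
    then have "ball (G v) (Min (insert 1 (m ` C'))) \<subseteq> ball (G v) (m u)" by (rule subset_ball)
    also have "\<dots> \<subseteq> ball (G u) (2 * m u)"
    proof
      fix w assume "w \<in> ball (G v) (m u)"
      moreover have "dist (G u) (G v) < m u" using u(2) by (simp add: N_def)
      ultimately show "w \<in> ball (G u) (2 * m u)" using dist_triangle[of "G u" w "G v"] by simp
    qed
    also have "\<dots> \<subseteq> G ` ball u (\<eta> / 2)" by (rule m(2))
    also have "\<dots> \<subseteq> G ` ball v \<eta>"
    proof (intro image_mono subsetI)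
      fix w assume "w \<in> ball u (\<eta> / 2)"
      moreover have "dist u v < \<eta> / 2" using u(2) by (simp add: N_def)
      ultimately show "w \<in> ball v \<eta>" using dist_triangle[of v w u] by (simp add: dist_commute)
    qed
    finally show "ball (G v) (Min (insert 1 (m ` C'))) \<subseteq> G ` ball v \<eta>" .
  qed
qed

text \<open>The value \<open>cis (2 * pi * \<theta>') * G z\<close> is close to
  \<open>G (F z)\<close>, so it has a preimage close to \<open>F z\<close>, unique within the radius
  of injectivity. Uniqueness makes the choice coincide locally with a holomorphic branch of the
  inverse. Uniform constants need a compact disc, which is paid for by passing from \<open>R\<close>
  to \<open>R'\<close>.\<close>

lemma rotation_lift_perturbation:
  assumes G: "G holomorphic_on UNIV" "\<And>z. deriv G z \<noteq> 0"
    and F: "F holomorphic_on ball 0 R" "\<And>z. z \<in> ball 0 R \<Longrightarrow> G (F z) = cis (2 * pi * \<theta>) * G z"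
    and R: "R' < R" and e: "e > 0"
  obtains \<mu> where "\<mu> > 0"
    "\<And>\<theta>'. \<bar>\<theta>' - \<theta>\<bar> < \<mu> \<Longrightarrow> \<exists>F'. F' holomorphic_on ball 0 R' \<and>
       (\<forall>z\<in>ball 0 R'. norm (F' z - F z) < e \<and> G (F' z) = cis (2 * pi * \<theta>') * G z)"
proof -
  have sub: "cball 0 R' \<subseteq> ball (0::complex) R" "ball 0 R' \<subseteq> ball (0::complex) R" using R by auto
  have Fc: "continuous_on (cball 0 R') F"
    using F(1) sub holomorphic_on_imp_continuous_on holomorphic_on_subset by blast
  have Gc: "continuous_on S G" for S
    using holomorphic_on_imp_continuous_on[OF G(1)] continuous_on_subset by blast
  define C where "C = F ` cball 0 R'"
  have C: "compact C" unfolding C_def by (intro compact_continuous_image Fc) auto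
  obtain \<eta> where \<eta>: "\<eta> > 0" "\<And>v. v \<in> C \<Longrightarrow> inj_on G (ball v \<eta>)"
    using uniform_injectivity_radius[OF G C] by metis
  \<comment> \<open>Half of \<open>\<eta>\<close>, so a point within \<open>d\<close> of
    \<open>F z\<close> stays in the injectivity disc about \<open>F z0\<close> as long as
    \<open>F z\<close> is within \<open>\<eta> / 2\<close> of \<open>F z0\<close>.\<close>
  define d where "d = min \<eta> e / 2"
  have d: "d > 0" "d \<le> \<eta> / 2" "d < e" using \<eta> e by (auto simp: d_def min_def)
  obtain m where m: "m > 0" "\<And>v. v \<in> C \<Longrightarrow> ball (G v) m \<subseteq> G ` ball v d"
    using uniform_image_ball[OF G C d(1)] by metis
  have "compact (G ` cball 0 R')" by (intro compact_continuous_image Gc) auto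
  then obtain B where B: "B > 0" "\<And>z. z \<in> cball 0 R' \<Longrightarrow> norm (G z) \<le> B"
    by (auto dest!: compact_imp_bounded simp: bounded_pos)
  \<comment> \<open>Rotating through less than \<open>\<mu>\<close> turns moves a point of modulus
    at most \<open>B\<close> by less than \<open>m\<close>.\<close>
  define \<mu> where "\<mu> = m / (2 * pi * B)"
  have \<mu>: "\<mu> > 0" using m B by (simp add: \<mu>_def)
  show thesis
  proof (rule that[OF \<mu>])
    fix \<theta>' assume \<theta>': "\<bar>\<theta>' - \<theta>\<bar> < \<mu>"
    define c where "c z = cis (2 * pi * \<theta>') * G z" for z
    have near: "c z \<in> ball (G (F z)) m" if z: "z \<in> ball 0 R'" for z
    proof -
      have "norm (cis (2 * pi * \<theta>') - cis (2 * pi * \<theta>)) \<le> \<bar>2 * pi * \<theta>' - 2 * pi * \<theta>\<bar>" by (rule norm_cis_diff_le)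
      also have "\<dots> = 2 * pi * \<bar>\<theta>' - \<theta>\<bar>" by (simp add: abs_mult flip: right_diff_distrib)
      finally have "norm (cis (2 * pi * \<theta>') - cis (2 * pi * \<theta>)) * norm (G z) \<le> (2 * pi * \<bar>\<theta>' - \<theta>\<bar>) * B"
        using B(2)[of z] z B(1) by (intro mult_mono) auto
      also have "\<dots> < (2 * pi * \<mu>) * B" using \<theta>' B by (intro mult_strict_right_mono mult_strict_left_mono) auto
      also have "\<dots> = m" using B by (simp add: \<mu>_def)
      finally have "norm ((cis (2 * pi * \<theta>') - cis (2 * pi * \<theta>)) * G z) < m" by (simp add: norm_mult)
      moreover have "z \<in> ball 0 R" using z sub by blast
      ultimately show ?thesis using F(2)[of z]
        by (simp add: c_def dist_norm left_diff_distrib norm_minus_commute)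
    qed
    have FC: "F z \<in> C" if "z \<in> ball 0 R'" for z using that by (auto simp: C_def)
    have "\<exists>u. u \<in> ball (F z) d \<and> G u = c z" if "z \<in> ball 0 R'" for z
      using m(2)[OF FC[OF that]] near[OF that] by (metis (no_types, lifting) imageE subsetD)
    then obtain F' where F': "\<And>z. z \<in> ball 0 R' \<Longrightarrow> F' z \<in> ball (F z) d" "\<And>z. z \<in> ball 0 R' \<Longrightarrow> G (F' z) = c z"
      by metis
    have "F' field_differentiable at z0" if z0: "z0 \<in> ball 0 R'" for z0
    proof -
      obtain g where g: "g holomorphic_on G ` ball (F z0) \<eta>" "\<And>u. u \<in> ball (F z0) \<eta> \<Longrightarrow> g (G u) = u"
        using holomorphic_has_inverse[of G "ball (F z0) \<eta>"] G(1) \<eta>(2)[OF FC[OF z0]]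
        by (metis holomorphic_on_subset open_ball subset_UNIV)
      have oG: "open (G ` ball (F z0) \<eta>)"
        using open_mapping_thm3[of G "ball (F z0) \<eta>"] G(1) \<eta>(2)[OF FC[OF z0]] holomorphic_on_subset by blast
      define N where "N = ball 0 R' \<inter> F -` ball (F z0) (\<eta> / 2)"
      have oN: "open N" unfolding N_def
        using continuous_open_preimage[OF continuous_on_subset[OF Fc ball_subset_cball], of "ball (F z0) (\<eta> / 2)"] by simp
      have in_ball: "F' z \<in> ball (F z0) \<eta>" if "z \<in> N" for z
      proof -
        have "dist (F z0) (F z) < \<eta> / 2" "dist (F z) (F' z) < d"
          using that F'(1)[of z] by (auto simp: N_def)
        then show ?thesis using dist_triangle[of "F z0" "F' z" "F z"] d by simp
      qed
      have eq: "g (c z) = F' z" if "z \<in> N" for z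
        using g(2)[OF in_ball[OF that]] F'(2)[of z] that by (simp add: N_def)
      have "c ` N \<subseteq> G ` ball (F z0) \<eta>"
        using in_ball F'(2) by (force simp: N_def)
      moreover have "c holomorphic_on N" unfolding c_def
        by (intro holomorphic_intros holomorphic_on_subset[OF G(1)]) auto
      ultimately have "g \<circ> c holomorphic_on N"
        using holomorphic_on_compose_gen[of c N g] g(1) by blast
      then have "F' holomorphic_on N" by (rule holomorphic_transform) (simp add: eq)
      moreover have "z0 \<in> N" using z0 \<eta> by (simp add: N_def)
      ultimately show ?thesis using oN by (meson holomorphic_on_imp_differentiable_at)
    qed
    then have "F' holomorphic_on ball 0 R'"
      by (auto simp: holomorphic_on_def intro: field_differentiable_at_within)
    moreover have "norm (F' z - F z) < e" if "z \<in> ball 0 R'" for z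
      using F'(1)[OF that] d by (simp add: dist_norm norm_minus_commute)
    ultimately show "\<exists>F'. F' holomorphic_on ball 0 R' \<and>
       (\<forall>z\<in>ball 0 R'. norm (F' z - F z) < e \<and> G (F' z) = cis (2 * pi * \<theta>') * G z)"
      using F'(2) unfolding c_def by blast
  qed
qed

section \<open>Hereditary indecomposability\<close>

text \<open>Crookedness at one scale: a point of \<open>Y\<close> with angle \<open>x\<close> is
  shadowed by the point \<open>g x\<close> of a closed curve, and \<open>g\<close> retraces its way
  whenever its net progress is at most two turns. Shadowing is demanded for every lift
  \<open>x\<close> of the angle, so that no global branch on \<open>Y\<close>, which may surround a
  hole, has to be chosen.\<close>

definition crooked_shadow :: "real \<Rightarrow> complex set \<Rightarrow> bool" where
  "crooked_shadow \<epsilon> Y \<longleftrightarrow> (\<exists>\<xi> \<gamma> g. continuous_on Y \<xi> \<and> (\<forall>z\<in>Y. norm (\<xi> z :: complex) = 1) \<and>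
     continuous_on UNIV (g :: real \<Rightarrow> real) \<and> (\<forall>t. \<gamma> (t + 1) = \<gamma> t) \<and>
     (\<forall>z\<in>Y. \<forall>x. \<xi> z = cis (2 * pi * x) \<longrightarrow> dist z (\<gamma> (g x)) < \<epsilon>) \<and>
     (\<forall>s t. s \<le> t \<longrightarrow> \<bar>g s - g t\<bar> \<le> 2 \<longrightarrow>
        (\<exists>c d. s \<le> c \<and> c \<le> d \<and> d \<le> t \<and> dist (\<gamma> (g c)) (\<gamma> (g t)) < \<epsilon> \<and> dist (\<gamma> (g d)) (\<gamma> (g s)) < \<epsilon>)))"

lemma crooked_shadow_subset:
  assumes "crooked_shadow \<epsilon> Y" "X \<subseteq> Y"
  shows "crooked_shadow \<epsilon> X"
  using assms(1) unfolding crooked_shadow_def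
  by (elim ex_forward conj_forward) (use assms(2) in \<open>auto intro: continuous_on_subset\<close>)

lemma unit_polar_2pi:
  assumes "norm w = 1"
  obtains x where "w = cis (2 * pi * x)"
  using polar_2pi[of w] assms by (metis mult_1 of_real_1)

text \<open>Dividing by the missed value and changing the sign moves that value to the cut of
  \<open>Arg\<close>, which is continuous elsewhere. An integer shift adjusts the value at
  \<open>p\<close>.\<close>

lemma continuous_angle:
  fixes \<xi> :: "'a::topological_space \<Rightarrow> complex"
  assumes \<xi>: "continuous_on S \<xi>" "\<And>z. z \<in> S \<Longrightarrow> norm (\<xi> z) = 1"
    and miss: "\<And>z. z \<in> S \<Longrightarrow> \<xi> z \<noteq> \<zeta>" "norm \<zeta> = 1"
    and p: "p \<in> S" "\<xi> p = cis (2 * pi * x)"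
  obtains l where "continuous_on S l" "\<And>z. z \<in> S \<Longrightarrow> \<xi> z = cis (2 * pi * l z)" "l p = x"
proof -
  obtain y where y: "\<zeta> = cis (2 * pi * y)" using unit_polar_2pi[OF miss(2)] .
  define u where "u z = - \<xi> z / \<zeta>" for z
  have z0: "\<zeta> \<noteq> 0" using miss(2) by auto
  have u: "u z \<notin> \<real>\<^sub>\<le>\<^sub>0" if "z \<in> S" for z
  proof
    assume "u z \<in> \<real>\<^sub>\<le>\<^sub>0"
    then obtain r where r: "u z = of_real r" "r \<le> 0" by (auto elim: nonpos_Reals_cases)
    moreover have "norm (u z) = 1" using \<xi>(2)[OF that] miss(2) by (simp add: u_def norm_divide)
    ultimately have "u z = -1" by auto
    then have "\<xi> z = \<zeta>" using z0 by (simp add: u_def field_simps)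
    then show False using miss(1)[OF that] by simp
  qed
  define l0 where "l0 z = y + 1/2 + Arg (u z) / (2 * pi)" for z
  have "continuous_on S u" unfolding u_def using z0 by (intro continuous_intros \<xi>) auto
  then have l0c: "continuous_on S l0" unfolding l0_def
    using u by (intro continuous_intros continuous_on_compose2[OF continuous_on_Arg]) auto
  have l0: "\<xi> z = cis (2 * pi * l0 z)" if "z \<in> S" for z
  proof -
    have nu: "norm (u z) = 1" using \<xi>(2)[OF that] miss(2) by (simp add: u_def norm_divide)
    then have uz0: "u z \<noteq> 0" by force
    have "2 * pi * l0 z = 2 * pi * y + pi + Arg (u z)" by (simp add: l0_def distrib_left)
    then have "cis (2 * pi * l0 z) = \<zeta> * (- 1) * cis (Arg (u z))" by (simp add: y cis_mult[symmetric])
    also have "cis (Arg (u z)) = u z" using cis_Arg[OF uz0] nu by (simp add: sgn_div_norm)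
    finally show ?thesis using z0 by (simp add: u_def)
  qed
  obtain k :: int where k: "x = l0 p + of_int k"
    using l0[OF p(1)] p(2) cis_2pi_eq_iff by metis
  show thesis
  proof (rule that[of "\<lambda>z. l0 z + of_int k"])
    show "\<xi> z = cis (2 * pi * (l0 z + of_int k))" if "z \<in> S" for z
      using l0[OF that] cis_2pi_eq_iff[of "l0 z + of_int k" "l0 z"] by auto
  qed (use k l0c in \<open>auto intro: continuous_intros\<close>)
qed

lemma connected_real_Icc: "\<lbrakk>connected (S::real set); a \<in> S; b \<in> S; a \<le> x; x \<le> b\<rbrakk> \<Longrightarrow> x \<in> S"
  by (meson connected_contains_Icc atLeastAtMost_iff subsetD)

lemma connected_real_avoids_translates:
  assumes S: "connected (S::real set)" "a \<in> S" "b \<in> S" and avoid: "\<And>k::int. y + of_int k \<notin> S"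
  shows "\<bar>a - b\<bar> < 1"
proof -
  have "v - u < 1" if uv: "u \<in> S" "v \<in> S" for u v
  proof (rule ccontr)
    assume "\<not> v - u < 1"
    define k where "k = \<lceil>u - y\<rceil>"
    have "u \<le> y + of_int k" "y + of_int k \<le> v" using \<open>\<not> v - u < 1\<close> unfolding k_def by linarith+
    then show False using connected_real_Icc[OF S(1) uv] avoid by blast
  qed
  from this[OF S(2,3)] this[OF S(3,2)] show ?thesis by linarith
qed

text \<open>If \<open>K = A \<union> B\<close>, the angles along \<open>A\<close> and \<open>B\<close> are lifted to the line so as to agree at a common point.
  The lifts are intervals covering a path from near \<open>a \<in> A - B\<close> to near \<open>b \<in> B - A\<close>, and the return
  of this path towards \<open>a\<close> would have to happen inside \<open>B\<close>.\<close>

lemma hereditarily_indecomposable_if_crooked: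
  assumes crooked: "\<And>\<epsilon>. \<epsilon> > 0 \<Longrightarrow> crooked_shadow \<epsilon> X"
  shows "hereditarily_indecomposable X"
  unfolding hereditarily_indecomposable_def indecomposable_continuum_def
proof (intro allI impI conjI notI)
  fix K assume K: "K \<subseteq> X \<and> continuum K"
  then show "continuum K" by blast
  assume "\<exists>A B. continuum A \<and> continuum B \<and> A \<subset> K \<and> B \<subset> K \<and> K = A \<union> B"
  then obtain A B where AB: "compact A" "connected A" "A \<noteq> {}" "compact B" "connected B" "B \<noteq> {}"
      "A \<subset> K" "B \<subset> K" "K = A \<union> B"
    by (auto simp: continuum_def)
  obtain a b where a: "a \<in> A" "a \<notin> B" and b: "b \<in> B" "b \<notin> A" using AB by blast
  have "A \<inter> B \<noteq> {}"
    using connected_closedD[of K A B] K AB compact_imp_closed[of A] compact_imp_closed[of B]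
    unfolding continuum_def by blast
  then obtain p where p: "p \<in> A" "p \<in> B" by blast
  have "open (- A)" "open (- B)" using AB compact_imp_closed by auto
  then obtain d1 d2 where d12: "d1 > 0" "ball a d1 \<subseteq> - B" "d2 > 0" "ball b d2 \<subseteq> - A"
    using a b open_contains_ball by (metis ComplI)
  \<comment> \<open>Replacing two points by their shadows costs less than one
    \<open>\<epsilon>\<close> each, and a third one remains as separation.\<close>
  define \<epsilon> where "\<epsilon> = min d1 d2 / 3"
  have \<epsilon>: "\<epsilon> > 0" using d12 by (simp add: \<epsilon>_def)
  have farA: "3 * \<epsilon> \<le> dist z b" if "z \<in> A" for z
  proof -
    have "\<not> dist b z < d2" using d12(4) that by auto
    then show ?thesis by (simp add: \<epsilon>_def dist_commute)
  qed
  have farB: "3 * \<epsilon> \<le> dist z a" if "z \<in> B" for z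
  proof -
    have "\<not> dist a z < d1" using d12(2) that by auto
    then show ?thesis by (simp add: \<epsilon>_def dist_commute)
  qed
  obtain \<xi> \<gamma> and g :: "real \<Rightarrow> real" where \<xi>: "continuous_on X \<xi>" "\<And>z. z \<in> X \<Longrightarrow> norm (\<xi> z :: complex) = 1"
    and g: "continuous_on UNIV g" and \<gamma>: "\<And>t. \<gamma> (t + 1) = \<gamma> t"
    and near: "\<And>z x. \<lbrakk>z \<in> X; \<xi> z = cis (2 * pi * x)\<rbrakk> \<Longrightarrow> dist z (\<gamma> (g x)) < \<epsilon>"
    and retrace: "\<And>s t. \<lbrakk>s \<le> t; \<bar>g s - g t\<bar> \<le> 2\<rbrakk> \<Longrightarrow>
        \<exists>c d. s \<le> c \<and> c \<le> d \<and> d \<le> t \<and> dist (\<gamma> (g c)) (\<gamma> (g t)) < \<epsilon> \<and> dist (\<gamma> (g d)) (\<gamma> (g s)) < \<epsilon>"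
    using crooked[OF \<epsilon>] unfolding crooked_shadow_def by blast
  have AX: "A \<subseteq> X" "B \<subseteq> X" using K AB by auto
  \<comment> \<open>Points with equal angle share a shadow, hence are closer than
    \<open>2 * \<epsilon>\<close>. So the angle on \<open>A\<close> misses that of \<open>b\<close>,
    and on \<open>B\<close> that of \<open>a\<close>, which is what makes continuous lifts
    available.\<close>
  have sep: "\<xi> z \<noteq> \<xi> w" if zw: "z \<in> X" "w \<in> X" "3 * \<epsilon> \<le> dist z w" for z w
  proof
    assume eq: "\<xi> z = \<xi> w"
    obtain x where x: "\<xi> w = cis (2 * pi * x)" using unit_polar_2pi \<xi>(2)[OF zw(2)] by blast
    have "dist z (\<gamma> (g x)) < \<epsilon>" "dist w (\<gamma> (g x)) < \<epsilon>" using near zw x eq by auto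
    then show False using zw(3) dist_triangle2[of z w "\<gamma> (g x)"] \<epsilon> by linarith
  qed
  have aX: "a \<in> X" "b \<in> X" "p \<in> X" using a b p AX by auto
  obtain x where x: "\<xi> p = cis (2 * pi * x)" using unit_polar_2pi \<xi>(2)[OF aX(3)] by blast
  obtain lA where lA: "continuous_on A lA" "\<And>z. z \<in> A \<Longrightarrow> \<xi> z = cis (2 * pi * lA z)" "lA p = x"
    using continuous_angle[of A \<xi> "\<xi> b" p x] continuous_on_subset[OF \<xi>(1) AX(1)] \<xi>(2) sep farA AX aX p x
    by (metis subsetD)
  obtain lB where lB: "continuous_on B lB" "\<And>z. z \<in> B \<Longrightarrow> \<xi> z = cis (2 * pi * lB z)" "lB p = x"
    using continuous_angle[of B \<xi> "\<xi> a" p x] continuous_on_subset[OF \<xi>(1) AX(2)] \<xi>(2) sep farB AX aX p x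
    by (metis subsetD)
  define I J where "I = lA ` A" and "J = lB ` B"
  have conn: "connected I" "connected J"
    unfolding I_def J_def using AB lA(1) lB(1) connected_continuous_image by blast+
  have pIJ: "x \<in> I" "x \<in> J" unfolding I_def J_def using p lA(3) lB(3) by (metis imageI)+
  define \<alpha> \<beta> where "\<alpha> = lA a" and "\<beta> = lB b"
  have \<alpha>\<beta>: "\<alpha> \<in> I" "\<beta> \<in> J" unfolding I_def J_def \<alpha>_def \<beta>_def using a b by auto
  have \<gamma>a: "dist a (\<gamma> (g \<alpha>)) < \<epsilon>" unfolding \<alpha>_def using near aX lA(2) a by blast
  have \<gamma>b: "dist b (\<gamma> (g \<beta>)) < \<epsilon>" unfolding \<beta>_def using near aX lB(2) b by blast
  have I_far: "\<epsilon> \<le> dist (\<gamma> (g t)) (\<gamma> (g \<beta>))" if t: "t \<in> I" for t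
  proof -
    obtain z where z: "z \<in> A" "t = lA z" using t by (auto simp: I_def)
    then have "dist z (\<gamma> (g t)) < \<epsilon>" using near lA(2) AX by blast
    then show ?thesis using farA[OF z(1)] \<gamma>b dist_triangle[of z b "\<gamma> (g t)"] dist_triangle[of "\<gamma> (g t)" b "\<gamma> (g \<beta>)"]
      by (simp add: dist_commute)
  qed
  have J_far: "\<epsilon> \<le> dist (\<gamma> (g t)) (\<gamma> (g \<alpha>))" if t: "t \<in> J" for t
  proof -
    obtain z where z: "z \<in> B" "t = lB z" using t by (auto simp: J_def)
    then have "dist z (\<gamma> (g t)) < \<epsilon>" using near lB(2) AX by blast
    then show ?thesis using farB[OF z(1)] \<gamma>a dist_triangle[of z a "\<gamma> (g t)"] dist_triangle[of "\<gamma> (g t)" a "\<gamma> (g \<alpha>)"]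
      by (simp add: dist_commute)
  qed
  have \<gamma>k: "\<gamma> (t + of_int k) = \<gamma> t" for t k by (rule periodic_real_int) (rule \<gamma>)
  have cg: "connected (g ` I)" "connected (g ` J)"
    using conn g by (meson connected_continuous_image continuous_on_subset subset_UNIV)+
  \<comment> \<open>All integer translates of \<open>g \<beta>\<close> are sent by
    \<open>\<gamma>\<close> to one point near \<open>b\<close>, so they are missed by the image of
    \<open>I\<close> under \<open>g\<close>, which thus has no two points a full turn apart. The
    same holds for \<open>J\<close> and \<open>g \<alpha>\<close>, and both bounds together give the
    2 needed for retracing.\<close>
  have "\<bar>g \<alpha> - g x\<bar> < 1"
  proof (rule connected_real_avoids_translates[OF cg(1), of _ _ "g \<beta>"])
    show "g \<beta> + of_int k \<notin> g ` I" for k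
      using I_far \<gamma>k[of "g \<beta>" k] \<epsilon> by (metis dist_self imageE not_less)
  qed (use \<alpha>\<beta> pIJ in auto)
  moreover have "\<bar>g x - g \<beta>\<bar> < 1"
  proof (rule connected_real_avoids_translates[OF cg(2), of _ _ "g \<alpha>"])
    show "g \<alpha> + of_int k \<notin> g ` J" for k
      using J_far \<gamma>k[of "g \<alpha>" k] \<epsilon> by (metis dist_self imageE not_less)
  qed (use \<alpha>\<beta> pIJ in auto)
  ultimately have g2: "\<bar>g \<alpha> - g \<beta>\<bar> \<le> 2" by linarith
  have IJ: "connected (I \<union> J)" using conn pIJ by (intro connected_Un) auto
  show False
  proof (cases "\<alpha> \<le> \<beta>")
    case True
    then obtain c d where cd: "\<alpha> \<le> c" "c \<le> d" "d \<le> \<beta>" "dist (\<gamma> (g c)) (\<gamma> (g \<beta>)) < \<epsilon>" "dist (\<gamma> (g d)) (\<gamma> (g \<alpha>)) < \<epsilon>"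
      using retrace[of \<alpha> \<beta>] g2 by auto
    have "c \<notin> I" "d \<notin> J" using I_far J_far cd by force+
    moreover have "c \<in> I \<union> J" using connected_real_Icc[OF IJ, of \<alpha> \<beta> c] \<alpha>\<beta> cd by auto
    ultimately show False using connected_real_Icc[OF conn(2), of c \<beta> d] \<alpha>\<beta> cd by auto
  next
    case False
    then obtain c d where cd: "\<beta> \<le> c" "c \<le> d" "d \<le> \<alpha>" "dist (\<gamma> (g c)) (\<gamma> (g \<alpha>)) < \<epsilon>" "dist (\<gamma> (g d)) (\<gamma> (g \<beta>)) < \<epsilon>"
      using retrace[of \<beta> \<alpha>] g2 by (auto simp: abs_minus_commute)
    have "d \<notin> I" "c \<notin> J" using I_far J_far cd by force+
    moreover have "c \<in> I \<union> J" using connected_real_Icc[OF IJ, of \<beta> \<alpha> c] \<alpha>\<beta> cd by auto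
    ultimately show False using connected_real_Icc[OF conn(1), of c \<alpha> d] \<alpha>\<beta> cd by auto
  qed
qed

section \<open>Towers of annuli\<close>

text \<open>\<open>H n\<close> is the inverse branch of \<open>G n\<close> at 0 on a neighbourhood
  of the closed unit disc. \<open>thin\<close> controls cells of full radial and small angular
  extent. The crookedness of annulus \<open>Suc n\<close> is measured at the scale of annulus
  \<open>n\<close>, whose outer boundary it follows.\<close>

locale annulus_tower =
  fixes G H :: "nat \<Rightarrow> complex \<Rightarrow> complex" and s \<rho> :: "nat \<Rightarrow> real"
  assumes G_hol: "G n holomorphic_on UNIV"
    and H_hol: "H n holomorphic_on ball 0 (s n)"
    and s_gt_1: "s n > 1"
    and G_H: "w \<in> ball 0 (s n) \<Longrightarrow> G n (H n w) = w"
    and H_0: "H n 0 = 0"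
    and rho: "0 < \<rho> n" "\<rho> n < 1"
    and thin: "\<exists>\<tau>>0. \<forall>r r' x x'. r \<in> {\<rho> n..1} \<longrightarrow> r' \<in> {\<rho> n..1} \<longrightarrow> \<bar>x - x'\<bar> \<le> \<tau> \<longrightarrow>
      dist (H n (of_real r * cis (2 * pi * x))) (H n (of_real r' * cis (2 * pi * x'))) < 1 / real (Suc n)"
    and nest_outer: "H (Suc n) ` cball 0 1 \<subseteq> H n ` ball 0 1"
    and nest_inner: "H n ` cball 0 (\<rho> n) \<subseteq> H (Suc n) ` ball 0 (\<rho> (Suc n))"
    and first_disc: "H 0 ` cball 0 1 \<subseteq> cball 0 1"
    and crooked: "crooked_shadow (1 / real (Suc n)) (H (Suc n) ` (cball 0 1 - ball 0 (\<rho> (Suc n))))"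
begin

definition core :: "complex set" where "core = (\<Union>n. H n ` ball 0 (\<rho> n))"

definition filled :: "complex set" where "filled = (\<Inter>n. H n ` cball 0 1)"

definition rim :: "complex set" where "rim = filled - core"

section \<open>Topology of the core, the filled set and the rim\<close>

lemma H_inj: "inj_on (H n) (ball 0 (s n))"
  by (metis G_H inj_onI)

lemma cball_sub: "cball 0 1 \<subseteq> ball (0::complex) (s n)"
  using s_gt_1[of n] by auto

lemma H_cont: "continuous_on (cball 0 1) (H n)"
  using H_hol cball_sub continuous_on_subset holomorphic_on_imp_continuous_on by blast

lemma disc_sub: "cball 0 (\<rho> n) \<subseteq> cball (0::complex) 1" "ball 0 (\<rho> n) \<subseteq> cball (0::complex) 1"
  using rho[of n] by auto

lemma H_image_eq: "\<lbrakk>w \<in> cball 0 1; T \<subseteq> cball 0 1; H n w \<in> H n ` T\<rbrakk> \<Longrightarrow> w \<in> T"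
  using H_inj[of n] cball_sub[of n] by (meson inj_on_image_mem_iff subset_trans subsetD)

lemma core_n_open: "open (H n ` ball 0 (\<rho> n))"
proof (rule open_mapping_thm3)
  have "ball 0 (\<rho> n) \<subseteq> ball (0::complex) (s n)" using disc_sub(2) cball_sub by blast
  then show "H n holomorphic_on ball 0 (\<rho> n)" "inj_on (H n) (ball 0 (\<rho> n))"
    using H_hol H_inj holomorphic_on_subset inj_on_subset by blast+
qed auto

lemma core_mono: "m \<le> n \<Longrightarrow> H m ` ball 0 (\<rho> m) \<subseteq> H n ` ball 0 (\<rho> n)"
proof (rule lift_Suc_mono_le[of "\<lambda>n. H n ` ball 0 (\<rho> n)"])
  show "H n ` ball 0 (\<rho> n) \<subseteq> H (Suc n) ` ball 0 (\<rho> (Suc n))" for n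
    using nest_inner[of n] ball_subset_cball by blast
qed auto

lemma disc_antimono: "m \<le> n \<Longrightarrow> H n ` cball 0 1 \<subseteq> H m ` cball 0 1"
proof (rule lift_Suc_antimono_le[of "\<lambda>n. H n ` cball 0 1"])
  show "H (Suc n) ` cball 0 1 \<subseteq> H n ` cball 0 1" for n
    using nest_outer[of n] ball_subset_cball by blast
qed auto

lemma core_sub_disc: "H m ` ball 0 (\<rho> m) \<subseteq> H n ` cball 0 1"
proof -
  have "H m ` ball 0 (\<rho> m) \<subseteq> H (max m n) ` ball 0 (\<rho> (max m n))" by (intro core_mono) auto
  also have "\<dots> \<subseteq> H (max m n) ` cball 0 1" using disc_sub by blast
  also have "\<dots> \<subseteq> H n ` cball 0 1" by (intro disc_antimono) auto
  finally show ?thesis .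
qed

lemma core_sub_filled: "core \<subseteq> filled"
  unfolding core_def filled_def using core_sub_disc by blast

lemma core_open: "open core"
  unfolding core_def using core_n_open by blast

lemma zero_in_core: "0 \<in> core"
  unfolding core_def using rho(1)[of 0] H_0[of 0] by (auto intro!: image_eqI[of _ _ 0] exI[of _ 0])

lemma homeomorphic_disc: "T \<subseteq> cball 0 1 \<Longrightarrow> T homeomorphic H n ` T"
proof -
  assume T: "T \<subseteq> cball 0 1"
  have "continuous_on (H n ` T) (G n)"
    using G_hol holomorphic_on_imp_continuous_on continuous_on_subset by blast
  then have "homeomorphism T (H n ` T) (H n) (G n)"
    using G_H[of _ n] cball_sub[of n] T
    by (intro homeomorphismI continuous_on_subset[OF H_cont T]) (auto simp: subset_iff)
  then show ?thesis by (auto simp: homeomorphic_def)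
qed

lemma core_n_simply_connected: "simply_connected (H n ` ball 0 (\<rho> n))"
  using homeomorphic_disc[OF disc_sub(2), of n n] homeomorphic_simply_connected
    convex_imp_simply_connected[OF convex_ball] by blast

lemma core_connected: "connected core"
proof -
  have "connected (H n ` ball 0 (\<rho> n))" for n
    using core_n_simply_connected simply_connected_imp_connected by blast
  moreover have "0 \<in> H n ` ball 0 (\<rho> n)" for n using rho(1)[of n] H_0[of n] by (auto intro!: image_eqI[of _ _ 0])
  ultimately show ?thesis unfolding core_def by (intro connected_Union) blast+
qed

text \<open>Loops are compact, so any two of them lie in one of the increasing discs, where they are
  homotopic.\<close>

lemma core_simply_connected: "simply_connected core"
  unfolding simply_connected_homotopic_loops
proof (intro allI impI)
  fix p q :: "real \<Rightarrow> complex"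
  assume pq: "homotopic_loops core p p \<and> homotopic_loops core q q"
  have stage: "\<exists>n. path_image p \<subseteq> H n ` ball 0 (\<rho> n)" if pc: "path p" "path_image p \<subseteq> core" for p
  proof -
    define f where "f n = H n ` ball 0 (\<rho> n)" for n
    have f: "\<And>n. n \<in> UNIV \<Longrightarrow> open (f n)" "path_image p \<subseteq> (\<Union>n\<in>UNIV. f n)"
      unfolding f_def using pc(2) core_n_open by (simp_all add: core_def)
    obtain C where C: "C \<subseteq> UNIV" "finite C" "path_image p \<subseteq> (\<Union>n\<in>C. f n)"
      by (rule compactE_image[OF compact_path_image[OF pc(1)] f])
    have "f n \<subseteq> f (Max C)" if "n \<in> C" for n
      unfolding f_def using C(2) that by (intro core_mono Max_ge)
    then have "path_image p \<subseteq> f (Max C)" using C(3) by blast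
    then show ?thesis unfolding f_def by blast
  qed
  have p: "path p" "path_image p \<subseteq> core" "pathfinish p = pathstart p"
    and q: "path q" "path_image q \<subseteq> core" "pathfinish q = pathstart q"
    using pq unfolding homotopic_loops_refl by blast+
  obtain m n where mn: "path_image p \<subseteq> H m ` ball 0 (\<rho> m)" "path_image q \<subseteq> H n ` ball 0 (\<rho> n)"
    using stage[OF p(1,2)] stage[OF q(1,2)] by blast
  define k where "k = max m n"
  have "path_image p \<subseteq> H k ` ball 0 (\<rho> k)" "path_image q \<subseteq> H k ` ball 0 (\<rho> k)"
    using mn core_mono[of m k] core_mono[of n k] by (auto simp: k_def)
  then have "homotopic_loops (H k ` ball 0 (\<rho> k)) p q"
    using core_n_simply_connected[of k] p q unfolding simply_connected_homotopic_loops
    by (simp add: homotopic_loops_refl)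
  then show "homotopic_loops core p q"
    by (rule homotopic_loops_subset) (auto simp: core_def)
qed

lemma disc_compact: "compact (H n ` cball 0 1)"
  by (intro compact_continuous_image H_cont) auto

lemma filled_compact: "compact filled"
proof -
  have "closed filled" unfolding filled_def using disc_compact compact_imp_closed by blast
  moreover have "bounded filled"
    by (rule bounded_subset[OF compact_imp_bounded[OF disc_compact[of 0]]]) (auto simp: filled_def)
  ultimately show ?thesis by (simp add: compact_eq_bounded_closed)
qed

lemma rim_compact: "compact rim"
  unfolding rim_def using filled_compact core_open by (simp add: compact_diff)

lemma filled_sub: "filled \<subseteq> cball 0 1"
  using first_disc by (auto simp: filled_def)

lemma annulus_eq: "H n ` cball 0 1 - H n ` ball 0 (\<rho> n) = H n ` (cball 0 1 - ball 0 (\<rho> n))"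
  using inj_on_image_set_diff[OF H_inj[of n], of "cball 0 1" "ball 0 (\<rho> n)"] cball_sub[of n] disc_sub(2)[of n] by auto

lemma rim_eq: "rim = (\<Inter>n. H n ` (cball 0 1 - ball 0 (\<rho> n)))"
  unfolding annulus_eq[symmetric] rim_def filled_def core_def by blast

lemma rim_polar:
  assumes "z \<in> rim"
  obtains r x where "z = H n (of_real r * cis (2 * pi * x))" "r \<in> {\<rho> n..1}" "0 < x" "x \<le> 1"
proof -
  obtain w where w: "z = H n w" "w \<in> cball 0 1" "w \<notin> ball 0 (\<rho> n)" using assms unfolding rim_eq by blast
  obtain x where "w = of_real (norm w) * cis (2 * pi * x)" "0 < x" "x \<le> 1" using polar_2pi .
  then show thesis using that[of "norm w" x] w by auto
qed

lemma polar_in_cball: "r \<in> {\<rho> n..1} \<Longrightarrow> of_real r * cis (2 * pi * x) \<in> cball 0 1"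
  using rho(1)[of n] by (auto simp: norm_mult)

lemma inner_in_core: "H n (of_real (\<rho> n) * cis (2 * pi * x)) \<in> core"
proof -
  have "of_real (\<rho> n) * cis (2 * pi * x) \<in> cball 0 (\<rho> n)" using rho(1)[of n] by (simp add: norm_mult)
  then have "H n (of_real (\<rho> n) * cis (2 * pi * x)) \<in> H (Suc n) ` ball 0 (\<rho> (Suc n))"
    using nest_inner by blast
  then show ?thesis unfolding core_def by blast
qed

lemma outer_notin_filled: "H n (cis (2 * pi * x)) \<notin> filled"
proof
  assume "H n (cis (2 * pi * x)) \<in> filled"
  then have "H n (cis (2 * pi * x)) \<in> H n ` ball 0 1" using nest_outer[of n] by (auto simp: filled_def)
  then have "cis (2 * pi * x) \<in> ball 0 1"
    using H_image_eq[of "cis (2 * pi * x)" "ball 0 1" n] ball_subset_cball by simp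
  then show False by simp
qed

text \<open>Radii of the n-th annulus have small diameter and join the core to the outside: the
  inner end is absorbed by the next inner disc, and the outer end is left out by the next outer
  disc. This determines closure, interior and frontier of the core without any regularity of the
  boundary.\<close>

lemma rim_approximated:
  assumes z: "z \<in> rim" and e: "e > 0"
  shows "\<exists>y\<in>core. dist z y < e" "\<exists>y. y \<notin> filled \<and> dist z y < e"
proof -
  obtain n where n: "1 / real (Suc n) < e" using e reals_Archimedean by (metis inverse_eq_divide)
  obtain r x where rx: "z = H n (of_real r * cis (2 * pi * x))" "r \<in> {\<rho> n..1}" using rim_polar[OF z] by metis
  obtain \<tau> where \<tau>: "\<tau> > 0" "\<And>r r' x x'. \<lbrakk>r \<in> {\<rho> n..1}; r' \<in> {\<rho> n..1}; \<bar>x - x'\<bar> \<le> \<tau>\<rbrakk> \<Longrightarrow>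
      dist (H n (of_real r * cis (2 * pi * x))) (H n (of_real r' * cis (2 * pi * x'))) < 1 / real (Suc n)"
    using thin[of n] by blast
  have "dist z (H n (of_real (\<rho> n) * cis (2 * pi * x))) < e"
    using \<tau>(2)[OF rx(2), of "\<rho> n" x x] rho[of n] \<tau>(1) n unfolding rx(1) by auto
  then show "\<exists>y\<in>core. dist z y < e" using inner_in_core by blast
  have "dist z (H n (of_real 1 * cis (2 * pi * x))) < e"
    using \<tau>(2)[OF rx(2), of 1 x x] rho[of n] \<tau>(1) n unfolding rx(1) by auto
  then show "\<exists>y. y \<notin> filled \<and> dist z y < e" using outer_notin_filled[of n x] by auto
qed

lemma closure_core: "closure core = filled"
proof
  show "closure core \<subseteq> filled"
    using core_sub_filled filled_compact by (simp add: closure_minimal compact_imp_closed)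
  show "filled \<subseteq> closure core"
  proof
    fix z assume "z \<in> filled"
    then consider "z \<in> core" | "z \<in> rim" by (auto simp: rim_def)
    then show "z \<in> closure core"
    proof cases
      case 2
      then show ?thesis unfolding closure_approachable using rim_approximated(1) by (metis dist_commute)
    qed (use closure_subset in auto)
  qed
qed

lemma interior_filled: "interior filled = core"
proof
  show "core \<subseteq> interior filled" using core_open core_sub_filled by (simp add: interior_maximal)
  show "interior filled \<subseteq> core"
  proof
    fix z assume z: "z \<in> interior filled"
    then obtain e where "e > 0" "ball z e \<subseteq> filled" by (auto simp: mem_interior)
    then have "z \<notin> rim" using rim_approximated(2)[of z e] by (auto simp: subset_iff)
    then show "z \<in> core" using z interior_subset by (auto simp: rim_def)
  qed
qed

lemma frontier_core: "frontier core = rim"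
  unfolding frontier_def closure_core interior_open[OF core_open] rim_def ..

lemma rim_connected: "connected rim" and rim_nonempty: "rim \<noteq> {}"
proof -
  define A where "A n = H n ` (cball 0 1 - ball 0 (\<rho> n))" for n
  have c: "compact (A n)" for n unfolding A_def
    by (intro compact_continuous_image continuous_on_subset[OF H_cont] compact_diff) auto
  have "connected (cball 0 1 - ball (0::complex) (\<rho> n))" for n
    using disc_sub(1)[of n] by (intro connected_diff_ball) auto
  then have conn: "connected (A n)" for n unfolding A_def
    by (intro connected_continuous_image continuous_on_subset[OF H_cont]) auto
  have "1 \<in> cball 0 1 - ball (0::complex) (\<rho> n)" for n using rho(2)[of n] by auto
  then have ne: "A n \<noteq> {}" for n unfolding A_def by blast
  have mono: "A n \<subseteq> A m" if "m \<le> n" for m n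
    using core_mono[OF that] disc_antimono[OF that] unfolding A_def annulus_eq[symmetric] by blast
  have "rim = \<Inter> (range A)" unfolding rim_eq A_def ..
  then show "connected rim" "rim \<noteq> {}" using connected_nest[of A, OF c conn mono] compact_nest[of A, OF c ne mono] by auto
qed

lemma rim_continuum: "continuum rim"
  using rim_connected rim_nonempty rim_compact by (simp add: continuum_def)

text \<open>An increasing union of complements of closed topological discs, all containing the point
  2.\<close>

lemma outside_connected: "connected (- filled)"
proof -
  have eq: "- filled = (\<Union>n. - H n ` cball 0 1)" by (auto simp: filled_def)
  have "connected (- H n ` cball 0 1)" for n
    using connected_complement_homeomorphic_convex_compact[of "H n ` cball 0 1" "cball (0::complex) 1"]
      homeomorphic_disc[of "cball 0 1" n] homeomorphic_sym by auto
  moreover have "2 \<in> - H n ` cball 0 1" for n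
    using disc_antimono[of 0 n] first_disc by fastforce
  ultimately show ?thesis unfolding eq by (intro connected_Union) blast+
qed

lemma components_complement_rim: "components (- rim) = {core, - filled}"
proof -
  have un: "- rim = core \<union> - filled" using core_sub_filled by (auto simp: rim_def)
  have oh: "open (- filled)" using filled_compact by (simp add: compact_imp_closed open_Compl)
  have dis: "core \<inter> - filled = {}" "- filled \<inter> core = {}" using core_sub_filled by auto
  have max: "c \<subseteq> U" if c: "connected c" "c \<subseteq> U \<union> V" "x \<in> c" "x \<in> U" and UV: "open U" "open V" "U \<inter> V = {}" for c U V :: "complex set" and x
    using connectedD[OF c(1) UV(1,2)] UV(3) c by blast
  have c1: "connected_component_set (- rim) x = core" if "x \<in> core" for x
    by (rule connected_component_unique) (use that un core_connected max[OF _ _ _ that core_open oh dis(1)] in auto)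
  have c2: "connected_component_set (- rim) x = - filled" if "x \<in> - filled" for x
    by (rule connected_component_unique) (use that un outside_connected max[OF _ _ _ that oh core_open dis(2)] in \<open>auto simp: Un_commute\<close>)
  have "2 \<in> - filled" using filled_sub by (auto simp: subset_iff)
  then have "connected_component_set (- rim) ` (- filled) = {- filled}" using c2 by (auto intro!: image_eqI[of _ _ 2])
  moreover have "connected_component_set (- rim) ` core = {core}"
    using c1 zero_in_core by (auto intro!: image_eqI[of _ _ 0])
  ultimately show ?thesis
    by (simp add: components_def un image_Un insert_commute)
qed

lemma card_components: "card (components (- rim)) = 2"
proof -
  have "core \<noteq> - filled" using zero_in_core core_sub_filled by blast
  then show ?thesis by (simp add: components_complement_rim)
qed

lemma rim_hereditarily_indecomposable: "hereditarily_indecomposable rim"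
proof (rule hereditarily_indecomposable_if_crooked)
  fix e :: real assume "e > 0"
  then obtain n where n: "1 / real (Suc n) < e" using reals_Archimedean by (metis inverse_eq_divide)
  have "crooked_shadow (1 / real (Suc n)) rim"
    by (rule crooked_shadow_subset[OF crooked[of n]]) (auto simp: rim_eq)
  then show "crooked_shadow e rim"
    unfolding crooked_shadow_def using n by (elim ex_forward conj_forward) (force intro: less_trans)+
qed

text \<open>A radius starts in the core and ends outside it, so it crosses the frontier. This
  guarantees that overlapping sectors really have points of the rim in common.\<close>

lemma radius_meets_rim: "\<exists>r\<in>{\<rho> n..1}. H n (of_real r * cis (2 * pi * x)) \<in> rim"
proof -
  define L where "L = (\<lambda>r. H n (of_real r * cis (2 * pi * x))) ` {\<rho> n..1}"
  have "connected L" unfolding L_def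
    using polar_in_cball[of _ n x]
    by (intro connected_continuous_image continuous_on_compose2[OF H_cont] continuous_intros) auto
  moreover have "L \<inter> core \<noteq> {}" using inner_in_core[of n x] rho(2)[of n] unfolding L_def by force
  moreover have "H n (of_real 1 * cis (2 * pi * x)) \<in> L" unfolding L_def by (rule imageI) (use rho(2)[of n] in auto)
  then have "L - core \<noteq> {}" using outer_notin_filled[of n x] core_sub_filled by auto
  ultimately have "L \<inter> frontier core \<noteq> {}" by (rule connected_Int_frontier)
  then show ?thesis unfolding frontier_core L_def by blast
qed

end

section \<open>Circular chains on the rim cut out by angular sectors\<close>

definition sector :: "real \<Rightarrow> real \<Rightarrow> complex set" where
  "sector \<alpha> \<beta> = {w. \<exists>r t. r > 0 \<and> \<alpha> < t \<and> t < \<beta> \<and> w = of_real r * cis (2 * pi * t)}"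

lemma in_sectorI:
  assumes "r > 0" "m > 0" "a < m * t" "m * t < b"
  shows "of_real r * cis (2 * pi * t) \<in> sector (a / m) (b / m)"
proof -
  have "a / m < t" "t < b / m" using assms by (auto simp: field_simps)
  then show ?thesis unfolding sector_def using assms(1) by blast
qed

lemma sector_open: "open (sector \<alpha> \<beta>)"
proof -
  define T where "T = {z. 2 * pi * \<alpha> < Im z} \<inter> {z. Im z < 2 * pi * \<beta>}"
  have "open T" unfolding T_def by (intro open_Int open_halfspace_Im_gt open_halfspace_Im_lt)
  moreover have nc: "\<not> (exp :: complex \<Rightarrow> complex) constant_on UNIV"
  proof
    assume "(exp :: complex \<Rightarrow> complex) constant_on UNIV"
    then have "exp (1 :: complex) = exp 0" unfolding constant_on_def by (metis UNIV_I)
    then have "exp (1 :: real) = 1" by (metis exp_of_real exp_zero of_real_1 of_real_eq_1_iff)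
    then show False by simp
  qed
  ultimately have "open (exp ` T)"
    by (intro open_mapping_thm[OF _ open_UNIV connected_UNIV _ _ nc]) (auto intro: holomorphic_intros)
  moreover have "exp ` T = sector \<alpha> \<beta>"
  proof
    show "exp ` T \<subseteq> sector \<alpha> \<beta>"
    proof
      fix w assume "w \<in> exp ` T"
      then obtain z where z: "w = exp z" "2 * pi * \<alpha> < Im z" "Im z < 2 * pi * \<beta>" by (auto simp: T_def)
      have "w = of_real (exp (Re z)) * cis (2 * pi * (Im z / (2 * pi)))"
        unfolding z(1) by (simp add: exp_eq_polar)
      moreover have "\<alpha> < Im z / (2 * pi)" "Im z / (2 * pi) < \<beta>" using z by (auto simp: field_simps)
      ultimately show "w \<in> sector \<alpha> \<beta>" unfolding sector_def using exp_gt_zero by blast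
    qed
    show "sector \<alpha> \<beta> \<subseteq> exp ` T"
    proof
      fix w assume "w \<in> sector \<alpha> \<beta>"
      then obtain r t where rt: "r > 0" "\<alpha> < t" "t < \<beta>" "w = of_real r * cis (2 * pi * t)" by (auto simp: sector_def)
      have "w = exp (Complex (ln r) (2 * pi * t))" using rt by (simp add: exp_eq_polar)
      moreover have "Complex (ln r) (2 * pi * t) \<in> T" using rt by (simp add: T_def)
      ultimately show "w \<in> exp ` T" by blast
    qed
  qed
  ultimately show ?thesis by simp
qed

lemma overlapping_residues:
  fixes i j m :: nat and k :: int
  assumes "i < m" "j < m" and int: "\<bar>int i - int j - k * int m\<bar> \<le> 1"
  shows "i = j \<or> j = (i + 1) mod m \<or> i = (j + 1) mod m"
proof -
  have m: "int i < int m" "int j < int m" "0 \<le> int i" "0 \<le> int j" using assms by auto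
  have "-1 \<le> k \<and> k \<le> 1"
  proof (rule ccontr)
    assume "\<not> (-1 \<le> k \<and> k \<le> 1)"
    then consider "k \<ge> 2" | "k \<le> -2" by linarith
    then show False
    proof cases
      case 1
      then have "2 * int m \<le> k * int m" by (intro mult_right_mono) auto
      then show False using int m by linarith
    next
      case 2
      then have "k * int m \<le> (-2) * int m" by (intro mult_right_mono) auto
      then show False using int m by linarith
    qed
  qed
  then consider "k = 0" | "k = 1" | "k = -1" by linarith
  then show ?thesis
  proof cases
    case 1
    then have "\<bar>int i - int j\<bar> \<le> 1" using int by simp
    then consider "i = j" | "j = i + 1" | "i = j + 1" by linarith
    then show ?thesis by cases (use assms in auto)
  next
    case 2
    then have "i + 1 = m" "j = 0" using int m by auto
    then show ?thesis by simp
  next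
    case 3
    then have "j + 1 = m" "i = 0" using int m by auto
    then show ?thesis by simp
  qed
qed

context annulus_tower
begin

text \<open>In the coordinate \<open>G n\<close> the links are sectors of width \<open>3/2\<close>
  placed at unit steps, the unit being \<open>1 / m\<close> of a turn: neighbours overlap by half a
  unit and all other pairs are disjoint. Thinness makes the links small however the rim wanders
  radially.\<close>

lemma rim_circularly_chainable: "circularly_chainable rim"
  unfolding circularly_chainable_def
proof (intro conjI allI impI)
  show "continuum rim" by (rule rim_continuum)
  fix \<epsilon> :: real assume "\<epsilon> > 0"
  then obtain n where n: "1 / real (Suc n) < \<epsilon>" using reals_Archimedean by (metis inverse_eq_divide)
  obtain \<tau> where \<tau>: "\<tau> > 0" "\<And>r r' x x'. \<lbrakk>r \<in> {\<rho> n..1}; r' \<in> {\<rho> n..1}; \<bar>x - x'\<bar> \<le> \<tau>\<rbrakk> \<Longrightarrow>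
      dist (H n (of_real r * cis (2 * pi * x))) (H n (of_real r' * cis (2 * pi * x'))) < 1 / real (Suc n)"
    using thin[of n] by blast
  \<comment> \<open>With more than \<open>2 / \<tau>\<close> links, each spans an angle below
    \<open>\<tau>\<close>; at least 4 links are prescribed for a circular chain.\<close>
  obtain m0 :: nat where m0: "2 / \<tau> < real m0" using reals_Archimedean2 by blast
  define m where "m = max 4 m0"
  have m: "m \<ge> 4" "real m > 0" by (auto simp: m_def)
  have "2 / \<tau> < real m" using m0 by (simp add: m_def)
  then have m\<tau>: "2 / real m \<le> \<tau>" using \<tau>(1) m by (simp add: field_simps)
  define e where "e i = rim \<inter> G n -` sector (real i / real m) ((real i + 3/2) / real m)" for i :: nat
  have link: "\<exists>r t. z = H n (of_real r * cis (2 * pi * t)) \<and> r \<in> {\<rho> n..1} \<and> real i < real m * t \<and> real m * t < real i + 3/2 \<and> G n z = of_real r * cis (2 * pi * t)"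
    if "z \<in> e i" for z i
  proof -
    have z: "z \<in> rim" "G n z \<in> sector (real i / real m) ((real i + 3/2) / real m)" using that by (auto simp: e_def)
    obtain r x where rx: "z = H n (of_real r * cis (2 * pi * x))" "r \<in> {\<rho> n..1}" using rim_polar[OF z(1)] by metis
    have Gz: "G n z = of_real r * cis (2 * pi * x)"
      unfolding rx(1) using polar_in_cball[OF rx(2)] cball_sub by (intro G_H) blast
    obtain r' t where t: "r' > 0" "real i / real m < t" "t < (real i + 3/2) / real m" "G n z = of_real r' * cis (2 * pi * t)"
      using z(2) by (auto simp: sector_def)
    have "r = r'" using arg_cong[OF trans[OF Gz[symmetric] t(4)], of norm] t(1) rx(2) rho(1)[of n] by (simp add: norm_mult)
    then have "z = H n (of_real r * cis (2 * pi * t))" using t(4) Gz rx(1) by metis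
    then show ?thesis using rx(2) t \<open>r = r'\<close> m by (intro exI[of _ r] exI[of _ t]) (auto simp: field_simps)
  qed
  have meet: "e i \<inter> e j \<noteq> {}"
    if t: "real i < real m * t" "real m * t < real i + 3/2" "real j < real m * (t + of_int k)" "real m * (t + of_int k) < real j + 3/2" for i j t k
  proof -
    obtain r where r: "r \<in> {\<rho> n..1}" "H n (of_real r * cis (2 * pi * t)) \<in> rim" using radius_meets_rim by blast
    have r0: "r > 0" using r(1) rho(1)[of n] by auto
    have Gz: "G n (H n (of_real r * cis (2 * pi * t))) = of_real r * cis (2 * pi * t)"
      using polar_in_cball[OF r(1)] cball_sub by (intro G_H) blast
    have "cis (2 * pi * (t + of_int k)) = cis (2 * pi * t)" unfolding cis_2pi_eq_iff by auto
    then have Gz': "G n (H n (of_real r * cis (2 * pi * t))) = of_real r * cis (2 * pi * (t + of_int k))" using Gz by simp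
    have "H n (of_real r * cis (2 * pi * t)) \<in> e i"
      unfolding e_def using r(2) in_sectorI[OF r0 m(2) t(1,2)] by (simp add: Gz)
    moreover have "H n (of_real r * cis (2 * pi * t)) \<in> e j"
      unfolding e_def using r(2) in_sectorI[OF r0 m(2) t(3,4)] by (simp add: Gz')
    ultimately show ?thesis by blast
  qed
  have next_meet: "e i \<inter> e ((i + 1) mod m) \<noteq> {}" if "i < m" for i
  proof (cases "i + 1 = m")
    case True
    have a: "real m = real i + 1" using True by auto
    \<comment> \<open>\<open>5/4\<close> is the middle of the overlap \<open>(1, 3/2)\<close>. For
      the last link, one turn back, it is the point \<open>1/4\<close> of link 0.\<close>
    define T where "T = (real i + 5/4) / real m"
    have T: "real m * T = real i + 5/4" using m by (simp add: T_def)
    then have T': "real m * (T + of_int (-1)) = 1/4" using a by (simp add: algebra_simps)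
    have "e i \<inter> e 0 \<noteq> {}" using meet[of i T 0 "-1", unfolded T T'] by simp
    then show ?thesis using True by simp
  next
    case False
    then have "(i + 1) mod m = i + 1" using that by simp
    moreover have "e i \<inter> e (i + 1) \<noteq> {}"
      using meet[of i "(real i + 5/4) / real m" "i + 1" 0] m by simp
    ultimately show ?thesis by simp
  qed
  have "circular_chain (top_of_set rim) m e"
    unfolding circular_chain_def
  proof (intro conjI allI impI)
    show "4 \<le> m" by (rule m(1))
    show "openin (top_of_set rim) (e i)" for i
    proof -
      have "continuous_on UNIV (G n)" using G_hol holomorphic_on_imp_continuous_on by blast
      then have "open (G n -` sector (real i / real m) ((real i + 3/2) / real m))"
        by (intro open_vimage sector_open)
      then show ?thesis unfolding e_def by (rule openin_open_Int)
    qed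
    fix i j assume ij: "i < m" "j < m"
    show "e i \<inter> e j \<noteq> {} \<longleftrightarrow> i = j \<or> j = (i + 1) mod m \<or> i = (j + 1) mod m"
    proof
      assume "e i \<inter> e j \<noteq> {}"
      then obtain z where z: "z \<in> e i" "z \<in> e j" by blast
      obtain r t where t: "r \<in> {\<rho> n..1}" "real i < real m * t" "real m * t < real i + 3/2" "G n z = of_real r * cis (2 * pi * t)"
        using link[OF z(1)] by blast
      obtain r' t' where t': "r' \<in> {\<rho> n..1}" "real j < real m * t'" "real m * t' < real j + 3/2" "G n z = of_real r' * cis (2 * pi * t')"
        using link[OF z(2)] by blast
      have r0: "r > 0" "r' > 0" using t(1) t'(1) rho(1)[of n] by auto
      have "r = r'" using arg_cong[OF trans[OF t(4)[symmetric] t'(4)], of norm] r0 by (simp add: norm_mult)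
      then have "cis (2 * pi * t) = cis (2 * pi * t')" using t(4) t'(4) r0 by simp
      then obtain k :: int where k: "t = t' + of_int k" unfolding cis_2pi_eq_iff by blast
      have "real m * t = real m * t' + of_int k * real m" unfolding k by (simp add: algebra_simps)
      then have lt: "\<bar>real i - real j - of_int k * real m\<bar> < 2" using t t' by linarith
      have "real_of_int \<bar>int i - int j - k * int m\<bar> < of_int 2" using lt by simp
      then have "\<bar>int i - int j - k * int m\<bar> \<le> 1" unfolding of_int_less_iff by linarith
      then show "i = j \<or> j = (i + 1) mod m \<or> i = (j + 1) mod m"
        using overlapping_residues[OF ij] by blast
    next
      assume "i = j \<or> j = (i + 1) mod m \<or> i = (j + 1) mod m"
      moreover have "e i \<inter> e i \<noteq> {}" for i
        using meet[of i "(real i + 1/2) / real m" i 0] m by simp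
      ultimately show "e i \<inter> e j \<noteq> {}" using next_meet ij by (metis Int_commute)
    qed
  qed
  moreover have "rim \<subseteq> (\<Union>i<m. e i)"
  proof
    fix z assume z: "z \<in> rim"
    obtain r x where rx: "z = H n (of_real r * cis (2 * pi * x))" "r \<in> {\<rho> n..1}" "0 < x" "x \<le> 1" using rim_polar[OF z] by metis
    have Gz: "G n z = of_real r * cis (2 * pi * x)"
      unfolding rx(1) using polar_in_cball[OF rx(2)] cball_sub by (intro G_H) blast
    have mx: "0 < real m * x" "real m * x \<le> real m" using rx m by auto
    \<comment> \<open>Sectors omit their left end, so \<open>m * x\<close> is rounded up and then
      lowered by one; with \<open>x\<close> in \<open>(0, 1]\<close> this gives
      \<open>i < m * x \<le> i + 1\<close> and \<open>i < m\<close> even at the seam.\<close>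
    define i where "i = nat (\<lceil>real m * x\<rceil> - 1)"
    have c: "\<lceil>real m * x\<rceil> \<ge> 1" "\<lceil>real m * x\<rceil> \<le> int m" using mx by (auto simp: ceiling_le_iff)
    have "int i = \<lceil>real m * x\<rceil> - 1" unfolding i_def int_nat_eq using c(1) by presburger
    then have i: "real i = of_int \<lceil>real m * x\<rceil> - 1" "i < m" using c(2) by linarith+
    have "real i < real m * x" "real m * x < real i + 3/2" unfolding i by linarith+
    moreover have "r > 0" using rx(2) rho(1)[of n] by auto
    ultimately have "z \<in> e i" unfolding e_def
      using z in_sectorI[of r "real m" "real i" x] m by (simp add: Gz)
    then show "z \<in> (\<Union>i<m. e i)" using i by blast
  qed
  moreover have "diameter (e i) < \<epsilon>" for i
  proof -
    have "diameter (e i) \<le> 1 / real (Suc n)"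
    proof (rule diameter_le)
      fix z z' assume "z \<in> e i" "z' \<in> e i"
      then obtain r t r' t' where rt: "z = H n (of_real r * cis (2 * pi * t))" "r \<in> {\<rho> n..1}" "real i < real m * t" "real m * t < real i + 3/2"
        "z' = H n (of_real r' * cis (2 * pi * t'))" "r' \<in> {\<rho> n..1}" "real i < real m * t'" "real m * t' < real i + 3/2"
        using link by metis
      have "\<bar>real m * t - real m * t'\<bar> \<le> 2" using rt by linarith
      then have "real m * \<bar>t - t'\<bar> \<le> 2" using m by (simp add: abs_mult flip: right_diff_distrib)
      then have "\<bar>t - t'\<bar> \<le> 2 / real m" using m by (simp add: field_simps)
      then have "\<bar>t - t'\<bar> \<le> \<tau>" using m\<tau> by linarith
      from \<tau>(2)[OF rt(2,6) this] show "norm (z - z') \<le> 1 / real (Suc n)"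
        unfolding rt(1,5) dist_norm by simp
    qed simp
    then show ?thesis using n by simp
  qed
  ultimately show "\<exists>m e. circular_chain (top_of_set rim) m e \<and> rim \<subseteq> (\<Union>i<m. e i) \<and> (\<forall>i<m. diameter (e i) < \<epsilon>)"
    by blast
qed

theorem rim_pseudo_circle: "pseudo_circle rim"
  unfolding pseudo_circle_def
  using rim_continuum rim_circularly_chainable rim_hereditarily_indecomposable card_components by blast

end

section \<open>The limit map and its Siegel disk\<close>

text \<open>The closed intervals of radius \<open>\<sigma> n\<close> about \<open>\<theta> n\<close>
  are nested and eliminate the rationals one at a time, so their common point is irrational. All
  \<open>F n\<close> share the disc of radius 2, while every linearization disc stays in the unit
  disc.\<close>

locale siegel_tower = annulus_tower G H s \<rho> for G H s \<rho> +
  fixes F :: "nat \<Rightarrow> complex \<Rightarrow> complex" and \<theta> \<sigma> :: "nat \<Rightarrow> real"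
  assumes F_hol: "F n holomorphic_on ball 0 2"
    and F_0: "F n 0 = 0"
    and G_F: "z \<in> ball 0 2 \<Longrightarrow> G n (F n z) = cis (2 * pi * \<theta> n) * G n z"
    and F_close: "z \<in> ball 0 2 \<Longrightarrow> norm (F (Suc n) z - F n z) \<le> (1/2) ^ n"
    and sigma: "0 \<le> \<sigma> n" "\<sigma> n \<le> (1/2) ^ n"
    and theta_nest: "\<bar>\<theta> (Suc n) - \<theta> n\<bar> + \<sigma> (Suc n) \<le> \<sigma> n"
    and theta_avoid: "from_nat_into \<rat> n \<notin> {\<theta> (Suc n) - \<sigma> (Suc n)..\<theta> (Suc n) + \<sigma> (Suc n)}"
begin

definition limit_map :: "complex \<Rightarrow> complex" where "limit_map z = lim (\<lambda>n. F n z)"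

definition rotation_number :: real where "rotation_number = lim \<theta>"

lemma rotation_number_in: "rotation_number \<in> {\<theta> n - \<sigma> n..\<theta> n + \<sigma> n}"
  and theta_tendsto: "\<theta> \<longlonglongrightarrow> rotation_number"
proof -
  define I where "I n = {\<theta> n - \<sigma> n..\<theta> n + \<sigma> n}" for n
  have mono: "I n \<subseteq> I m" if "m \<le> n" for m n
  proof (rule lift_Suc_antimono_le[of I, OF _ that])
    show "I (Suc n) \<subseteq> I n" for n using theta_nest[of n] by (auto simp: I_def abs_if split: if_splits)
  qed
  have "\<Inter> (range I) \<noteq> {}"
    by (rule compact_nest[of I]) (use mono sigma(1) in \<open>auto simp: I_def\<close>)
  then obtain t where t: "\<And>n. t \<in> I n" by blast
  have "(\<lambda>n. \<theta> n - t) \<longlonglongrightarrow> 0"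
  proof (rule Lim_null_comparison)
    have "norm (\<theta> n - t) \<le> (1/2) ^ n" for n using t[of n] sigma(2)[of n] by (auto simp: I_def abs_le_iff)
    then show "\<forall>\<^sub>F n in sequentially. norm (\<theta> n - t) \<le> (1/2) ^ n" by simp
  qed (simp add: LIMSEQ_realpow_zero)
  then have lim: "\<theta> \<longlonglongrightarrow> t" by (simp add: LIM_zero_iff)
  then have "rotation_number = t" unfolding rotation_number_def by (rule limI)
  then show "rotation_number \<in> {\<theta> n - \<sigma> n..\<theta> n + \<sigma> n}" "\<theta> \<longlonglongrightarrow> rotation_number"
    using t lim by (auto simp: I_def)
qed

lemma rotation_number_irrational: "rotation_number \<notin> \<rat>"
proof
  assume "rotation_number \<in> \<rat>"
  then obtain n where "from_nat_into \<rat> n = rotation_number"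
    using from_nat_into_surj[OF countable_rat] by blast
  then show False using theta_avoid[of n] rotation_number_in[of "Suc n"] by simp
qed

section \<open>Convergence of the maps, derivative of the limit and invariance of the core\<close>

lemma uniform_limit_F: "uniform_limit (ball 0 2) F limit_map sequentially"
proof -
  have "uniformly_convergent_on (ball 0 2) (\<lambda>n z. \<Sum>i<n. F (Suc i) z - F i z)"
    by (rule Weierstrass_m_test'[where M = "\<lambda>n. (1/2) ^ n"]) (use F_close in \<open>auto simp: summable_geometric\<close>)
  then have "uniformly_convergent_on (ball 0 2) (\<lambda>n z. F 0 z + (\<Sum>i<n. F (Suc i) z - F i z))"
    by (intro uniformly_convergent_add uniformly_convergent_on_const)
  moreover have "F 0 z + (\<Sum>i<n. F (Suc i) z - F i z) = F n z" for n z
    by (subst sum_lessThan_telescope) simp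
  ultimately have "uniformly_convergent_on (ball 0 2) F" by simp
  then show ?thesis
    unfolding uniformly_convergent_uniform_limit_iff limit_map_def[abs_def] .
qed

lemma F_tendsto: "z \<in> ball 0 2 \<Longrightarrow> (\<lambda>n. F n z) \<longlonglongrightarrow> limit_map z"
  using uniform_limit_F by (rule tendsto_uniform_limitI)

lemma deriv_G_0: "deriv (G n) 0 \<noteq> 0"
proof -
  have b: "0 \<in> ball 0 (s n)" using s_gt_1[of n] by simp
  have "(H n has_field_derivative deriv (H n) 0) (at 0)" by (rule holomorphic_derivI[OF H_hol open_ball b])
  moreover have "(G n has_field_derivative deriv (G n) 0) (at (H n 0))"
    using holomorphic_derivI[OF G_hol open_UNIV, of 0 n] H_0 by simp
  ultimately have "((\<lambda>w. G n (H n w)) has_field_derivative deriv (H n) 0 * deriv (G n) 0) (at 0)"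
    by (metis DERIV_chain' mult.commute)
  then have "((\<lambda>w. w) has_field_derivative deriv (H n) 0 * deriv (G n) 0) (at 0)"
    by (rule has_field_derivative_transform_within_open[OF _ open_ball b]) (rule G_H)
  then have "deriv (H n) 0 * deriv (G n) 0 = 1" using DERIV_ident DERIV_unique by blast
  then show ?thesis by auto
qed

lemma F_deriv: "deriv (F n) 0 = cis (2 * pi * \<theta> n)"
proof -
  have b: "0 \<in> ball (0::complex) 2" by simp
  have dG: "(G n has_field_derivative deriv (G n) 0) (at 0)"
    using holomorphic_derivI[OF G_hol open_UNIV, of 0 n] by simp
  have "(F n has_field_derivative deriv (F n) 0) (at 0)" by (rule holomorphic_derivI[OF F_hol open_ball b])
  then have "((\<lambda>z. G n (F n z)) has_field_derivative deriv (F n) 0 * deriv (G n) 0) (at 0)"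
    using dG F_0[of n] by (metis DERIV_chain' mult.commute)
  then have "((\<lambda>z. cis (2 * pi * \<theta> n) * G n z) has_field_derivative deriv (F n) 0 * deriv (G n) 0) (at 0)"
    by (rule has_field_derivative_transform_within_open[OF _ open_ball b]) (rule G_F)
  moreover have "((\<lambda>z. cis (2 * pi * \<theta> n) * G n z) has_field_derivative cis (2 * pi * \<theta> n) * deriv (G n) 0) (at 0)"
    by (intro DERIV_cmult dG)
  ultimately have "deriv (F n) 0 * deriv (G n) 0 = cis (2 * pi * \<theta> n) * deriv (G n) 0" using DERIV_unique by blast
  then show ?thesis using deriv_G_0[of n] by simp
qed

lemma limit_map_holomorphic: "limit_map holomorphic_on ball 0 2"
  and limit_map_deriv: "deriv limit_map 0 = cis (2 * pi * rotation_number)"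
proof -
  have "\<exists>g'. \<forall>x\<in>ball 0 2. (limit_map has_field_derivative g' x) (at x) \<and> (\<lambda>n. deriv (F n) x) \<longlonglongrightarrow> g' x"
  proof (rule has_complex_derivative_uniform_sequence)
    show "(F n has_field_derivative deriv (F n) x) (at x)" if "x \<in> ball 0 2" for n x
      by (rule holomorphic_derivI[OF F_hol open_ball that])
    fix x :: complex assume "x \<in> ball 0 2"
    then obtain d where "d > 0" "cball x d \<subseteq> ball 0 2" by (metis open_ball open_contains_cball)
    then show "\<exists>d>0. cball x d \<subseteq> ball 0 2 \<and> uniform_limit (cball x d) F limit_map sequentially"
      using uniform_limit_F uniform_limit_on_subset by blast
  qed auto
  then obtain g' where g': "\<And>x. x \<in> ball 0 2 \<Longrightarrow> (limit_map has_field_derivative g' x) (at x)"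
    "\<And>x. x \<in> ball 0 2 \<Longrightarrow> (\<lambda>n. deriv (F n) x) \<longlonglongrightarrow> g' x" by blast
  show "limit_map holomorphic_on ball 0 2" unfolding holomorphic_on_open[OF open_ball] using g'(1) by blast
  have "(\<lambda>n. cis (2 * pi * \<theta> n)) \<longlonglongrightarrow> cis (2 * pi * rotation_number)"
    by (intro tendsto_intros theta_tendsto)
  then have "g' 0 = cis (2 * pi * rotation_number)"
    using g'(2)[of 0] unfolding F_deriv by (metis LIMSEQ_unique centre_in_ball zero_less_numeral)
  then show "deriv limit_map 0 = cis (2 * pi * rotation_number)"
    using DERIV_imp_deriv[OF g'(1)[of 0]] by simp
qed

lemma limit_map_0: "limit_map 0 = 0"
  using F_tendsto[of 0] F_0 by (simp add: LIMSEQ_const_iff)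

lemma H_image_sub: "w \<in> cball 0 1 \<Longrightarrow> H n w \<in> ball 0 2"
proof -
  assume "w \<in> cball 0 1"
  then have "H n w \<in> H n ` cball 0 1" by blast
  then have "H n w \<in> cball 0 1" using disc_antimono[of 0 n] first_disc by blast
  then show ?thesis by simp
qed

text \<open>Both sides are lifts through \<open>G n\<close> of the rotation, and they agree at \<open>0\<close>.\<close>

lemma F_H:
  assumes w: "w \<in> ball 0 1"
  shows "F n (H n w) = H n (cis (2 * pi * \<theta> n) * w)"
proof -
  define c where "c = cis (2 * pi * \<theta> n)"
  have nc: "norm c = 1" by (simp add: c_def)
  have rot: "c * w \<in> ball 0 1" if "w \<in> ball 0 1" for w using that nc by (simp add: norm_mult)
  have b1: "ball 0 1 \<subseteq> ball (0::complex) (s n)" using cball_sub ball_subset_cball by blast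
  have H1: "H n holomorphic_on ball 0 1" using H_hol b1 by (rule holomorphic_on_subset)
  have h1: "(\<lambda>w. F n (H n w)) holomorphic_on ball 0 1"
  proof -
    have "F n \<circ> H n holomorphic_on ball 0 1"
      by (rule holomorphic_on_compose_gen[OF H1 F_hol]) (use H_image_sub in auto)
    then show ?thesis by (simp add: o_def)
  qed
  have h2: "(\<lambda>w. H n (c * w)) holomorphic_on ball 0 1"
  proof -
    have "H n \<circ> (\<lambda>w. c * w) holomorphic_on ball 0 1"
      by (rule holomorphic_on_compose_gen[OF _ H1]) (use rot in \<open>auto intro: holomorphic_intros\<close>)
    then show ?thesis by (simp add: o_def)
  qed
  \<comment> \<open>\<open>G n\<close> is injective near 0, which identifies the two lifts there;
    analytic continuation extends the equality to the whole disc.\<close>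
  obtain r where r: "r > 0" "inj_on (G n) (ball 0 r)"
    using has_complex_derivative_locally_injective[OF G_hol _ open_UNIV deriv_G_0, of n] by auto
  define N where "N = ball 0 1 \<inter> (\<lambda>w. F n (H n w)) -` ball 0 r \<inter> (ball 0 1 \<inter> (\<lambda>w. H n (c * w)) -` ball 0 r)"
  have oN: "open N" unfolding N_def
    by (rule open_Int; rule continuous_open_preimage[OF holomorphic_on_imp_continuous_on])
      (fact h1 h2 open_ball)+
  have "0 \<in> N" using r(1) F_0 H_0 by (simp add: N_def)
  have eq: "F n (H n v) = H n (c * v)" if v: "v \<in> N" for v
  proof (rule inj_onD[OF r(2)])
    have v1: "v \<in> ball 0 1" using v by (simp add: N_def)
    have "G n (F n (H n v)) = c * G n (H n v)"
      unfolding c_def using H_image_sub[of v n] v1 by (intro G_F) auto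
    also have "\<dots> = c * v" using G_H[of v n] v1 b1 by auto
    also have "\<dots> = G n (H n (c * v))" using G_H[of "c * v" n] rot[OF v1] b1 by auto
    finally show "G n (F n (H n v)) = G n (H n (c * v))" .
  qed (use v in \<open>auto simp: N_def\<close>)
  have "N \<noteq> {}" "N \<subseteq> ball 0 1" using \<open>0 \<in> N\<close> unfolding N_def by blast+
  then show ?thesis
    unfolding c_def[symmetric]
    by (rule analytic_continuation_open[OF oN open_ball _ connected_ball _ h1 h2 eq w])
qed

lemma core_sub: "core \<subseteq> ball 0 2" and filled_sub2: "filled \<subseteq> ball 0 2"
proof -
  have "cball 0 1 \<subseteq> ball (0::complex) 2" by auto
  then show "core \<subseteq> ball 0 2" "filled \<subseteq> ball 0 2" using filled_sub core_sub_filled by blast+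
qed

text \<open>For large \<open>m\<close> the map \<open>F m\<close> rotates the m-th inner disc, which
  contains the given point, so the limit lies in the closure of the core. The open mapping theorem
  brings it back into the core, which is the interior of its closure.\<close>

lemma limit_map_core: "limit_map ` core \<subseteq> core"
proof -
  have "limit_map z \<in> closure core" if z: "z \<in> core" for z
  proof -
    obtain n where n: "z \<in> H n ` ball 0 (\<rho> n)" using z unfolding core_def by blast
    have "F m z \<in> core" if mn: "m \<ge> n" for m
    proof -
      obtain w where w: "z = H m w" "w \<in> ball 0 (\<rho> m)" using n core_mono[OF mn] by blast
      have "F m z = H m (cis (2 * pi * \<theta> m) * w)" unfolding w(1) using w(2) rho(2)[of m] by (intro F_H) auto
      moreover have "cis (2 * pi * \<theta> m) * w \<in> ball 0 (\<rho> m)" using w(2) by (simp add: norm_mult)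
      ultimately show ?thesis unfolding core_def by blast
    qed
    then have ev: "\<forall>\<^sub>F m in sequentially. F m z \<in> closure core"
      unfolding eventually_sequentially using closure_subset by blast
    have "z \<in> ball 0 2" using z core_sub by blast
    then show ?thesis by (intro Lim_in_closed_set[OF closed_closure ev _ F_tendsto]) auto
  qed
  then have "limit_map ` core \<subseteq> filled" unfolding closure_core by blast
  moreover have "open (limit_map ` core)"
  proof (rule open_mapping_thm[OF limit_map_holomorphic open_ball connected_ball core_open core_sub])
    show "\<not> limit_map constant_on ball 0 2"
    proof
      assume "limit_map constant_on ball 0 2"
      then obtain c where c: "\<And>z. z \<in> ball 0 2 \<Longrightarrow> limit_map z = c" by (auto simp: constant_on_def)
      have "(limit_map has_field_derivative 0) (at 0)"
        by (rule has_field_derivative_transform_within_open[OF DERIV_const[of c] open_ball[of 0 2]]) (use c in auto)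
      then show False using limit_map_deriv by (simp add: DERIV_imp_deriv)
    qed
  qed
  ultimately show ?thesis using interior_filled interior_maximal by blast
qed

lemma core_proper: "core \<noteq> UNIV"
proof
  assume "core = UNIV"
  then have "(3::complex) \<in> ball 0 2" using core_sub by blast
  then show False by simp
qed

end

section \<open>The core as the largest rotation domain\<close>

lemma irrational_rotation_dense:
  assumes "\<theta> \<notin> \<rat>" "e > 0"
  shows "\<exists>k::nat. norm (cis (2 * pi * (real k * \<theta>)) - cis (2 * pi * x)) < e"
proof -
  define \<alpha> where "\<alpha> = frac x"
  have \<alpha>: "0 \<le> \<alpha>" "\<alpha> \<le> 1" unfolding \<alpha>_def using frac_lt_1[of x] by auto
  have "e / (2 * pi) > 0" using assms(2) by simp
  from Kronecker_approx_1_explicit[OF assms(1) \<alpha> this]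
  obtain k :: nat where k: "\<bar>frac (real k * \<theta>) - \<alpha>\<bar> < e / (2 * pi)" by metis
  have fr: "cis (2 * pi * y) = cis (2 * pi * frac y)" for y
    unfolding cis_2pi_eq_iff by (intro exI[of _ "\<lfloor>y\<rfloor>"]) (simp add: frac_def)
  have "norm (cis (2 * pi * (real k * \<theta>)) - cis (2 * pi * x)) = norm (cis (2 * pi * frac (real k * \<theta>)) - cis (2 * pi * \<alpha>))"
    using fr[of "real k * \<theta>"] fr[of x] by (simp only: \<alpha>_def)
  also have "\<dots> \<le> \<bar>2 * pi * frac (real k * \<theta>) - 2 * pi * \<alpha>\<bar>" by (rule norm_cis_diff_le)
  also have "\<dots> = 2 * pi * \<bar>frac (real k * \<theta>) - \<alpha>\<bar>" by (simp add: abs_mult flip: right_diff_distrib)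
  also have "\<dots> < 2 * pi * (e / (2 * pi))" using k by (intro mult_strict_left_mono) auto
  finally show ?thesis by (intro exI[of _ k]) simp
qed

text \<open>Two closed half circles cover the circle, and each of them omits some of its points;
  injectivity transports this to the curve.\<close>

lemma Jordan_image_decomposable:
  assumes r: "r > 0" and \<psi>: "continuous_on (sphere 0 r) \<psi>" "inj_on \<psi> (sphere 0 r)"
  shows "continuum (\<psi> ` sphere (0::complex) r) \<and> \<not> indecomposable_continuum (\<psi> ` sphere 0 r)"
proof -
  define arc where "arc a = (\<lambda>t. of_real r * cis (2 * pi * t)) ` {a..a + 1/2}" for a :: real
  have n: "norm (of_real r * cis (2 * pi * t)) = r" for t using r by (simp add: norm_mult)
  have sub: "arc a \<subseteq> sphere 0 r" for a using n by (auto simp: arc_def)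
  have mem: "of_real r * cis (2 * pi * t) \<in> arc a" if "t \<in> {a..a + 1/2}" for a t
    unfolding arc_def using that by (rule imageI)
  have arc_cont: "continuous_on T (\<lambda>t. of_real r * cis (2 * pi * t))" for T by (intro continuous_intros)
  have arc_conn: "connected (arc a)" and arc_comp: "compact (arc a)" for a
    unfolding arc_def
    by (rule connected_continuous_image[OF arc_cont connected_Icc], rule compact_continuous_image[OF arc_cont compact_Icc])
  have cont: "continuum (\<psi> ` arc a)" for a
    unfolding continuum_def
  proof (intro conjI)
    have \<psi>a: "continuous_on (arc a) \<psi>" using continuous_on_subset[OF \<psi>(1) sub] .
    show "compact (\<psi> ` arc a)" by (rule compact_continuous_image[OF \<psi>a arc_comp])
    show "connected (\<psi> ` arc a)" by (rule connected_continuous_image[OF \<psi>a arc_conn])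
    show "\<psi> ` arc a \<noteq> {}" by (simp add: arc_def)
  qed
  have un: "sphere 0 r = arc 0 \<union> arc (1/2)"
  proof
    show "sphere 0 r \<subseteq> arc 0 \<union> arc (1/2)"
    proof
      fix w :: complex assume "w \<in> sphere 0 r"
      moreover obtain x where "w = of_real (norm w) * cis (2 * pi * x)" "0 < x" "x \<le> 1" using polar_2pi .
      ultimately have x: "w = of_real r * cis (2 * pi * x)" "0 < x" "x \<le> 1" by auto
      show "w \<in> arc 0 \<union> arc (1/2)"
      proof (cases "x \<le> 1/2")
        case True
        then have "w \<in> arc 0" unfolding x(1) by (intro mem) (use x in simp)
        then show ?thesis by blast
      next
        case False
        then have "w \<in> arc (1/2)" unfolding x(1) by (intro mem) (use x in simp)
        then show ?thesis by blast
      qed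
    qed
  qed (use sub in blast)
  have proper: "arc a \<subset> sphere 0 r" for a
  proof -
    have "of_real r * cis (2 * pi * (a + 3/4)) \<notin> arc a"
    proof
      assume "of_real r * cis (2 * pi * (a + 3/4)) \<in> arc a"
      then obtain t where t: "t \<in> {a..a + 1/2}" "of_real r * cis (2 * pi * (a + 3/4)) = of_real r * cis (2 * pi * t)"
        unfolding arc_def by blast
      then have "cis (2 * pi * (a + 3/4)) = cis (2 * pi * t)" using r mult_left_cancel[of "of_real r :: complex"] by force
      then obtain k :: int where "a + 3/4 = t + of_int k" unfolding cis_2pi_eq_iff by blast
      then have "0 < real_of_int k" "real_of_int k < 1" using t(1) unfolding atLeastAtMost_iff by linarith+
      then show False by simp
    qed
    moreover have "of_real r * cis (2 * pi * (a + 3/4)) \<in> sphere 0 r" using n by simp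
    ultimately show ?thesis using sub by blast
  qed
  have psub: "\<psi> ` arc a \<subset> \<psi> ` sphere 0 r" for a
    using proper[of a] inj_on_image_eq_iff[OF \<psi>(2) sub order_refl, of a] image_mono[OF sub, of \<psi> a]
    unfolding psubset_eq by simp
  have "continuum (\<psi> ` sphere 0 r)"
  proof -
    have "arc 0 \<inter> arc (1/2) \<noteq> {}" using mem[of "1/2" 0] mem[of "1/2" "1/2"] by auto
    then have "connected (arc 0 \<union> arc (1/2))" by (intro connected_Un arc_conn)
    then have "connected (sphere (0::complex) r)" unfolding un .
    then have "connected (\<psi> ` sphere 0 r)" by (rule connected_continuous_image[OF \<psi>(1)])
    moreover have "compact (\<psi> ` sphere 0 r)" by (rule compact_continuous_image[OF \<psi>(1) compact_sphere])
    ultimately show ?thesis unfolding continuum_def using r by simp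
  qed
  moreover have "\<psi> ` sphere 0 r = \<psi> ` arc 0 \<union> \<psi> ` arc (1/2)" unfolding un by (rule image_Un)
  then have "\<exists>A B. continuum A \<and> continuum B \<and> A \<subset> \<psi> ` sphere 0 r \<and> B \<subset> \<psi> ` sphere 0 r \<and> \<psi> ` sphere 0 r = A \<union> B"
    by (intro exI[of _ "\<psi> ` arc 0"] exI[of _ "\<psi> ` arc (1/2)"] conjI cont psub)
  ultimately show ?thesis unfolding indecomposable_continuum_def by simp
qed

context siegel_tower
begin

text \<open>A Riemann map of the core bundled with its inverse and with the fact that it linearizes
  the limit map, since both the rotation domain and the invariance of the rim rely on it.\<close>

definition core_chart :: "(complex \<Rightarrow> complex) \<Rightarrow> (complex \<Rightarrow> complex) \<Rightarrow> bool" where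
  "core_chart \<kappa> h \<longleftrightarrow> \<kappa> holomorphic_on core \<and> h holomorphic_on ball 0 1 \<and> \<kappa> 0 = 0 \<and>
    (\<forall>z\<in>core. \<kappa> z \<in> ball 0 1 \<and> h (\<kappa> z) = z) \<and> (\<forall>u\<in>ball 0 1. h u \<in> core \<and> \<kappa> (h u) = u) \<and>
    (\<forall>z\<in>core. \<kappa> (limit_map z) = cis (2 * pi * rotation_number) * \<kappa> z)"

lemma core_chart_exists: "\<exists>\<kappa> h. core_chart \<kappa> h"
proof -
  obtain \<kappa> h where \<kappa>: "\<kappa> holomorphic_on core" and h: "h holomorphic_on ball 0 1" and zero: "\<kappa> 0 = 0" "h 0 = 0"
    and inv: "\<And>z. z \<in> core \<Longrightarrow> \<kappa> z \<in> ball 0 1 \<and> h (\<kappa> z) = z" "\<And>u. u \<in> ball 0 1 \<Longrightarrow> h u \<in> core \<and> \<kappa> (h u) = u"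
    using normalized_Riemann_map[OF core_open core_simply_connected zero_in_core core_proper] by metis
  have rot: "\<kappa> (limit_map z) = deriv limit_map 0 * \<kappa> z" if "z \<in> core" for z
  proof (rule Schwarz_conjugate_rotation[OF core_open zero_in_core \<kappa> h zero inv])
    show "limit_map holomorphic_on core" using limit_map_holomorphic core_sub holomorphic_on_subset by blast
    show "limit_map z \<in> core" if "z \<in> core" for z using limit_map_core that by blast
  qed (use limit_map_0 limit_map_deriv that in auto)
  have "core_chart \<kappa> h"
    unfolding core_chart_def using \<kappa> h zero(1) inv rot[unfolded limit_map_deriv] by (intro conjI ballI) auto
  then show ?thesis by blast
qed

lemma core_rotation_domain: "rotation_domain limit_map (ball 0 2) core"
proof -
  obtain \<kappa> h where "core_chart \<kappa> h" using core_chart_exists by blast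
  then have kh: "\<kappa> holomorphic_on core" "\<kappa> 0 = 0"
    "\<And>z. z \<in> core \<Longrightarrow> \<kappa> z \<in> ball 0 1 \<and> h (\<kappa> z) = z" "\<And>u. u \<in> ball 0 1 \<Longrightarrow> h u \<in> core \<and> \<kappa> (h u) = u"
    "\<And>z. z \<in> core \<Longrightarrow> \<kappa> (limit_map z) = cis (2 * pi * rotation_number) * \<kappa> z"
    unfolding core_chart_def by simp_all
  have "bij_betw \<kappa> core (ball 0 1)"
    by (rule bij_betw_byWitness[of _ h]) (use kh in auto)
  then have "conformal_bijection \<kappa> core (ball 0 1)" using kh(1) by (simp add: conformal_bijection_def)
  moreover have "\<forall>z\<in>core. limit_map z \<in> core \<and> \<kappa> (limit_map z) = cis (2 * pi * rotation_number) * \<kappa> z"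
    using kh(5) limit_map_core by blast
  ultimately show ?thesis
    unfolding rotation_domain_def
    using core_open core_connected zero_in_core core_sub rotation_number_irrational limit_map_deriv kh(2)
    by (intro conjI exI[of _ rotation_number] exI[of _ \<kappa>] exI[of _ "ball 0 1"]) (auto intro: exI[of _ "1::real"])
qed

text \<open>A rotation of the disc is proper. If a rim point \<open>x\<close> were sent into the
  core, then for core points tending to \<open>x\<close> the coordinates would converge inside the
  unit disc, so the points themselves would converge to a point of the core.\<close>

lemma limit_map_rim: "limit_map ` rim \<subseteq> rim"
proof
  fix y assume "y \<in> limit_map ` rim"
  then obtain x where x: "x \<in> rim" "y = limit_map x" by blast
  obtain \<kappa> h where "core_chart \<kappa> h" using core_chart_exists by blast
  then have \<kappa>: "\<kappa> holomorphic_on core" and h: "h holomorphic_on ball 0 1"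
    and inv: "\<And>z. z \<in> core \<Longrightarrow> \<kappa> z \<in> ball 0 1 \<and> h (\<kappa> z) = z" "\<And>u. u \<in> ball 0 1 \<Longrightarrow> h u \<in> core \<and> \<kappa> (h u) = u"
    and rot: "\<And>z. z \<in> core \<Longrightarrow> \<kappa> (limit_map z) = cis (2 * pi * rotation_number) * \<kappa> z"
    unfolding core_chart_def by simp_all
  have xf: "x \<in> filled" "x \<notin> core" using x(1) by (auto simp: rim_def)
  have lc: "continuous_on filled limit_map"
    using limit_map_holomorphic filled_sub2 holomorphic_on_imp_continuous_on continuous_on_subset by blast
  have "limit_map ` closure core \<subseteq> filled"
    by (rule image_closure_subset) (use lc limit_map_core core_sub_filled filled_compact in \<open>auto simp: closure_core compact_imp_closed\<close>)
  then have yf: "y \<in> filled" using x xf by (auto simp: closure_core)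
  have "y \<notin> core"
  proof
    assume y: "y \<in> core"
    obtain X where X: "\<And>n. X n \<in> core" "X \<longlonglongrightarrow> x"
      using xf(1) unfolding closure_core[symmetric] closure_sequential by blast
    have "X n \<in> filled" for n using X(1) core_sub_filled by blast
    then have "(\<lambda>n. limit_map (X n)) \<longlonglongrightarrow> limit_map x"
      by (intro continuous_on_tendsto_compose[OF lc X(2) xf(1)]) simp
    moreover have "limit_map (X n) \<in> core" for n using X(1) limit_map_core by blast
    ultimately have "(\<lambda>n. \<kappa> (limit_map (X n))) \<longlonglongrightarrow> \<kappa> y"
      unfolding x(2)[symmetric] using y x(2)
      by (intro continuous_on_tendsto_compose[OF holomorphic_on_imp_continuous_on[OF \<kappa>]]) auto
    then have "(\<lambda>n. cis (2 * pi * rotation_number) * \<kappa> (X n)) \<longlonglongrightarrow> \<kappa> y" using rot X(1) by simp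
    then have "(\<lambda>n. cis (- (2 * pi * rotation_number)) * (cis (2 * pi * rotation_number) * \<kappa> (X n)))
       \<longlonglongrightarrow> cis (- (2 * pi * rotation_number)) * \<kappa> y" by (intro tendsto_intros)
    then have lim: "(\<lambda>n. \<kappa> (X n)) \<longlonglongrightarrow> cis (- (2 * pi * rotation_number)) * \<kappa> y"
      by (simp add: mult.assoc[symmetric] cis_mult)
    define u where "u = cis (- (2 * pi * rotation_number)) * \<kappa> y"
    have u: "u \<in> ball 0 1" using inv(1)[OF y] by (simp add: u_def norm_mult)
    have "(\<lambda>n. h (\<kappa> (X n))) \<longlonglongrightarrow> h u"
      by (rule continuous_on_tendsto_compose[OF holomorphic_on_imp_continuous_on[OF h] lim[folded u_def] u])
        (use inv(1) X(1) in auto)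
    then have "X \<longlonglongrightarrow> h u" using inv(1) X(1) by simp
    then have "x = h u" using X(2) LIMSEQ_unique by blast
    then show False using inv(2)[OF u] xf(2) by simp
  qed
  then show "y \<in> rim" using yf by (simp add: rim_def)
qed

text \<open>A larger rotation domain would contain an invariant Jordan curve inside the rim.\<close>

lemma rotation_domain_sub_core:
  assumes D: "rotation_domain limit_map U D"
  shows "D \<subseteq> core"
proof (rule ccontr)
  assume "\<not> D \<subseteq> core"
  have D1: "open D" "connected D" "0 \<in> D" using D by (auto simp: rotation_domain_def)
  obtain \<theta>' \<phi> V where \<theta>': "\<theta>' \<notin> \<rat>" and V: "V = UNIV \<or> (\<exists>r>0. V = ball 0 r)"
    and \<phi>: "conformal_bijection \<phi> D V" "\<phi> 0 = 0"
    and rot: "\<And>z. z \<in> D \<Longrightarrow> limit_map z \<in> D \<and> \<phi> (limit_map z) = cis (2 * pi * \<theta>') * \<phi> z"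
    using D unfolding rotation_domain_def by blast
  have \<phi>h: "\<phi> holomorphic_on D" and bij: "bij_betw \<phi> D V" using \<phi>(1) by (auto simp: conformal_bijection_def)
  have inj: "inj_on \<phi> D" and im: "\<phi> ` D = V" using bij by (auto simp: bij_betw_def)
  have "D \<inter> frontier core \<noteq> {}"
    using D1(2,3) zero_in_core \<open>\<not> D \<subseteq> core\<close> by (intro connected_Int_frontier) auto
  then obtain x where x: "x \<in> D" "x \<in> rim" by (auto simp: frontier_core)
  have x0: "x \<noteq> 0" using x(2) zero_in_core by (auto simp: rim_def)
  then have px0: "\<phi> x \<noteq> 0" using inj_onD[OF inj _ x(1) D1(3)] \<phi>(2) by auto
  define r where "r = norm (\<phi> x)"
  have r: "r > 0" using px0 by (simp add: r_def)
  obtain \<psi> where \<psi>: "\<psi> holomorphic_on V" "\<And>z. z \<in> D \<Longrightarrow> \<psi> (\<phi> z) = z"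
    using holomorphic_has_inverse[OF \<phi>h D1(1) inj] im by metis
  have "\<phi> x \<in> V" using im x by blast
  then have sV: "sphere 0 r \<subseteq> V" using V by (auto simp: r_def)
  have \<psi>c: "continuous_on (sphere 0 r) \<psi>"
    using \<psi>(1) sV holomorphic_on_imp_continuous_on continuous_on_subset by blast
  have \<psi>i: "inj_on \<psi> V"
    unfolding im[symmetric] by (rule inj_onI) (use \<psi>(2) in auto)
  have orbit: "(limit_map ^^ k) x \<in> D \<inter> rim \<and> \<phi> ((limit_map ^^ k) x) = cis (2 * pi * (real k * \<theta>')) * \<phi> x" for k
  proof (induction k)
    case 0
    then show ?case using x by simp
  next
    case (Suc k)
    have "cis (2 * pi * \<theta>') * cis (2 * pi * (real k * \<theta>')) = cis (2 * pi * (real (Suc k) * \<theta>'))"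
      by (simp add: cis_mult algebra_simps)
    then show ?case using Suc rot[of "(limit_map ^^ k) x"] limit_map_rim by (auto simp: mult.assoc[symmetric])
  qed
  \<comment> \<open>The orbit of \<open>x\<close> stays in the rim and is dense on the circle of
    radius \<open>r\<close> in the coordinate \<open>\<phi>\<close>. The rim is closed, so it
    contains the whole preimage of that circle.\<close>
  have "\<psi> w \<in> rim" if w: "w \<in> sphere 0 r" for w
  proof -
    have "norm w = norm (\<phi> x)" using w by (simp add: r_def)
    then have "norm (w / \<phi> x) = 1" using px0 by (simp add: norm_divide)
    then obtain y where y: "w / \<phi> x = cis (2 * pi * y)" using unit_polar_2pi by blast
    have "\<exists>k. norm (cis (2 * pi * (real k * \<theta>')) - cis (2 * pi * y)) < 1 / real (Suc n)" for n
      by (rule irrational_rotation_dense[OF \<theta>']) simp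
    then obtain k where k: "\<And>n. norm (cis (2 * pi * (real (k n) * \<theta>')) - cis (2 * pi * y)) < 1 / real (Suc n)" by metis
    have "(\<lambda>n. cis (2 * pi * (real (k n) * \<theta>')) - cis (2 * pi * y)) \<longlonglongrightarrow> 0"
      by (rule LIMSEQ_norm_0) (use k in simp)
    then have "(\<lambda>n. cis (2 * pi * (real (k n) * \<theta>'))) \<longlonglongrightarrow> w / \<phi> x" unfolding y by (simp add: LIM_zero_iff)
    then have "(\<lambda>n. cis (2 * pi * (real (k n) * \<theta>')) * \<phi> x) \<longlonglongrightarrow> w / \<phi> x * \<phi> x" by (intro tendsto_intros)
    then have lim: "(\<lambda>n. \<phi> ((limit_map ^^ k n) x)) \<longlonglongrightarrow> w" using orbit px0 by simp
    have mem: "\<phi> ((limit_map ^^ k n) x) \<in> V" for n using orbit im by blast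
    have "(\<lambda>n. \<psi> (\<phi> ((limit_map ^^ k n) x))) \<longlonglongrightarrow> \<psi> w"
      by (rule continuous_on_tendsto_compose[OF holomorphic_on_imp_continuous_on[OF \<psi>(1)] lim])
        (use w sV mem in auto)
    moreover have "\<psi> (\<phi> ((limit_map ^^ k n) x)) = (limit_map ^^ k n) x" for n using \<psi>(2) orbit by blast
    ultimately have "(\<lambda>n. (limit_map ^^ k n) x) \<longlonglongrightarrow> \<psi> w" by simp
    moreover have "(limit_map ^^ k n) x \<in> rim" for n using orbit by blast
    ultimately show ?thesis using closed_sequentially[OF compact_imp_closed[OF rim_compact]] by metis
  qed
  then have "\<psi> ` sphere 0 r \<subseteq> rim" by blast
  then show False
    using Jordan_image_decomposable[OF r \<psi>c inj_on_subset[OF \<psi>i sV]] rim_hereditarily_indecomposable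
    unfolding hereditarily_indecomposable_def by blast
qed

theorem siegel_disk_core: "siegel_disk limit_map (ball 0 2) core"
  unfolding siegel_disk_def using core_rotation_domain rotation_domain_sub_core by blast

end

section \<open>Construction of the tower\<close>

definition thin_annulus :: "(complex \<Rightarrow> complex) \<Rightarrow> real \<Rightarrow> real \<Rightarrow> bool" where
  "thin_annulus H \<rho> \<epsilon> \<longleftrightarrow> (\<exists>\<tau>>0. \<forall>r r' x x'. r \<in> {\<rho>..1} \<longrightarrow> r' \<in> {\<rho>..1} \<longrightarrow> \<bar>x - x'\<bar> \<le> \<tau> \<longrightarrow>
      dist (H (of_real r * cis (2 * pi * x))) (H (of_real r' * cis (2 * pi * x'))) < \<epsilon>)"

lemma thin_annulus_exists:
  assumes H: "H holomorphic_on ball 0 s" "s > 1" and \<epsilon>: "\<epsilon> > 0" and \<rho>0: "\<rho>0 < 1"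
  obtains \<rho> where "\<rho>0 < \<rho>" "0 < \<rho>" "\<rho> < 1" "thin_annulus H \<rho> \<epsilon>"
proof -
  have "continuous_on (cball 0 1) H"
    using H by (intro holomorphic_on_imp_continuous_on holomorphic_on_subset[OF H(1)]) auto
  then have "uniformly_continuous_on (cball 0 1) H" by (intro compact_uniformly_continuous) auto
  then obtain \<delta> where \<delta>: "\<delta> > 0" "\<And>w w'. \<lbrakk>w \<in> cball 0 1; w' \<in> cball 0 1; dist w' w < \<delta>\<rbrakk> \<Longrightarrow> dist (H w') (H w) < \<epsilon>"
    using \<epsilon> unfolding uniformly_continuous_on_def by metis
  \<comment> \<open>The radial displacement and the rotation may each use up
    \<open>\<delta> / 4\<close>; \<open>\<tau>\<close> below is that arc length in turns.\<close>
  define \<rho> where "\<rho> = max (max ((1 + \<rho>0) / 2) (1/2)) (1 - \<delta> / 4)"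
  have \<rho>: "\<rho> < 1" "(1 + \<rho>0) / 2 \<le> \<rho>" "1/2 \<le> \<rho>" "1 - \<delta> / 4 \<le> \<rho>" using \<delta>(1) \<rho>0 by (auto simp: \<rho>_def max_def)
  define \<tau> where "\<tau> = \<delta> / (8 * pi)"
  have \<tau>: "\<tau> > 0" "2 * pi * \<tau> = \<delta> / 4" using \<delta>(1) by (auto simp: \<tau>_def)
  have "dist (H (of_real r * cis (2 * pi * x))) (H (of_real r' * cis (2 * pi * x'))) < \<epsilon>"
    if r: "r \<in> {\<rho>..1}" "r' \<in> {\<rho>..1}" and x: "\<bar>x - x'\<bar> \<le> \<tau>" for r r' x x'
  proof (rule \<delta>(2))
    show "of_real r * cis (2 * pi * x) \<in> cball 0 1" "of_real r' * cis (2 * pi * x') \<in> cball 0 1"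
      using r \<rho>(3) by (auto simp: norm_mult)
    have "norm (cis (2 * pi * x) - cis (2 * pi * x')) \<le> \<bar>2 * pi * x - 2 * pi * x'\<bar>" by (rule norm_cis_diff_le)
    also have "\<dots> = 2 * pi * \<bar>x - x'\<bar>" by (simp add: abs_mult flip: right_diff_distrib)
    also have "\<dots> \<le> 2 * pi * \<tau>" using x by (intro mult_left_mono) auto
    finally have c: "norm (cis (2 * pi * x) - cis (2 * pi * x')) \<le> \<delta> / 4" unfolding \<tau>(2) .
    have "of_real r * cis (2 * pi * x) - of_real r' * cis (2 * pi * x')
      = of_real (r - r') * cis (2 * pi * x) + of_real r' * (cis (2 * pi * x) - cis (2 * pi * x'))"
      by (simp add: algebra_simps)
    also have "norm \<dots> \<le> \<bar>r - r'\<bar> + \<bar>r'\<bar> * norm (cis (2 * pi * x) - cis (2 * pi * x'))"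
      by (rule order_trans[OF norm_triangle_ineq]) (simp add: norm_mult del: of_real_diff)
    also have "\<bar>r - r'\<bar> \<le> \<delta> / 4"
      using r \<rho>(4) unfolding atLeastAtMost_iff by linarith
    also have "\<bar>r'\<bar> * norm (cis (2 * pi * x) - cis (2 * pi * x')) \<le> 1 * (\<delta> / 4)"
      using r \<rho>(3) c by (intro mult_mono) auto
    also have "\<delta> / 4 + 1 * (\<delta> / 4) < \<delta>" using \<delta>(1) by simp
    finally show "dist (of_real r * cis (2 * pi * x)) (of_real r' * cis (2 * pi * x')) < \<delta>" by (simp add: dist_norm)
  qed
  then have "thin_annulus H \<rho> \<epsilon>" unfolding thin_annulus_def using \<tau>(1) by blast
  moreover have "\<rho>0 < \<rho>" "0 < \<rho>" using \<rho> \<rho>0 by (auto simp: field_simps)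
  ultimately show thesis using that \<rho>(1) by blast
qed

section \<open>Stages of the inductive construction\<close>

lemma rational_rotation_power:
  assumes "\<theta> \<in> \<rat>"
  obtains q j :: nat where "q > 0" "cis (2 * pi * \<theta>) = cis (2 * pi / real q) ^ j"
proof -
  obtain p q :: int where pq: "q > 0" "\<theta> = of_int p / of_int q" using assms by (auto elim: Rats_cases')
  define j where "j = nat (p mod q)"
  have j: "real j = of_int (p mod q)" using pq(1) by (simp add: j_def)
  have "of_int p = of_int (p div q) * of_int q + (of_int (p mod q) :: real)"
    by (metis div_mult_mod_eq of_int_add of_int_mult)
  then have "\<theta> = of_int (p mod q) / of_int q + of_int (p div q)"
    using pq by (simp add: field_simps)
  then have "cis (2 * pi * \<theta>) = cis (2 * pi * (of_int (p mod q) / of_int q))"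
    unfolding cis_2pi_eq_iff by blast
  also have "2 * pi * (of_int (p mod q) / of_int q) = real j * (2 * pi / real (nat q))" using pq(1) by (simp add: j)
  also have "cis \<dots> = cis (2 * pi / real (nat q)) ^ j" by (rule Complex.DeMoivre[symmetric])
  finally show thesis using that[of "nat q" j] pq(1) by simp
qed

text \<open>The radius \<open>2 + 1 / Suc n\<close> decreases because every perturbation of the lift
  costs some room, and it stays above 2. Zeros of \<open>G\<close> other than 0 are excluded so that
  the next lift must fix 0. \<open>\<theta>\<close> stays rational to leave a symmetry of finite
  order for the next step.\<close>

definition stage :: "nat \<Rightarrow> (complex \<Rightarrow> complex) \<times> (complex \<Rightarrow> complex) \<times> real \<times> real \<times> (complex \<Rightarrow> complex) \<times> real \<times> real \<Rightarrow> bool" where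
  "stage n = (\<lambda>(G, H, s, \<rho>, F, \<theta>, \<sigma>).
     G holomorphic_on UNIV \<and> (\<forall>z. deriv G z \<noteq> 0) \<and> (\<forall>z. G z = 0 \<longleftrightarrow> z = 0) \<and>
     H holomorphic_on ball 0 s \<and> s > 1 \<and> (\<forall>w\<in>ball 0 s. G (H w) = w) \<and> H 0 = 0 \<and>
     0 < \<rho> \<and> \<rho> < 1 \<and> thin_annulus H \<rho> (1 / real (Suc n)) \<and> (n = 0 \<longrightarrow> H ` cball 0 1 \<subseteq> cball 0 1) \<and>
     F holomorphic_on ball 0 (2 + 1 / real (Suc n)) \<and> F 0 = 0 \<and>
     (\<forall>z\<in>ball 0 (2 + 1 / real (Suc n)). G (F z) = cis (2 * pi * \<theta>) * G z) \<and>
     \<theta> \<in> \<rat> \<and> 0 < \<sigma> \<and> \<sigma> \<le> (1/2) ^ n)"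

definition stage_step :: "nat \<Rightarrow> (complex \<Rightarrow> complex) \<times> (complex \<Rightarrow> complex) \<times> real \<times> real \<times> (complex \<Rightarrow> complex) \<times> real \<times> real
    \<Rightarrow> (complex \<Rightarrow> complex) \<times> (complex \<Rightarrow> complex) \<times> real \<times> real \<times> (complex \<Rightarrow> complex) \<times> real \<times> real \<Rightarrow> bool" where
  "stage_step n = (\<lambda>(G, H, s, \<rho>, F, \<theta>, \<sigma>) (G', H', s', \<rho>', F', \<theta>', \<sigma>').
     H' ` cball 0 1 \<subseteq> H ` ball 0 1 \<and> H ` cball 0 \<rho> \<subseteq> H' ` ball 0 \<rho>' \<and>
     crooked_shadow (1 / real (Suc n)) (H' ` (cball 0 1 - ball 0 \<rho>')) \<and>
     (\<forall>z\<in>ball 0 2. norm (F' z - F z) \<le> (1/2) ^ n) \<and>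
     \<bar>\<theta>' - \<theta>\<bar> + \<sigma>' \<le> \<sigma> \<and> from_nat_into \<rat> n \<notin> {\<theta>' - \<sigma>'..\<theta>' + \<sigma>'})"

lemma first_stage: "\<exists>S. stage 0 S"
proof -
  have id: "(\<lambda>w. w) holomorphic_on ball (0::complex) 2" by (intro holomorphic_intros)
  obtain \<rho> where \<rho>: "0 < \<rho>" "\<rho> < 1" "thin_annulus (\<lambda>w. w) \<rho> 1"
    using thin_annulus_exists[OF id, of 1 0] by auto
  have "stage 0 (\<lambda>z. z, \<lambda>w. w, 2, \<rho>, \<lambda>z. z, 0, 1)"
    unfolding stage_def using \<rho> by (auto intro!: holomorphic_intros)
  then show ?thesis by blast
qed

text \<open>Of two rationals just above \<open>\<theta>\<close> at least one differs from
  \<open>t\<close>. Half of its distance from \<open>t\<close> bounds the new interval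
  radius.\<close>

lemma next_rotation_number:
  fixes \<theta> \<sigma> \<mu> t :: real
  assumes "0 < \<sigma>" "0 < \<mu>" "0 < b"
  obtains \<theta>' \<sigma>' where "\<theta>' \<in> \<rat>" "\<bar>\<theta>' - \<theta>\<bar> < \<mu>" "0 < \<sigma>'" "\<sigma>' \<le> b" "\<bar>\<theta>' - \<theta>\<bar> + \<sigma>' \<le> \<sigma>" "t \<notin> {\<theta>' - \<sigma>'..\<theta>' + \<sigma>'}"
proof -
  define m where "m = min \<mu> (\<sigma> / 2)"
  have m: "m > 0" "m \<le> \<mu>" "m \<le> \<sigma> / 2" using assms by (auto simp: m_def)
  obtain u where u: "u \<in> \<rat>" "\<theta> < u" "u < \<theta> + m" using Rats_dense_in_real[of \<theta> "\<theta> + m"] m by auto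
  obtain v where v: "v \<in> \<rat>" "\<theta> < v" "v < u" using Rats_dense_in_real[of \<theta> u] u by auto
  obtain \<theta>' where \<theta>': "\<theta>' \<in> \<rat>" "\<theta> < \<theta>'" "\<theta>' < \<theta> + m" "\<theta>' \<noteq> t"
    using u v by (cases "u = t") force+
  define \<sigma>' where "\<sigma>' = min b (min (\<sigma> / 2) (\<bar>\<theta>' - t\<bar> / 2))"
  have \<sigma>': "0 < \<sigma>'" "\<sigma>' \<le> b" "\<sigma>' \<le> \<sigma> / 2" "\<sigma>' \<le> \<bar>\<theta>' - t\<bar> / 2" using assms \<theta>'(4) by (auto simp: \<sigma>'_def min_def)
  show thesis
  proof (rule that[OF \<theta>'(1) _ \<sigma>'(1,2)])
    show "t \<notin> {\<theta>' - \<sigma>'..\<theta>' + \<sigma>'}"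
    proof
      assume "t \<in> {\<theta>' - \<sigma>'..\<theta>' + \<sigma>'}"
      then have "\<bar>\<theta>' - t\<bar> \<le> \<sigma>'" by auto
      then have "\<bar>\<theta>' - t\<bar> / 2 \<le> \<sigma>' / 2" by (rule divide_right_mono) simp
      then have "\<sigma>' \<le> \<sigma>' / 2" using \<sigma>'(4) by (rule order_trans[rotated])
      then show False using \<sigma>'(1) by simp
    qed
  qed (use m \<theta>' \<sigma>' in linarith)+
qed

text \<open>\<open>H' = H \<circ> J\<close> reparametrizes part of the old disc by the approximate
  inverse Riemann map of a twisted domain. In the old coordinate the new annulus lies in the collar
  \<open>D - K\<close>, at angles within \<open>\<tau>\<close> of \<open>g x\<close>; as
  \<open>\<tau>\<close> was supplied by the thinness of the old annulus, this becomes closeness in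
  the plane.\<close>

lemma next_annulus:
  assumes G: "G holomorphic_on UNIV"
    and H: "H holomorphic_on ball 0 s" "s > 1" "\<And>w. w \<in> ball 0 s \<Longrightarrow> G (H w) = w" "H 0 = 0"
    and \<rho>: "0 < \<rho>" "\<rho> < 1" and thin: "thin_annulus H \<rho> \<epsilon>" and q: "q > 0" and \<epsilon>': "\<epsilon>' > 0"
  obtains k H' s' \<rho>' where "k holomorphic_on UNIV" "\<And>z. deriv k z \<noteq> 0" "\<And>z. k z = 0 \<longleftrightarrow> z = 0"
    "\<And>z. k (cis (2 * pi / real q) * z) = cis (2 * pi / real q) * k z"
    "s' > 1" "H' holomorphic_on ball 0 s'" "\<And>w. w \<in> ball 0 s' \<Longrightarrow> k (G (H' w)) = w" "H' 0 = 0"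
    "0 < \<rho>'" "\<rho>' < 1" "thin_annulus H' \<rho>' \<epsilon>'"
    "H' ` cball 0 1 \<subseteq> H ` ball 0 1" "H ` cball 0 \<rho> \<subseteq> H' ` ball 0 \<rho>'"
    "crooked_shadow \<epsilon> (H' ` (cball 0 1 - ball 0 \<rho>'))"
proof -
  obtain \<tau> where \<tau>: "\<tau> > 0" "\<And>r r' x x'. \<lbrakk>r \<in> {\<rho>..1}; r' \<in> {\<rho>..1}; \<bar>x - x'\<bar> \<le> \<tau>\<rbrakk> \<Longrightarrow>
      dist (H (of_real r * cis (2 * pi * x))) (H (of_real r' * cis (2 * pi * x'))) < \<epsilon>"
    using thin unfolding thin_annulus_def by blast
  obtain D K and \<xi> :: "complex \<Rightarrow> complex" and g :: "real \<Rightarrow> real"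
    where D: "open D" "simply_connected D" and K: "compact K" "cball 0 \<rho> \<subseteq> K" "K \<subseteq> D" and D1: "D \<subseteq> ball 0 1"
    and sym: "\<And>w. w \<in> D \<Longrightarrow> cis (2 * pi / real q) * w \<in> D"
    and \<xi>: "continuous_on (- {0}) \<xi>" "\<And>w. w \<noteq> 0 \<Longrightarrow> norm (\<xi> w) = 1"
    and g: "continuous_on UNIV g"
    and retrace: "\<And>s t. \<lbrakk>s \<le> t; \<bar>g s - g t\<bar> \<le> 2\<rbrakk> \<Longrightarrow>
       \<exists>c d. s \<le> c \<and> c \<le> d \<and> d \<le> t \<and> \<bar>g c - g t\<bar> \<le> \<tau> \<and> \<bar>g d - g s\<bar> \<le> \<tau>"
    and shadow: "\<And>w x. \<lbrakk>w \<in> D - K; \<xi> w = cis (2 * pi * x)\<rbrakk> \<Longrightarrow>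
       \<exists>X. w = of_real (norm w) * cis (2 * pi * X) \<and> \<bar>X - g x\<bar> \<le> \<tau>"
    by (rule twisted_domain_exists[OF q \<rho> \<tau>(1)]) (rule that)
  have "0 \<in> cball 0 \<rho>" using \<rho> by simp
  then have 0: "0 \<in> K" "0 \<in> D" using K by blast+
  have "(2::complex) \<notin> D" using D1 by (auto simp: subset_iff)
  then have DU: "D \<noteq> UNIV" by blast
  obtain k J s' \<rho>1 where k: "k holomorphic_on UNIV" "\<And>z. deriv k z \<noteq> 0" "\<And>z. k z = 0 \<longleftrightarrow> z = 0"
    "\<And>z. k (cis (2 * pi / real q) * z) = cis (2 * pi / real q) * k z"
    and J: "s' > 1" "J holomorphic_on ball 0 s'" "J ` ball 0 s' \<subseteq> D" "\<And>w. w \<in> ball 0 s' \<Longrightarrow> k (J w) = w" "J 0 = 0"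
    and \<rho>1: "0 < \<rho>1" "\<rho>1 < 1" "K \<subseteq> J ` ball 0 \<rho>1"
    by (rule approximating_immersion[OF D 0(2) DU q sym K(1,3)]) (assumption, rule that)
  have Ds: "D \<subseteq> ball 0 s" using D1 H(2) by (auto simp: subset_iff intro: less_trans)
  define H' where "H' = H \<circ> J"
  have H'_hol: "H' holomorphic_on ball 0 s'"
    unfolding H'_def using J(3) Ds by (intro holomorphic_on_compose_gen[OF J(2) H(1)]) blast
  have GH': "G (H' w) = J w" if "w \<in> ball 0 s'" for w
  proof -
    have "J w \<in> ball 0 s" using J(3) Ds that by blast
    then show ?thesis using H(3) by (simp add: H'_def)
  qed
  \<comment> \<open>Beyond \<open>\<rho>1\<close>, so that the new inner disc covers
    \<open>K\<close> and the new annulus is mapped by \<open>J\<close> into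
    \<open>D - K\<close>.\<close>
  obtain \<rho>' where \<rho>': "\<rho>1 < \<rho>'" "0 < \<rho>'" "\<rho>' < 1" "thin_annulus H' \<rho>' \<epsilon>'"
    using thin_annulus_exists[OF H'_hol J(1) \<epsilon>' \<rho>1(2)] by blast
  have sub: "cball 0 1 \<subseteq> ball (0::complex) s'" using J(1) by auto
  have outer: "H' ` cball 0 1 \<subseteq> H ` ball 0 1"
  proof -
    have "J ` cball 0 1 \<subseteq> ball 0 1" using J(3) D1 sub by blast
    then show ?thesis unfolding H'_def image_comp[symmetric] by (rule image_mono)
  qed
  have inner: "H ` cball 0 \<rho> \<subseteq> H' ` ball 0 \<rho>'"
  proof -
    have "cball 0 \<rho> \<subseteq> J ` ball 0 \<rho>1" using K(2) \<rho>1(3) by blast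
    also have "\<dots> \<subseteq> J ` ball 0 \<rho>'" using \<rho>'(1) by (intro image_mono subset_ball) simp
    finally show ?thesis unfolding H'_def image_comp[symmetric] by (rule image_mono)
  qed
  have rim: "J w \<in> D - K" if w: "w \<in> cball 0 1 - ball 0 \<rho>'" for w
  proof -
    have ws: "w \<in> ball 0 s'" using w sub by blast
    have "J w \<notin> K"
    proof
      assume "J w \<in> K"
      then obtain v where v: "v \<in> ball 0 \<rho>1" "J w = J v" using \<rho>1(3) by blast
      have vs: "v \<in> ball 0 s'" using v(1) \<rho>1(2) J(1) by auto
      have "w = v" using J(4)[OF ws] J(4)[OF vs] v(2) by metis
      then show False using v(1) w \<rho>'(1) by auto
    qed
    then show ?thesis using J(3) ws by blast
  qed
  have "crooked_shadow \<epsilon> (H' ` (cball 0 1 - ball 0 \<rho>'))"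
    unfolding crooked_shadow_def
  \<comment> \<open>The guiding curve is the boundary of the old disc; the angle is that of the old
    coordinate \<open>G z\<close> before the twist.\<close>
  proof (intro exI[of _ "\<lambda>z. \<xi> (G z)"] exI[of _ "\<lambda>t. H (cis (2 * pi * t))"] exI[of _ g] conjI)
    have Gz: "\<exists>w. z = H w \<and> G z = w \<and> w \<in> D - K" if z: "z \<in> H' ` (cball 0 1 - ball 0 \<rho>')" for z
    proof -
      obtain w where w: "z = H' w" "w \<in> cball 0 1 - ball 0 \<rho>'" using z by blast
      then have "G z = J w" using GH' sub by blast
      then show ?thesis using rim[OF w(2)] w(1) by (auto simp: H'_def)
    qed
    then have nz: "G z \<noteq> 0" if "z \<in> H' ` (cball 0 1 - ball 0 \<rho>')" for z
      using that 0(1) by (metis DiffD2)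
    show "continuous_on (H' ` (cball 0 1 - ball 0 \<rho>')) (\<lambda>z. \<xi> (G z))"
      by (rule continuous_on_compose2[OF \<xi>(1) continuous_on_subset[OF holomorphic_on_imp_continuous_on[OF G]]])
        (use nz in auto)
    show "\<forall>z\<in>H' ` (cball 0 1 - ball 0 \<rho>'). norm (\<xi> (G z)) = 1" using nz \<xi>(2) by blast
    show "continuous_on UNIV g" by (rule g)
    have "cis (2 * pi * (t + 1)) = cis (2 * pi * t)" for t unfolding cis_2pi_eq_iff by (intro exI[of _ 1]) simp
    then show "\<forall>t. H (cis (2 * pi * (t + 1))) = H (cis (2 * pi * t))" by simp
    show "\<forall>z\<in>H' ` (cball 0 1 - ball 0 \<rho>'). \<forall>x. \<xi> (G z) = cis (2 * pi * x) \<longrightarrow> dist z (H (cis (2 * pi * g x))) < \<epsilon>"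
    proof (intro ballI allI impI)
      fix z x assume z: "z \<in> H' ` (cball 0 1 - ball 0 \<rho>')" and x: "\<xi> (G z) = cis (2 * pi * x)"
      obtain w where w: "z = H w" "G z = w" "w \<in> D - K" using Gz[OF z] by blast
      then obtain X where X: "w = of_real (norm w) * cis (2 * pi * X)" "\<bar>X - g x\<bar> \<le> \<tau>" using shadow[of w x] x by auto
      have "norm w \<in> {\<rho>..1}" using w(3) K(2) D1 by (force simp: subset_iff)
      then have "dist (H (of_real (norm w) * cis (2 * pi * X))) (H (of_real 1 * cis (2 * pi * g x))) < \<epsilon>"
        using \<tau>(2)[of "norm w" 1 X "g x"] X(2) \<rho>(2) by auto
      then show "dist z (H (cis (2 * pi * g x))) < \<epsilon>" using X(1) w(1) by simp
    qed
    have close: "dist (H (cis (2 * pi * a))) (H (cis (2 * pi * b))) < \<epsilon>" if "\<bar>a - b\<bar> \<le> \<tau>" for a b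
      using \<tau>(2)[of 1 1 a b] that \<rho>(2) by simp
    show "\<forall>s t. s \<le> t \<longrightarrow> \<bar>g s - g t\<bar> \<le> 2 \<longrightarrow>
        (\<exists>c d. s \<le> c \<and> c \<le> d \<and> d \<le> t \<and> dist (H (cis (2 * pi * g c))) (H (cis (2 * pi * g t))) < \<epsilon> \<and>
          dist (H (cis (2 * pi * g d))) (H (cis (2 * pi * g s))) < \<epsilon>)"
      using retrace close by meson
  qed
  moreover have "k (G (H' w)) = w" if "w \<in> ball 0 s'" for w using GH'[OF that] J(4)[OF that] by simp
  moreover have "H' 0 = 0" using J(5) H(4) by (simp add: H'_def)
  ultimately show thesis
    using that[OF k J(1) H'_hol _ _ \<rho>'(2,3,4) outer inner] by blast
qed

lemma next_stage:
  assumes "stage n S"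
  shows "\<exists>S'. stage (Suc n) S' \<and> stage_step n S S'"
proof -
  obtain G H s \<rho> F \<theta> \<sigma> where S: "S = (G, H, s, \<rho>, F, \<theta>, \<sigma>)" by (metis prod.exhaust)
  have G: "G holomorphic_on UNIV" "\<And>z. deriv G z \<noteq> 0" "\<And>z. G z = 0 \<longleftrightarrow> z = 0"
    and H: "H holomorphic_on ball 0 s" "s > 1" "\<And>w. w \<in> ball 0 s \<Longrightarrow> G (H w) = w" "H 0 = 0"
    and \<rho>: "0 < \<rho>" "\<rho> < 1" "thin_annulus H \<rho> (1 / real (Suc n))"
    and F: "F holomorphic_on ball 0 (2 + 1 / real (Suc n))" "F 0 = 0"
      "\<And>z. z \<in> ball 0 (2 + 1 / real (Suc n)) \<Longrightarrow> G (F z) = cis (2 * pi * \<theta>) * G z"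
    and \<theta>: "\<theta> \<in> \<rat>" "0 < \<sigma>"
    using assms unfolding S stage_def by simp_all
  obtain q j where q: "q > 0" "cis (2 * pi * \<theta>) = cis (2 * pi / real q) ^ j"
    using rational_rotation_power[OF \<theta>(1)] .
  have e: "1 / real (Suc (Suc n)) > 0" by simp
  obtain k H' s' \<rho>' where k: "k holomorphic_on UNIV" "\<And>z. deriv k z \<noteq> 0" "\<And>z. k z = 0 \<longleftrightarrow> z = 0"
    and sym: "\<And>z. k (cis (2 * pi / real q) * z) = cis (2 * pi / real q) * k z"
    and H': "s' > 1" "H' holomorphic_on ball 0 s'" "\<And>w. w \<in> ball 0 s' \<Longrightarrow> k (G (H' w)) = w" "H' 0 = 0"
    and \<rho>': "0 < \<rho>'" "\<rho>' < 1" "thin_annulus H' \<rho>' (1 / real (Suc (Suc n)))"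
    and nest: "H' ` cball 0 1 \<subseteq> H ` ball 0 1" "H ` cball 0 \<rho> \<subseteq> H' ` ball 0 \<rho>'"
    and crooked: "crooked_shadow (1 / real (Suc n)) (H' ` (cball 0 1 - ball 0 \<rho>'))"
    by (rule next_annulus[OF G(1) H \<rho> q(1) e]) (assumption, rule that)
  define G' where "G' z = k (G z)" for z
  have G'_hol: "G' holomorphic_on UNIV"
    using holomorphic_on_compose_gen[OF G(1) k(1)] by (simp add: G'_def[abs_def] o_def)
  have G'_deriv: "deriv G' z \<noteq> 0" for z
  proof -
    have "(G' has_field_derivative deriv G z * deriv k (G z)) (at z)"
      unfolding G'_def[abs_def]
      using DERIV_chain'[OF holomorphic_derivI[OF G(1) open_UNIV UNIV_I] holomorphic_derivI[OF k(1) open_UNIV UNIV_I]]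
      by (simp add: mult.commute)
    then show ?thesis using G(2) k(2) by (simp add: DERIV_imp_deriv)
  qed
  have sym_pow: "k (cis (2 * pi / real q) ^ i * z) = cis (2 * pi / real q) ^ i * k z" for i z
    by (induction i) (simp_all add: sym mult.assoc)
  have G'F: "G' (F z) = cis (2 * pi * \<theta>) * G' z" if "z \<in> ball 0 (2 + 1 / real (Suc n))" for z
    using F(3)[OF that] sym_pow by (simp add: G'_def q(2))
  have R: "2 + 1 / real (Suc (Suc n)) < 2 + 1 / real (Suc n)" by (simp add: field_simps)
  \<comment> \<open>The old \<open>F\<close> is still a lift through \<open>G'\<close>, and the
    admissible change \<open>\<mu>\<close> depends on \<open>G'\<close>. So the annulus is settled
    before the rotation number moves.\<close>
  obtain \<mu> where \<mu>: "\<mu> > 0" and lift: "\<And>\<theta>'. \<bar>\<theta>' - \<theta>\<bar> < \<mu> \<Longrightarrow> \<exists>F'. F' holomorphic_on ball 0 (2 + 1 / real (Suc (Suc n))) \<and>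
       (\<forall>z\<in>ball 0 (2 + 1 / real (Suc (Suc n))). norm (F' z - F z) < (1/2) ^ n \<and> G' (F' z) = cis (2 * pi * \<theta>') * G' z)"
    by (rule rotation_lift_perturbation[OF G'_hol G'_deriv F(1) G'F R, of "(1/2) ^ n"]) (assumption, simp, rule that)
  obtain \<theta>' \<sigma>' where \<theta>': "\<theta>' \<in> \<rat>" "\<bar>\<theta>' - \<theta>\<bar> < \<mu>" "0 < \<sigma>'" "\<sigma>' \<le> (1/2) ^ Suc n" "\<bar>\<theta>' - \<theta>\<bar> + \<sigma>' \<le> \<sigma>"
      "from_nat_into \<rat> n \<notin> {\<theta>' - \<sigma>'..\<theta>' + \<sigma>'}"
    using next_rotation_number[OF \<theta>(2) \<mu>, of "(1/2) ^ Suc n" \<theta> "from_nat_into \<rat> n"] by auto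
  obtain F' where F': "F' holomorphic_on ball 0 (2 + 1 / real (Suc (Suc n)))"
    "\<And>z. z \<in> ball 0 (2 + 1 / real (Suc (Suc n))) \<Longrightarrow> norm (F' z - F z) < (1/2) ^ n"
    "\<And>z. z \<in> ball 0 (2 + 1 / real (Suc (Suc n))) \<Longrightarrow> G' (F' z) = cis (2 * pi * \<theta>') * G' z"
    using lift[OF \<theta>'(2)] by blast
  have G'0: "G' z = 0 \<longleftrightarrow> z = 0" for z using G(3) k(3) by (simp add: G'_def)
  have pos: "2 + 1 / real (Suc (Suc n)) > 2" by simp
  then have "0 \<in> ball (0::complex) (2 + 1 / real (Suc (Suc n)))" unfolding mem_ball dist_self by linarith
  from F'(3)[OF this] have "G' (F' 0) = 0" using G'0[of 0] by simp
  \<comment> \<open>The lift was chosen by nearness alone; it fixes 0 because \<open>G'\<close> has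
    no other zero.\<close>
  then have F'0: "F' 0 = 0" using G'0 by simp
  have "stage (Suc n) (G', H', s', \<rho>', F', \<theta>', \<sigma>')"
    unfolding stage_def using G'_hol G'_deriv G'0 H' \<rho>' F'(1,3) F'0 \<theta>'(1,3,4) by (simp add: G'_def)
  moreover have "stage_step n S (G', H', s', \<rho>', F', \<theta>', \<sigma>')"
  proof -
    have "norm (F' z - F z) \<le> (1/2) ^ n" if "z \<in> ball 0 2" for z
    proof -
      have "z \<in> ball 0 (2 + 1 / real (Suc (Suc n)))" using that pos unfolding mem_ball by linarith
      then show ?thesis by (rule less_imp_le[OF F'(2)])
    qed
    then show ?thesis unfolding S stage_step_def using nest crooked \<theta>'(5,6) by simp
  qed
  ultimately show ?thesis by blast
qed

lemma siegel_tower_exists: "\<exists>G H s \<rho> F \<theta> \<sigma>. siegel_tower G H s \<rho> F \<theta> \<sigma>"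
proof -
  obtain S where S: "\<And>n. stage n (S n)" "\<And>n. stage_step n (S n) (S (Suc n))"
    using dependent_nat_choice[of stage stage_step] first_stage next_stage by metis
  define G where "G n = fst (S n)" for n
  define H where "H n = fst (snd (S n))" for n
  define s where "s n = fst (snd (snd (S n)))" for n
  define \<rho> where "\<rho> n = fst (snd (snd (snd (S n))))" for n
  define F where "F n = fst (snd (snd (snd (snd (S n)))))" for n
  define \<theta> where "\<theta> n = fst (snd (snd (snd (snd (snd (S n))))))" for n
  define \<sigma> where "\<sigma> n = snd (snd (snd (snd (snd (snd (S n))))))" for n
  have eq: "S n = (G n, H n, s n, \<rho> n, F n, \<theta> n, \<sigma> n)" for n
    by (simp add: G_def H_def s_def \<rho>_def F_def \<theta>_def \<sigma>_def)
  note st = S(1)[unfolded eq stage_def split_conv]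
  note step = S(2)[unfolded eq stage_step_def split_conv]
  have sub: "ball 0 2 \<subseteq> ball (0::complex) (2 + 1 / real (Suc n))" for n by (intro subset_ball) simp
  have "siegel_tower G H s \<rho> F \<theta> \<sigma>"
  proof
    fix n
    show "G n holomorphic_on UNIV" using st[of n] by (elim conjE)
    show "H n holomorphic_on ball 0 (s n)" using st[of n] by (elim conjE)
    show "s n > 1" using st[of n] by (elim conjE)
    show "H n 0 = 0" using st[of n] by (elim conjE)
    show "0 < \<rho> n" using st[of n] by (elim conjE)
    show "\<rho> n < 1" using st[of n] by (elim conjE)
    show "F n 0 = 0" using st[of n] by (elim conjE)
    show "\<sigma> n \<le> (1/2) ^ n" using st[of n] by (elim conjE)
    have "0 < \<sigma> n" using st[of n] by (elim conjE)
    then show "0 \<le> \<sigma> n" by simp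
    have "\<forall>w\<in>ball 0 (s n). G n (H n w) = w" using st[of n] by (elim conjE)
    then show "G n (H n w) = w" if "w \<in> ball 0 (s n)" for w using that by blast
    have "thin_annulus (H n) (\<rho> n) (1 / real (Suc n))" using st[of n] by (elim conjE)
    then show "\<exists>\<tau>>0. \<forall>r r' x x'. r \<in> {\<rho> n..1} \<longrightarrow> r' \<in> {\<rho> n..1} \<longrightarrow> \<bar>x - x'\<bar> \<le> \<tau> \<longrightarrow>
      dist (H n (of_real r * cis (2 * pi * x))) (H n (of_real r' * cis (2 * pi * x'))) < 1 / real (Suc n)"
      unfolding thin_annulus_def .
    have "0 = (0::nat) \<longrightarrow> H 0 ` cball 0 1 \<subseteq> cball 0 1" using st[of 0] by (elim conjE)
    then show "H 0 ` cball 0 1 \<subseteq> cball 0 1" by simp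
    have "F n holomorphic_on ball 0 (2 + 1 / real (Suc n))" using st[of n] by (elim conjE)
    then show "F n holomorphic_on ball 0 2" using sub by (rule holomorphic_on_subset)
    have "\<forall>z\<in>ball 0 (2 + 1 / real (Suc n)). G n (F n z) = cis (2 * pi * \<theta> n) * G n z" using st[of n] by (elim conjE)
    then show "G n (F n z) = cis (2 * pi * \<theta> n) * G n z" if "z \<in> ball 0 2" for z using sub that by blast
    show "H (Suc n) ` cball 0 1 \<subseteq> H n ` ball 0 1" using step[of n] by (elim conjE)
    show "H n ` cball 0 (\<rho> n) \<subseteq> H (Suc n) ` ball 0 (\<rho> (Suc n))" using step[of n] by (elim conjE)
    show "crooked_shadow (1 / real (Suc n)) (H (Suc n) ` (cball 0 1 - ball 0 (\<rho> (Suc n))))" using step[of n] by (elim conjE)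
    show "\<bar>\<theta> (Suc n) - \<theta> n\<bar> + \<sigma> (Suc n) \<le> \<sigma> n" using step[of n] by (elim conjE)
    show "from_nat_into \<rat> n \<notin> {\<theta> (Suc n) - \<sigma> (Suc n)..\<theta> (Suc n) + \<sigma> (Suc n)}" using step[of n] by (elim conjE)
    have "\<forall>z\<in>ball 0 2. norm (F (Suc n) z - F n z) \<le> (1/2) ^ n" using step[of n] by (elim conjE)
    then show "norm (F (Suc n) z - F n z) \<le> (1/2) ^ n" if "z \<in> ball 0 2" for z using that by blast
  qed
  then show ?thesis by blast
qed

theorem theorem1:
  shows "\<exists>(U :: complex set) (f :: complex \<Rightarrow> complex) (\<Delta> :: complex set).
           open U \<and> simply_connected U \<and> 0 \<in> U \<and>
           f holomorphic_on U \<and> f 0 = 0 \<and>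
           siegel_disk f U \<Delta> \<and>
           compact (closure \<Delta>) \<and> closure \<Delta> \<subseteq> U \<and>
           pseudo_circle (frontier \<Delta>)"
proof -
  obtain G H s \<rho> F \<theta> \<sigma> where "siegel_tower G H s \<rho> F \<theta> \<sigma>" using siegel_tower_exists by blast
  then interpret siegel_tower G H s \<rho> F \<theta> \<sigma> .
  show ?thesis
  proof (intro exI conjI)
    show "simply_connected (ball (0::complex) 2)" by (rule convex_imp_simply_connected) simp
    show "compact (closure core)" "closure core \<subseteq> ball 0 2" using filled_compact filled_sub2 by (simp_all add: closure_core)
    show "pseudo_circle (frontier core)" using rim_pseudo_circle by (simp add: frontier_core)
  qed (use limit_map_holomorphic limit_map_0 siegel_disk_core in auto)
qed

end
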